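(* Let $T\ge 1$ and $n\ge 1$ be integers and $d\ge 1$. For each domain $t=1,\dots,T$, let $p_t$ be a distribution on $\mathbb{R}^d$ with $\mathbb{E}_{\boldsymbol{x}\sim p_t}\boldsymbol{x}=0$ and $\mathbb{E}_{\boldsymbol{x}\sim p_t}\boldsymbol{x}\boldsymbol{x}^\top=\Sigma_t$, and let $X_t\in\mathbb{R}^{n\times d}$ have rows drawn from $p_t$. Let $\theta^*\in\mathbb{R}^d$ be the ground-truth parameter and let the labels be $Y_t=X_t\theta^*+\epsilon_t\in\mathbb{R}^n$ with $\epsilon_t\sim\mathcal{N}(0,\sigma I_n)$. Assume: (i) there is a positive semi-definite matrix $\Sigma$ with $\Sigma_t\preceq\Sigma$ for every $t$; (ii) there is $\rho>0$ such that for every $t$ the whitened vector $\bar{\boldsymbol{x}}=\Sigma_t^{-1/2}\boldsymbol{x}$, $\boldsymbol{x}\sim p_t$, is $\rho^2$-subgaussian. Let $\hat\theta$ be a minimizer of $$\min_{\theta\in\mathbb{R}^d}\ \frac{1}{2nT}\|\mathcal{X}(\theta)-Y\|_F^2+\lambda_1\|\theta\|_1+\lambda_2\|\theta\|_2,$$ where $\mathcal{X}(\theta)=[X_1\theta,\dots,X_T\theta]\in\mathbb{R}^{n\times T}$ and $Y=[Y_1,\dots,Y_T]\in\mathbb{R}^{n\times T}$, and let $\Delta=\hat\theta-\theta^*$. Fix a failure probability $\delta\in(0,1)$. Then, for a proper choice of $\lambda_1,\lambda_2$, with probability at least $1-\delta$ over the training samples, $$\frac{1}{2T}\sum_{t=1}^T\mathbb{E}_{\boldsymbol{x}\sim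 p_t}\big[(\boldsymbol{x}^\top\Delta)^2\big]\le \tilde{O}\!\left(\frac{\sigma R\sqrt{\mathrm{Tr}(\Sigma)}}{\sqrt{nT}}\right)+\tilde{O}\!\left(\frac{\rho^4R^2\,\mathrm{Tr}(\Sigma)}{nT}\right),$$ where $R=\|\theta^*\|_1$.
   Context: $\|\cdot\|_1,\|\cdot\|_2$ are vector $\ell_1,\ell_2$ norms, $\|\cdot\|_F$ is the Frobenius norm, and $A\preceq B$ is the Loewner order. $\tilde O(\cdot)$ hides absolute constants and logarithmic factors (in particular factors polylogarithmic in $1/\delta$).
   Formalization: The noise is taken with standard deviation σ > 0 (covariance σ²I_n); with covariance σI_n as written the bound fails for small σ (e.g. d=T=1, θ*=√(σ/n)). Each Σ_t is assumed positive definite so that Σ_t^{-1/2} exists. *)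

theory Defs
  imports "HOL-Probability.Probability"
begin

text \<open>Vectors of R^d are represented as functions nat => real of which only the
coordinates 0..d-1 matter; d x d matrices as nat => nat => real (entries i,j < d).
The dimension d is an explicit natural number so that the constants hidden in the
O-tilde can be quantified uniformly over d.\<close>

definition ip :: "nat \<Rightarrow> (nat \<Rightarrow> real) \<Rightarrow> (nat \<Rightarrow> real) \<Rightarrow> real" where
  "ip d x y = (\<Sum>j<d. x j * y j)"

definition l1n :: "nat \<Rightarrow> (nat \<Rightarrow> real) \<Rightarrow> real" where
  "l1n d x = (\<Sum>j<d. \<bar>x j\<bar>)"

definition l2n :: "nat \<Rightarrow> (nat \<Rightarrow> real) \<Rightarrow> real" where
  "l2n d x = sqrt (ip d x x)"

definition mmul :: "nat \<Rightarrow> (nat \<Rightarrow> nat \<Rightarrow> real) \<Rightarrow> (nat \<Rightarrow> nat \<Rightarrow> real) \<Rightarrow> (nat \<Rightarrow> nat \<Rightarrow> real)" where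
  "mmul d A B = (\<lambda>i j. \<Sum>k<d. A i k * B k j)"

definition mvec :: "nat \<Rightarrow> (nat \<Rightarrow> nat \<Rightarrow> real) \<Rightarrow> (nat \<Rightarrow> real) \<Rightarrow> (nat \<Rightarrow> real)" where
  "mvec d A x = (\<lambda>i. \<Sum>j<d. A i j * x j)"

definition msym :: "nat \<Rightarrow> (nat \<Rightarrow> nat \<Rightarrow> real) \<Rightarrow> bool" where
  "msym d A \<longleftrightarrow> (\<forall>i<d. \<forall>j<d. A i j = A j i)"

definition psd :: "nat \<Rightarrow> (nat \<Rightarrow> nat \<Rightarrow> real) \<Rightarrow> bool" where
  "psd d A \<longleftrightarrow> msym d A \<and> (\<forall>x. 0 \<le> ip d x (mvec d A x))"

definition pd :: "nat \<Rightarrow> (nat \<Rightarrow> nat \<Rightarrow> real) \<Rightarrow> bool" where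
  "pd d A \<longleftrightarrow> msym d A \<and> (\<forall>x. (\<exists>i<d. x i \<noteq> 0) \<longrightarrow> 0 < ip d x (mvec d A x))"

definition loewner_le :: "nat \<Rightarrow> (nat \<Rightarrow> nat \<Rightarrow> real) \<Rightarrow> (nat \<Rightarrow> nat \<Rightarrow> real) \<Rightarrow> bool" where
  "loewner_le d A B \<longleftrightarrow> psd d (\<lambda>i j. B i j - A i j)"

definition mtrace :: "nat \<Rightarrow> (nat \<Rightarrow> nat \<Rightarrow> real) \<Rightarrow> real" where
  "mtrace d A = (\<Sum>i<d. A i i)"

definition dmat :: "nat \<Rightarrow> (nat \<Rightarrow> nat \<Rightarrow> real) \<Rightarrow> bool" where
  "dmat d A \<longleftrightarrow> (\<forall>i j. \<not> (i < d \<and> j < d) \<longrightarrow> A i j = 0)"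

definition mat_sqrt :: "nat \<Rightarrow> (nat \<Rightarrow> nat \<Rightarrow> real) \<Rightarrow> (nat \<Rightarrow> nat \<Rightarrow> real)" where
  "mat_sqrt d A = (THE S. dmat d S \<and> psd d S \<and> (\<forall>i<d. \<forall>j<d. mmul d S S i j = A i j))"

definition mat_inv :: "nat \<Rightarrow> (nat \<Rightarrow> nat \<Rightarrow> real) \<Rightarrow> (nat \<Rightarrow> nat \<Rightarrow> real)" where
  "mat_inv d A = (THE B. dmat d B \<and> (\<forall>i<d. \<forall>j<d. mmul d A B i j = (if i = j then 1 else 0)))"

definition inv_sqrt :: "nat \<Rightarrow> (nat \<Rightarrow> nat \<Rightarrow> real) \<Rightarrow> (nat \<Rightarrow> nat \<Rightarrow> real)" where
  "inv_sqrt d A = mat_inv d (mat_sqrt d A)"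

definition subgaussian_rv :: "'a measure \<Rightarrow> ('a \<Rightarrow> real) \<Rightarrow> real \<Rightarrow> bool" where
  "subgaussian_rv M Z s \<longleftrightarrow>
     (\<forall>l::real. integrable M (\<lambda>w. exp (l * Z w)) \<and>
                (\<integral>w. exp (l * Z w) \<partial>M) \<le> exp (l\<^sup>2 * s / 2))"

definition subgaussian_vec :: "nat \<Rightarrow> 'a measure \<Rightarrow> ('a \<Rightarrow> nat \<Rightarrow> real) \<Rightarrow> real \<Rightarrow> bool" where
  "subgaussian_vec d M V s \<longleftrightarrow> (\<forall>u. l2n d u = 1 \<longrightarrow> subgaussian_rv M (\<lambda>w. ip d u (V w)) s)"

text \<open>Training-sample space: for each domain t < T and row i < n an independent pair
 (x, e) with x ~ p t and e ~ N(0, sigma^2).\<close>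
definition train_space :: "nat \<Rightarrow> nat \<Rightarrow> (nat \<Rightarrow> (nat \<Rightarrow> real) measure) \<Rightarrow> real
     \<Rightarrow> (nat \<times> nat \<Rightarrow> (nat \<Rightarrow> real) \<times> real) measure" where
  "train_space n T p \<sigma> =
     PiM ({..<T} \<times> {..<n}) (\<lambda>(t, i). p t \<Otimes>\<^sub>M density lborel (normal_density 0 \<sigma>))"

definition lasso_obj :: "nat \<Rightarrow> nat \<Rightarrow> nat \<Rightarrow> (nat \<Rightarrow> real) \<Rightarrow> real \<Rightarrow> real
     \<Rightarrow> (nat \<times> nat \<Rightarrow> (nat \<Rightarrow> real) \<times> real) \<Rightarrow> (nat \<Rightarrow> real) \<Rightarrow> real" where
  "lasso_obj d n T \<theta>s lam1 lam2 \<omega> \<theta> =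
     1 / (2 * real n * real T) *
       (\<Sum>t<T. \<Sum>i<n. (ip d (fst (\<omega> (t, i))) \<theta> - (ip d (fst (\<omega> (t, i))) \<theta>s + snd (\<omega> (t, i))))\<^sup>2)
     + lam1 * l1n d \<theta> + lam2 * l2n d \<theta>"

end

theory Submission
  imports Defs
begin

text \<open>
  Only the l1 penalty is needed, so \<open>\<lambda>\<^sub>2 = 0\<close>. If \<open>\<lambda>\<^sub>1\<close> dominates twice the sup norm of the
  averaged noise \<open>X\<^sup>T \<epsilon> / (nT)\<close>, optimality of the estimator gives \<open>\<parallel>\<Delta>\<parallel>\<^sub>1 \<le> 4 R\<close> and an empirical
  risk of at most \<open>2 \<lambda>\<^sub>1 R\<close>. The population risk must then be controlled by the empirical one
  uniformly over an l1 ball, at the fast rate \<open>1 / (nT)\<close>, although the domains may have wildly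
  different scales.

  The domains are sorted into dyadic levels according to the size \<open>u\<close> of
  \<open>q\<^sub>t(v) = v\<^sup>T \<Sigma>\<^sub>t v\<close>. On level \<open>u\<close>, Maurey's argument replaces \<open>v\<close> by an average of about
  \<open>\<rho>\<^sup>2 Tr(\<Sigma>) / u\<close> signed unit vectors, which moves every sample projection and every \<open>q\<^sub>t\<close> by a small
  multiple of \<open>u\<close>. There are \<open>exp(\<rho>\<^sup>2 Tr(\<Sigma>) / u)\<close> such averages up to logarithms, and the one-sided
  Chernoff bound for sums of squares fails on one of them with probability
  \<open>exp(- m / \<rho>\<^sup>2)\<close>, where \<open>m\<close> is the number of samples on the level.
  Hence a level with \<open>m u\<close> beyond \<open>\<rho>\<^sup>4 Tr(\<Sigma>)\<close> survives the union bound, the other levels contribute at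
  most \<open>\<rho>\<^sup>4 Tr(\<Sigma>)\<close> each, and there are only logarithmically many levels. Getting
  \<open>\<rho>\<^sup>4\<close> rather than \<open>\<rho>\<^sup>6\<close> uses that the fourth moment of a projection is \<open>\<rho>\<^sup>2 q\<^sub>t\<^sup>2\<close> up to
  logarithms of \<open>nT\<close> as long as \<open>\<rho>\<^sup>4 \<le> nT\<close>; otherwise the claim is trivial since
  \<open>q\<^sub>t(\<Delta>) \<le> 16 R\<^sup>2 Tr(\<Sigma>)\<close>.
\<close>

section \<open>Finite-dimensional linear algebra\<close>

lemma ip_commute: "ip d x y = ip d y x"
  by (simp add: ip_def mult.commute)

lemma ip_add_right: "ip d z (\<lambda>j. x j + y j) = ip d z x + ip d z y"
  by (simp add: ip_def algebra_simps sum.distrib)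

lemma ip_diff_left: "ip d (\<lambda>j. x j - y j) z = ip d x z - ip d y z"
  by (simp add: ip_def algebra_simps sum_subtractf)

lemma ip_diff_right: "ip d z (\<lambda>j. x j - y j) = ip d z x - ip d z y"
  by (simp add: ip_def algebra_simps sum_subtractf)

lemma ip_scale_left: "ip d (\<lambda>j. c * x j) z = c * ip d x z"
  by (simp add: ip_def algebra_simps sum_distrib_left)

lemma ip_scale_right: "ip d z (\<lambda>j. c * x j) = c * ip d z x"
  by (simp add: ip_def algebra_simps sum_distrib_left)

lemma ip_cong: "(\<And>j. j < d \<Longrightarrow> x j = x' j) \<Longrightarrow> (\<And>j. j < d \<Longrightarrow> y j = y' j) \<Longrightarrow> ip d x y = ip d x' y'"
  by (simp add: ip_def)

lemma ip_self_nonneg: "0 \<le> ip d x x"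
  by (simp add: ip_def sum_nonneg)

lemma ip_self_eq_0_iff: "ip d x x = 0 \<longleftrightarrow> (\<forall>j<d. x j = 0)"
  by (auto simp: ip_def sum_nonneg_eq_0_iff)

lemma l2n_sq: "(l2n d x)\<^sup>2 = ip d x x"
  by (simp add: l2n_def ip_self_nonneg)

lemma l2n_eq_L2_set: "l2n d x = L2_set x {..<d}"
  by (simp add: l2n_def ip_def L2_set_def power2_eq_square)

lemma l2n_nonneg: "0 \<le> l2n d x"
  by (simp add: l2n_eq_L2_set)

lemma ip_single: "k < d \<Longrightarrow> ip d x (\<lambda>j. if j = k then c else 0) = x k * c"
  by (simp add: ip_def if_distrib[of "\<lambda>c. _ * c"] cong: if_cong)

lemma mvec_single: "k < d \<Longrightarrow> mvec d A (\<lambda>j. if j = k then 1 else 0) i = A i k"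
  by (simp add: mvec_def if_distrib[of "\<lambda>c. _ * c"] cong: if_cong)

lemma mvec_eq_ip: "mvec d A x i = ip d (A i) x"
  by (simp add: mvec_def ip_def)

lemma mvec_mmul: "mvec d (mmul d A B) x i = mvec d A (mvec d B x) i"
  unfolding mvec_def mmul_def
  by (simp add: sum_distrib_left sum_distrib_right mult.assoc) (rule sum.swap)

lemma mvec_diff: "mvec d A (\<lambda>j. x j - y j) i = mvec d A x i - mvec d A y i"
  by (simp add: mvec_eq_ip ip_diff_right)

lemma mvec_scale: "mvec d A (\<lambda>j. c * x j) i = c * mvec d A x i"
  by (simp add: mvec_eq_ip ip_scale_right)

lemma ip_mvec_sym:
  assumes "msym d A"
  shows "ip d x (mvec d A y) = ip d (mvec d A x) y"
proof -
  have "ip d x (mvec d A y) = (\<Sum>i<d. \<Sum>j<d. x i * A i j * y j)"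
    by (simp add: ip_def mvec_def sum_distrib_left mult.assoc)
  also have "\<dots> = (\<Sum>j<d. \<Sum>i<d. x i * A i j * y j)"
    by (rule sum.swap)
  also have "\<dots> = (\<Sum>j<d. \<Sum>i<d. A j i * x i * y j)"
    using assms by (intro sum.cong) (auto simp: msym_def)
  finally show ?thesis
    by (simp add: ip_def mvec_def sum_distrib_right)
qed

section \<open>Operator-norm bounds and fixed points of matrix maps\<close>

definition op_bound :: "nat \<Rightarrow> (nat \<Rightarrow> nat \<Rightarrow> real) \<Rightarrow> real \<Rightarrow> bool" where
  "op_bound d A r \<longleftrightarrow> (\<forall>x. l2n d (mvec d A x) \<le> r * l2n d x)"

lemma l2n_cong: "(\<And>j. j < d \<Longrightarrow> x j = x' j) \<Longrightarrow> l2n d x = l2n d x'"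
  unfolding l2n_def using ip_cong by metis

lemma l2n_add_le: "l2n d (\<lambda>j. x j + y j) \<le> l2n d x + l2n d y"
  unfolding l2n_eq_L2_set by (rule L2_set_triangle_ineq)

lemma op_bound_add:
  assumes "op_bound d A a" "op_bound d B b"
  shows "op_bound d (\<lambda>i j. A i j + B i j) (a + b)"
  unfolding op_bound_def
proof
  fix x
  have "l2n d (mvec d (\<lambda>i j. A i j + B i j) x) = l2n d (\<lambda>i. mvec d A x i + mvec d B x i)"
    by (rule l2n_cong) (simp add: mvec_def algebra_simps sum.distrib)
  also have "\<dots> \<le> l2n d (mvec d A x) + l2n d (mvec d B x)"
    by (rule l2n_add_le)
  also have "\<dots> \<le> a * l2n d x + b * l2n d x"
    using assms by (intro add_mono) (auto simp: op_bound_def)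
  finally show "l2n d (mvec d (\<lambda>i j. A i j + B i j) x) \<le> (a + b) * l2n d x"
    by (simp add: algebra_simps)
qed

lemma op_bound_scale:
  assumes "op_bound d A a"
  shows "op_bound d (\<lambda>i j. c * A i j) (\<bar>c\<bar> * a)"
  unfolding op_bound_def
proof
  fix x
  have "l2n d (mvec d (\<lambda>i j. c * A i j) x) = l2n d (\<lambda>i. c * mvec d A x i)"
    by (rule l2n_cong) (simp add: mvec_def sum_distrib_left mult.assoc)
  also have "\<dots> = \<bar>c\<bar> * l2n d (mvec d A x)"
    by (simp add: l2n_def ip_scale_left ip_scale_right real_sqrt_mult flip: mult.assoc)
  also have "\<dots> \<le> \<bar>c\<bar> * (a * l2n d x)"
    using assms by (intro mult_left_mono) (auto simp: op_bound_def)
  finally show "l2n d (mvec d (\<lambda>i j. c * A i j) x) \<le> \<bar>c\<bar> * a * l2n d x"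
    by (simp add: algebra_simps)
qed

lemma op_bound_mmul:
  assumes "op_bound d A a" "op_bound d B b" "0 \<le> a"
  shows "op_bound d (mmul d A B) (a * b)"
  unfolding op_bound_def
proof
  fix x
  have "l2n d (mvec d (mmul d A B) x) = l2n d (mvec d A (mvec d B x))"
    by (rule l2n_cong) (simp add: mvec_mmul)
  also have "\<dots> \<le> a * l2n d (mvec d B x)"
    using assms by (simp add: op_bound_def)
  also have "\<dots> \<le> a * (b * l2n d x)"
    using assms by (intro mult_left_mono) (auto simp: op_bound_def)
  finally show "l2n d (mvec d (mmul d A B) x) \<le> a * b * l2n d x"
    by (simp add: algebra_simps)
qed

lemma op_bound_mono: "op_bound d A a \<Longrightarrow> a \<le> b \<Longrightarrow> op_bound d A b"
  unfolding op_bound_def by (meson l2n_nonneg mult_right_mono order_trans)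

lemma op_bound_entry:
  assumes "op_bound d A r" "i < d" "j < d"
  shows "\<bar>A i j\<bar> \<le> r"
proof -
  let ?e = "\<lambda>l. if l = j then 1 else (0::real)"
  have "\<bar>A i j\<bar> = \<bar>mvec d A ?e i\<bar>"
    using assms by (simp add: mvec_single)
  also have "\<dots> \<le> L2_set (\<lambda>i. \<bar>mvec d A ?e i\<bar>) {..<d}"
    using assms by (intro member_le_L2_set) auto
  also have "\<dots> = l2n d (mvec d A ?e)"
    unfolding l2n_eq_L2_set by (simp add: L2_set_def)
  also have "\<dots> \<le> r * l2n d ?e"
    using assms by (simp add: op_bound_def)
  also have "l2n d ?e = 1"
    using assms by (simp add: l2n_def ip_single)
  finally show ?thesis by simp
qed

lemma op_bound_0: "0 \<le> r \<Longrightarrow> op_bound d (\<lambda>i j. 0) r"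
  by (simp add: op_bound_def mvec_def l2n_def ip_def sum_nonneg)

lemma op_bound_1: "op_bound d (\<lambda>i j. if i = j then 1 else 0) 1"
proof -
  have "l2n d (mvec d (\<lambda>i j. if i = j then 1 else 0) x) = l2n d x" for x
    by (rule l2n_cong) (simp add: mvec_def if_distrib[of "\<lambda>c. c * _"] cong: if_cong)
  then show ?thesis by (simp add: op_bound_def)
qed

lemma op_bound_limit:
  assumes "\<And>k. op_bound d (Z k) r"
    and lim: "\<And>i j. i < d \<Longrightarrow> j < d \<Longrightarrow> (\<lambda>k. Z k i j) \<longlonglongrightarrow> Y i j"
  shows "op_bound d Y r"
  unfolding op_bound_def
proof
  fix x
  have "(\<lambda>k. l2n d (mvec d (Z k) x)) \<longlonglongrightarrow> l2n d (mvec d Y x)"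
    unfolding l2n_def ip_def mvec_def by (intro tendsto_intros lim) auto
  moreover have "l2n d (mvec d (Z k) x) \<le> r * l2n d x" for k
    using assms by (simp add: op_bound_def)
  ultimately show "l2n d (mvec d Y x) \<le> r * l2n d x"
    using LIMSEQ_le_const2 by blast
qed

text \<open>Banach iteration from the zero matrix: consecutive iterates differ by at most
  \<open>r ^ k * \<bar>R\<bar>\<close> in operator norm, so each entry is a convergent telescoping
  series. \<open>P\<close> plays the role of an invariant closed set; limits and the fixed-point
  equation are entrywise because only indices below \<open>d\<close> carry meaning.\<close>

lemma matrix_contraction:
  fixes F :: "(nat \<Rightarrow> nat \<Rightarrow> real) \<Rightarrow> (nat \<Rightarrow> nat \<Rightarrow> real)"
  assumes r: "0 \<le> r" "r < 1"
    and P0: "P (\<lambda>i j. 0)"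
    and PF: "\<And>A. P A \<Longrightarrow> P (F A)"
    and Pb: "\<And>A. P A \<Longrightarrow> op_bound d A R"
    and contr: "\<And>A B s. P A \<Longrightarrow> P B \<Longrightarrow> 0 \<le> s \<Longrightarrow> op_bound d (\<lambda>i j. A i j - B i j) s
          \<Longrightarrow> op_bound d (\<lambda>i j. F A i j - F B i j) (r * s)"
    and cont: "\<And>Z Y i j. (\<And>i j. i < d \<Longrightarrow> j < d \<Longrightarrow> (\<lambda>k. Z k i j) \<longlonglongrightarrow> Y i j) \<Longrightarrow> i < d \<Longrightarrow> j < d
          \<Longrightarrow> (\<lambda>k. F (Z k) i j) \<longlonglongrightarrow> F Y i j"
    and Plim: "\<And>Z Y. (\<And>k. P (Z k)) \<Longrightarrow>
          (\<And>i j. i < d \<Longrightarrow> j < d \<Longrightarrow> (\<lambda>k. Z k i j) \<longlonglongrightarrow> Y i j) \<Longrightarrow> P Y"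
  shows "\<exists>Y. P Y \<and> (\<forall>i<d. \<forall>j<d. F Y i j = Y i j)"
proof -
  define Z where "Z k = (F ^^ k) (\<lambda>i j. 0)" for k
  have ZS: "Z (Suc k) = F (Z k)" for k by (simp add: Z_def)
  have PZ: "P (Z k)" for k
    by (induction k) (auto simp: ZS PF, simp add: Z_def P0)
  have diff: "op_bound d (\<lambda>i j. Z (Suc k) i j - Z k i j) (r ^ k * \<bar>R\<bar>)" for k
  proof (induction k)
    case 0
    have "op_bound d (Z 1) \<bar>R\<bar>"
      using op_bound_mono[OF Pb[OF PZ], of "\<bar>R\<bar>"] by simp
    then show ?case by (simp add: Z_def)
  next
    case (Suc k)
    then show ?case
      using contr[OF PZ PZ _ Suc.IH] r by (simp add: ZS mult.assoc)
  qed
  have conv: "convergent (\<lambda>k. Z k i j)" if "i < d" "j < d" for i j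
  proof -
    have "summable (\<lambda>k. Z (Suc k) i j - Z k i j)"
    proof (rule summable_comparison_test'[where N = 0])
      show "summable (\<lambda>k. r ^ k * \<bar>R\<bar>)"
        using r by (intro summable_mult2 summable_geometric) auto
      show "norm (Z (Suc k) i j - Z k i j) \<le> r ^ k * \<bar>R\<bar>" for k
        using op_bound_entry[OF diff that] by simp
    qed
    then have "convergent (\<lambda>n. \<Sum>k<n. Z (Suc k) i j - Z k i j)"
      by (simp add: summable_iff_convergent)
    moreover have "(\<Sum>k<n. Z (Suc k) i j - Z k i j) = Z n i j - Z 0 i j" for n
      using sum_lessThan_telescope[of "\<lambda>k. Z k i j" n] by simp
    ultimately have "convergent (\<lambda>n. Z n i j - Z 0 i j)" by simp
    from convergent_add[OF this convergent_const[of "Z 0 i j"]] show ?thesis by simp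
  qed
  define Y where "Y i j = lim (\<lambda>k. Z k i j)" for i j
  have lim: "(\<lambda>k. Z k i j) \<longlonglongrightarrow> Y i j" if "i < d" "j < d" for i j
    using conv[OF that] by (simp add: Y_def convergent_LIMSEQ_iff)
  have "P Y" using PZ lim by (rule Plim)
  moreover have "F Y i j = Y i j" if "i < d" "j < d" for i j
  proof (rule LIMSEQ_unique)
    show "(\<lambda>k. Z (Suc k) i j) \<longlonglongrightarrow> F Y i j"
      unfolding ZS using lim that by (rule cont)
    show "(\<lambda>k. Z (Suc k) i j) \<longlonglongrightarrow> Y i j"
      using lim[OF that] by (rule LIMSEQ_Suc)
  qed
  ultimately show ?thesis by blast
qed

section \<open>Positive definite matrices, their square roots and inverses\<close>

text \<open>The constant is the minimum of the form over the unit sphere, extended by homogeneity.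
  Coordinates from \<open>d\<close> on are pinned to 0, so the sphere is closed in a product of
  compact sets and Tychonoff applies.\<close>

lemma pd_lower_bound:
  assumes "pd d A" "1 \<le> d"
  shows "\<exists>a>0. \<forall>x. a * ip d x x \<le> ip d x (mvec d A x)"
proof -
  define K where "K = PiE UNIV (\<lambda>i. if i < d then {-1..1::real} else {0}) \<inter> {x. ip d x x = 1}"
  have cont: "continuous_on UNIV (\<lambda>x. ip d x x)" "continuous_on UNIV (\<lambda>x. ip d x (mvec d A x))"
    unfolding ip_def mvec_def
    by (intro continuous_on_sum continuous_on_mult continuous_on_const continuous_on_product_coordinates)+
  have "compactin (product_topology (\<lambda>i. euclidean) UNIV)
          (PiE UNIV (\<lambda>i::nat. if i < d then {-1..1::real} else {0}))"
    by (subst compactin_PiE) auto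
  then have "compact (PiE UNIV (\<lambda>i::nat. if i < d then {-1..1::real} else {0}))"
    by (simp add: euclidean_product_topology)
  moreover have "closed {x. ip d x x = 1}"
    using continuous_closed_preimage_constant[OF cont(1) closed_UNIV, of 1] by simp
  ultimately have "compact K"
    unfolding K_def by (rule compact_Int_closed)
  moreover have "(\<lambda>j. if j = 0 then 1 else 0) \<in> K"
    using assms(2) by (auto simp: K_def ip_single)
  moreover have "continuous_on K (\<lambda>x. ip d x (mvec d A x))"
    using cont(2) continuous_on_subset by blast
  ultimately obtain z where z: "z \<in> K" "\<And>x. x \<in> K \<Longrightarrow> ip d z (mvec d A z) \<le> ip d x (mvec d A x)"
    using continuous_attains_inf[of K "\<lambda>x. ip d x (mvec d A x)"] by blast
  define a where "a = ip d z (mvec d A z)"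
  have "\<exists>i<d. z i \<noteq> 0"
  proof (rule ccontr)
    assume "\<not> ?thesis"
    then have "ip d z z = 0" by (auto simp: ip_def)
    with z show False by (simp add: K_def)
  qed
  then have "0 < a" using assms unfolding a_def pd_def by blast
  moreover have "a * ip d x x \<le> ip d x (mvec d A x)" for x
  proof (cases "ip d x x = 0")
    case True
    then have "ip d x (mvec d A x) = 0"
      by (simp add: ip_self_eq_0_iff) (simp add: ip_def)
    with True show ?thesis by simp
  next
    case False
    define l where "l = l2n d x"
    have l2: "l\<^sup>2 = ip d x x" by (simp add: l_def l2n_sq)
    have l: "0 < l" using False l2 l2n_nonneg[of d x] by (cases "l = 0") (auto simp: l_def)
    define y where "y j = (if j < d then (1/l) * x j else 0)" for j
    have yip: "ip d y y = 1"
    proof -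
      have "ip d y y = ip d (\<lambda>j. (1/l) * x j) (\<lambda>j. (1/l) * x j)"
        by (rule ip_cong) (auto simp: y_def)
      also have "\<dots> = ip d x x / l\<^sup>2"
        unfolding ip_scale_left ip_scale_right by (simp add: power2_eq_square)
      finally show ?thesis using False l2 by simp
    qed
    have "\<bar>y j\<bar> \<le> 1" if "j < d" for j
    proof -
      have "(y j)\<^sup>2 \<le> (\<Sum>j<d. (y j)\<^sup>2)"
        using that by (intro member_le_sum) auto
      then have "(y j)\<^sup>2 \<le> 1" using yip by (simp add: ip_def power2_eq_square)
      then show ?thesis by (simp add: abs_square_le_1)
    qed
    then have "y i \<in> (if i < d then {-1..1} else {0})" for i
      by (cases "i < d") (force simp: abs_le_iff, simp add: y_def)
    then have "y \<in> PiE UNIV (\<lambda>i. if i < d then {-1..1} else {0})"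
      by (intro PiE_I) (assumption, simp)
    then have "y \<in> K" using yip by (simp only: K_def Int_iff mem_Collect_eq)
    then have "a \<le> ip d y (mvec d A y)" unfolding a_def by (rule z)
    also have "\<dots> = ip d (\<lambda>j. (1/l) * x j) (mvec d A (\<lambda>j. (1/l) * x j))"
      by (rule ip_cong) (auto simp: y_def mvec_def)
    also have "\<dots> = ip d x (mvec d A x) / l\<^sup>2"
      unfolding mvec_scale ip_scale_left ip_scale_right by (simp add: power2_eq_square)
    finally show ?thesis using zero_less_power[OF l, of 2] l2 by (simp add: pos_le_divide_eq)
  qed
  ultimately show ?thesis by blast
qed

lemma quadratic_form_upper_bound:
  "\<exists>c>0. \<forall>x. ip d x (mvec d A x) \<le> c * ip d x x"
proof -
  define c where "c = 1 + (\<Sum>i<d. \<Sum>j<d. \<bar>A i j\<bar>)"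
  have "ip d x (mvec d A x) \<le> c * ip d x x" for x
  proof -
    have le: "\<bar>x i\<bar> \<le> l2n d x" if "i < d" for i
      using that member_le_L2_set[of "{..<d}" i "\<lambda>i. \<bar>x i\<bar>"]
      by (simp add: l2n_eq_L2_set L2_set_def)
    have "ip d x (mvec d A x) = (\<Sum>i<d. \<Sum>j<d. A i j * (x i * x j))"
      by (simp add: ip_def mvec_def sum_distrib_left algebra_simps)
    also have "\<dots> \<le> (\<Sum>i<d. \<Sum>j<d. \<bar>A i j\<bar> * (l2n d x * l2n d x))"
    proof (intro sum_mono)
      fix i j assume "i \<in> {..<d}" "j \<in> {..<d}"
      then have "\<bar>A i j * (x i * x j)\<bar> \<le> \<bar>A i j\<bar> * (l2n d x * l2n d x)"
        unfolding abs_mult using le l2n_nonneg by (intro mult_left_mono mult_mono) auto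
      then show "A i j * (x i * x j) \<le> \<bar>A i j\<bar> * (l2n d x * l2n d x)" by linarith
    qed
    also have "\<dots> = (c - 1) * ip d x x"
      by (simp add: c_def sum_distrib_right flip: l2n_sq power2_eq_square)
    also have "\<dots> \<le> c * ip d x x"
      using ip_self_nonneg by (intro mult_right_mono) auto
    finally show ?thesis .
  qed
  moreover have "0 < c" by (simp add: c_def add_pos_nonneg sum_nonneg)
  ultimately show ?thesis by blast
qed

text \<open>With \<open>y = E x\<close>, expand the nonnegative form at \<open>y - r x\<close> and
  bound \<open><y, E y>\<close> by \<open>r <y, y>\<close> and \<open><x, y>\<close> by
  \<open>r <x, x>\<close>; what remains is \<open>r |y|^2 \<le> r^3 |x|^2\<close>.\<close>

lemma psd_op_bound:
  assumes "psd d E" and ub: "\<And>x. ip d x (mvec d E x) \<le> r * ip d x x" and r: "0 < r"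
  shows "op_bound d E r"
  unfolding op_bound_def
proof
  fix x
  let ?y = "mvec d E x"
  have sym: "ip d u (mvec d E v) = ip d (mvec d E u) v" for u v
    using assms(1) by (intro ip_mvec_sym) (simp add: psd_def)
  have "0 \<le> ip d (\<lambda>j. ?y j - r * x j) (mvec d E (\<lambda>j. ?y j - r * x j))"
    using assms(1) by (simp add: psd_def)
  also have "\<dots> = ip d ?y (mvec d E ?y) - 2 * r * ip d ?y ?y + r\<^sup>2 * ip d x ?y"
    unfolding mvec_diff mvec_scale ip_diff_left ip_diff_right ip_scale_left ip_scale_right
    using sym[of x ?y] by (simp add: algebra_simps power2_eq_square)
  also have "\<dots> \<le> r * ip d ?y ?y - 2 * r * ip d ?y ?y + r\<^sup>2 * (r * ip d x x)"
    using ub r by (intro add_mono diff_mono mult_left_mono) auto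
  finally have "r * ip d ?y ?y \<le> r * (r\<^sup>2 * ip d x x)"
    by (simp only: mult.left_commute[of r "r\<^sup>2"])
  then have "ip d ?y ?y \<le> r\<^sup>2 * ip d x x"
    using r by (simp only: mult_le_cancel_left_pos)
  then have "(l2n d ?y)\<^sup>2 \<le> (r * l2n d x)\<^sup>2"
    by (simp only: l2n_sq power_mult_distrib)
  then show "l2n d ?y \<le> r * l2n d x"
    by (rule power2_le_imp_le) (simp add: r less_imp_le l2n_nonneg)
qed

lemma ip_le_l2n: "ip d x y \<le> l2n d x * l2n d y"
proof -
  have "ip d x y \<le> (\<Sum>j<d. \<bar>x j\<bar> * \<bar>y j\<bar>)"
    unfolding ip_def by (intro sum_mono) (metis abs_ge_self abs_mult)
  also have "\<dots> \<le> l2n d x * l2n d y"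
    unfolding l2n_eq_L2_set by (rule L2_set_mult_ineq)
  finally show ?thesis .
qed

lemma msym_mmul_self:
  assumes "msym d A"
  shows "msym d (mmul d A A)"
  unfolding msym_def mmul_def
proof (intro allI impI sum.cong refl)
  fix i j k assume "i < d" "j < d" "k \<in> {..<d}"
  then show "A i k * A k j = A j k * A k i"
    using assms unfolding msym_def by (metis lessThan_iff mult.commute)
qed

text \<open>Writing \<open>A = c (1 - E)\<close> with \<open>0 \<le> E \<le> r < 1\<close>, the square root is
  \<open>sqrt c (1 - Y)\<close> where \<open>Y\<close> is the fixed point of \<open>Y \<mapsto> (E + Y\<^sup>2) / 2\<close>, which is a
  contraction on the operator-norm ball of radius \<open>r\<close>; the inverse of \<open>1 - Y\<close> is the fixed point
  of \<open>B \<mapsto> 1 + Y B\<close>.\<close>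

lemma pd_sqrt_and_inverse:
  assumes A: "pd d A" and d: "1 \<le> d"
  shows "\<exists>S W. dmat d S \<and> pd d S \<and> (\<forall>i<d. \<forall>j<d. mmul d S S i j = A i j) \<and>
          dmat d W \<and> (\<forall>i<d. \<forall>j<d. mmul d S W i j = (if i = j then 1 else 0))"
proof -
  have Asym: "msym d A" using A by (simp add: pd_def)
  obtain a where a: "0 < a" "\<And>x. a * ip d x x \<le> ip d x (mvec d A x)"
    using pd_lower_bound[OF A d] by blast
  obtain c0 where c0: "0 < c0" "\<And>x. ip d x (mvec d A x) \<le> c0 * ip d x x"
    using quadratic_form_upper_bound by blast
  \<comment> \<open>Adding \<open>a\<close> forces \<open>a < c\<close>, so that
    \<open>r = 1 - a / c\<close> lies strictly between 0 and 1.\<close>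
  define c where "c = c0 + a"
  have c: "0 < c" "a < c" using a c0 by (auto simp: c_def)
  have cub: "ip d x (mvec d A x) \<le> c * ip d x x" for x
    using c0(2)[of x] mult_nonneg_nonneg[OF less_imp_le[OF a(1)] ip_self_nonneg[of d x]]
    by (simp add: c_def algebra_simps)
  define r where "r = 1 - a / c"
  have r: "0 < r" "r < 1" using a c by (auto simp: r_def)
  define I where "I i j = (if i = j then 1 else (0::real))" for i j :: nat
  define E where "E i j = I i j - A i j / c" for i j
  have mvecI: "mvec d I x i = x i" if "i < d" for x i
    using that by (simp add: mvec_def I_def if_distrib[of "\<lambda>c. c * _"] cong: if_cong)
  have mvecE: "mvec d E x i = x i - (1/c) * mvec d A x i" if "i < d" for x i
  proof -
    have "mvec d E x i = mvec d I x i - (1/c) * mvec d A x i"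
      unfolding E_def by (simp add: mvec_def algebra_simps sum_subtractf sum_distrib_left sum_divide_distrib)
    then show ?thesis using that by (simp add: mvecI)
  qed
  have formE: "ip d x (mvec d E x) = ip d x x - (1/c) * ip d x (mvec d A x)" for x
  proof -
    have "ip d x (mvec d E x) = ip d x (\<lambda>i. x i - (1/c) * mvec d A x i)"
      by (rule ip_cong) (auto simp: mvecE)
    then show ?thesis by (simp only: ip_diff_right ip_scale_right)
  qed
  have Esym: "msym d E" using Asym by (auto simp: msym_def E_def I_def)
  have "psd d E"
    using Esym cub c by (auto simp: psd_def formE divide_le_eq mult.commute)
  moreover have "ip d x (mvec d E x) \<le> r * ip d x x" for x
    using a(2)[of x] c unfolding formE r_def by (simp add: field_simps)
  ultimately have Er: "op_bound d E r" using r by (intro psd_op_bound) auto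

  define P where "P Y \<longleftrightarrow> msym d Y \<and> op_bound d Y r" for Y
  have "\<exists>Y. P Y \<and> (\<forall>i<d. \<forall>j<d. (\<lambda>i j. (1/2) * (E i j + mmul d Y Y i j)) i j = Y i j)"
  proof (rule matrix_contraction[where r = r and R = r and P = P])
    show "P (\<lambda>i j. 0)" using r by (simp add: P_def msym_def op_bound_0)
    show "op_bound d Y r" if "P Y" for Y using that by (simp add: P_def)
    show "P (\<lambda>i j. (1/2) * (E i j + mmul d Y Y i j))" if "P Y" for Y
    proof -
      have "op_bound d (\<lambda>i j. (1/2) * (E i j + mmul d Y Y i j)) (\<bar>1/2\<bar> * (r + r * r))"
        using that r Er by (intro op_bound_scale op_bound_add op_bound_mmul) (auto simp: P_def)
      moreover have "\<bar>1/2\<bar> * (r + r * r) \<le> r"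
        using r mult_left_mono[of r 1 r] by simp
      ultimately have "op_bound d (\<lambda>i j. (1/2) * (E i j + mmul d Y Y i j)) r"
        by (rule op_bound_mono)
      then show ?thesis
        using that Esym msym_mmul_self[of d Y] by (simp add: P_def msym_def)
    qed
    fix Y Z s assume YZ: "P Y" "P Z" "0 \<le> s" "op_bound d (\<lambda>i j. Y i j - Z i j) s"
    let ?D = "\<lambda>i j. Y i j - Z i j"
    \<comment> \<open>Difference of squares without commutativity:
      \<open>Y Y - Z Z = Y (Y - Z) + (Y - Z) Z\<close>. Both summands have norm at most
      \<open>r * s\<close>, and the factor 1/2 compensates for their number.\<close>
    have "op_bound d (\<lambda>i j. (1/2) * (mmul d Y ?D i j + mmul d ?D Z i j)) (\<bar>1/2\<bar> * (r * s + s * r))"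
      using YZ r by (intro op_bound_scale op_bound_add op_bound_mmul) (auto simp: P_def)
    moreover have "(\<lambda>i j. (1/2) * (mmul d Y ?D i j + mmul d ?D Z i j)) =
       (\<lambda>i j. (1/2) * (E i j + mmul d Y Y i j) - (1/2) * (E i j + mmul d Z Z i j))"
      by (intro ext) (simp add: mmul_def algebra_simps sum_subtractf flip: sum.distrib)
    ultimately show "op_bound d (\<lambda>i j. (1/2) * (E i j + mmul d Y Y i j) - (1/2) * (E i j + mmul d Z Z i j)) (r * s)"
      by (simp add: mult.commute)
  next
    fix Z :: "nat \<Rightarrow> nat \<Rightarrow> nat \<Rightarrow> real" and Y i j
    assume "\<And>i j. i < d \<Longrightarrow> j < d \<Longrightarrow> (\<lambda>k. Z k i j) \<longlonglongrightarrow> Y i j" "i < d" "j < d"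
    then show "(\<lambda>k. (1/2) * (E i j + mmul d (Z k) (Z k) i j)) \<longlonglongrightarrow> (1/2) * (E i j + mmul d Y Y i j)"
      unfolding mmul_def by (intro tendsto_intros) auto
  next
    fix Z :: "nat \<Rightarrow> nat \<Rightarrow> nat \<Rightarrow> real" and Y
    assume PZ: "\<And>k. P (Z k)" and lim: "\<And>i j. i < d \<Longrightarrow> j < d \<Longrightarrow> (\<lambda>k. Z k i j) \<longlonglongrightarrow> Y i j"
    have "Y i j = Y j i" if "i < d" "j < d" for i j
    proof -
      have "(\<lambda>k. Z k i j) = (\<lambda>k. Z k j i)" using PZ that by (auto simp: P_def msym_def)
      with lim[OF that] lim[OF that(2,1)] show ?thesis by (metis LIMSEQ_unique)
    qed
    moreover have "op_bound d Y r"
      by (rule op_bound_limit[of d Z]) (use PZ lim in \<open>auto simp: P_def\<close>)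
    ultimately show "P Y" by (simp add: P_def msym_def)
  qed (use r in auto)
  then obtain Y where Y: "msym d Y" "op_bound d Y r"
    and Yeq: "\<And>i j. i < d \<Longrightarrow> j < d \<Longrightarrow> E i j + mmul d Y Y i j = 2 * Y i j"
    by (auto simp: P_def)

  have "\<exists>B. op_bound d B (1 / (1 - r)) \<and> (\<forall>i<d. \<forall>j<d. (\<lambda>i j. I i j + mmul d Y B i j) i j = B i j)"
  proof (rule matrix_contraction[where r = r and R = "1 / (1 - r)"])
    fix B assume "op_bound d B (1 / (1 - r))"
    then have "op_bound d (\<lambda>i j. I i j + mmul d Y B i j) (1 + r * (1 / (1 - r)))"
      using Y r op_bound_1 unfolding I_def by (intro op_bound_add op_bound_mmul) auto
    moreover have "1 + r * (1 / (1 - r)) = 1 / (1 - r)" using r by (simp add: field_simps)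
    ultimately show "op_bound d (\<lambda>i j. I i j + mmul d Y B i j) (1 / (1 - r))" by simp
  next
    fix B C s assume "op_bound d (\<lambda>i j. B i j - C i j) s"
    then have "op_bound d (mmul d Y (\<lambda>i j. B i j - C i j)) (r * s)"
      using Y r by (intro op_bound_mmul) auto
    moreover have "mmul d Y (\<lambda>i j. B i j - C i j) =
        (\<lambda>i j. I i j + mmul d Y B i j - (I i j + mmul d Y C i j))"
      by (intro ext) (simp add: mmul_def algebra_simps sum_subtractf)
    ultimately show "op_bound d (\<lambda>i j. I i j + mmul d Y B i j - (I i j + mmul d Y C i j)) (r * s)"
      by simp
  next
    fix Z :: "nat \<Rightarrow> nat \<Rightarrow> nat \<Rightarrow> real" and B i j
    assume "\<And>i j. i < d \<Longrightarrow> j < d \<Longrightarrow> (\<lambda>k. Z k i j) \<longlonglongrightarrow> B i j" "i < d" "j < d"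
    then show "(\<lambda>k. I i j + mmul d Y (Z k) i j) \<longlonglongrightarrow> I i j + mmul d Y B i j"
      unfolding mmul_def by (intro tendsto_intros) auto
  next
    fix Z :: "nat \<Rightarrow> nat \<Rightarrow> nat \<Rightarrow> real" and B
    assume "\<And>k. op_bound d (Z k) (1 / (1 - r))"
      and "\<And>i j. i < d \<Longrightarrow> j < d \<Longrightarrow> (\<lambda>k. Z k i j) \<longlonglongrightarrow> B i j"
    then show "op_bound d B (1 / (1 - r))" by (rule op_bound_limit)
  qed (use r in \<open>auto intro: op_bound_0\<close>)
  then obtain B where Beq: "\<And>i j. i < d \<Longrightarrow> j < d \<Longrightarrow> I i j + mmul d Y B i j = B i j"
    by auto

  define S where "S i j = (if i < d \<and> j < d then sqrt c * (I i j - Y i j) else 0)" for i j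
  define W where "W i j = (if i < d \<and> j < d then B i j / sqrt c else 0)" for i j
  have IM: "(\<Sum>k<d. I i k * M k) = M i" if "i < d" for i and M :: "nat \<Rightarrow> real"
    using that by (simp add: I_def if_distrib[of "\<lambda>c. c * _"] cong: if_cong)
  have MI: "(\<Sum>k<d. M k * I k j) = M j" if "j < d" for j and M :: "nat \<Rightarrow> real"
    using that by (simp add: I_def if_distrib[of "\<lambda>c. _ * c"] cong: if_cong)
  have SS: "mmul d S S i j = A i j" if ij: "i < d" "j < d" for i j
  proof -
    have "mmul d S S i j = (\<Sum>k<d. (sqrt c * sqrt c) * ((I i k - Y i k) * (I k j - Y k j)))"
      using ij unfolding mmul_def S_def by (intro sum.cong) auto
    also have "\<dots> = c * (\<Sum>k<d. (I i k - Y i k) * (I k j - Y k j))"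
      using c by (simp add: sum_distrib_left)
    also have "(\<Sum>k<d. (I i k - Y i k) * (I k j - Y k j)) =
        (\<Sum>k<d. I i k * I k j) - (\<Sum>k<d. I i k * Y k j) - (\<Sum>k<d. Y i k * I k j) + mmul d Y Y i j"
      by (simp add: mmul_def algebra_simps sum_subtractf sum.distrib)
    also have "\<dots> = I i j - 2 * Y i j + mmul d Y Y i j"
      using ij by (simp add: IM MI)
    also have "\<dots> = I i j - E i j"
      using Yeq[OF ij] by simp
    finally show ?thesis using c by (simp add: E_def)
  qed
  have SW: "mmul d S W i j = I i j" if ij: "i < d" "j < d" for i j
  proof -
    have "mmul d S W i j = (\<Sum>k<d. (I i k - Y i k) * B k j)"
      using ij c by (auto simp: mmul_def S_def W_def intro!: sum.cong)
    also have "\<dots> = B i j - mmul d Y B i j"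
      using ij by (simp add: mmul_def left_diff_distrib sum_subtractf IM)
    finally show ?thesis using Beq[OF ij] by simp
  qed
  have "pd d S"
    unfolding pd_def
  proof (intro conjI allI impI)
    show "msym d S" using Y by (auto simp: msym_def S_def I_def)
    fix x :: "nat \<Rightarrow> real" assume "\<exists>i<d. x i \<noteq> 0"
    then have pos: "0 < ip d x x"
      using ip_self_nonneg[of d x] ip_self_eq_0_iff[of d x] by force
    have "ip d x (mvec d S x) = ip d x (\<lambda>i. sqrt c * (x i - mvec d Y x i))"
    proof (rule ip_cong)
      fix i assume i: "i < d"
      then have "mvec d S x i = sqrt c * (mvec d I x i - mvec d Y x i)"
        by (simp add: mvec_def S_def left_diff_distrib right_diff_distrib sum_subtractf
            sum_distrib_left mult.assoc)
      then show "mvec d S x i = sqrt c * (x i - mvec d Y x i)"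
        using i by (simp add: mvecI)
    qed auto
    also have "\<dots> = sqrt c * (ip d x x - ip d x (mvec d Y x))"
      by (simp only: ip_scale_right ip_diff_right)
    also have "\<dots> > 0"
    proof -
      have "ip d x (mvec d Y x) \<le> l2n d x * (r * l2n d x)"
        using ip_le_l2n[of d x "mvec d Y x"] Y(2) l2n_nonneg[of d x]
        unfolding op_bound_def by (meson mult_left_mono order_trans)
      also have "\<dots> = r * ip d x x"
        by (simp add: power2_eq_square flip: l2n_sq)
      also have "\<dots> < ip d x x" using r pos by simp
      finally show ?thesis using c by simp
    qed
    finally show "0 < ip d x (mvec d S x)" .
  qed
  moreover have "dmat d S" "dmat d W" by (auto simp: dmat_def S_def W_def)
  ultimately show ?thesis using SS SW unfolding I_def by blast
qed

lemma pd_mvec_eq_0: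
  assumes "pd d S" "\<And>i. i < d \<Longrightarrow> mvec d S x i = 0" "i < d"
  shows "x i = 0"
proof (rule ccontr)
  assume "x i \<noteq> 0"
  then have "0 < ip d x (mvec d S x)" using assms unfolding pd_def by blast
  moreover have "ip d x (mvec d S x) = 0" using assms(2) by (simp add: ip_def)
  ultimately show False by simp
qed

text \<open>With \<open>D = S - R\<close> and \<open>M = S + R\<close>, the equation \<open>S\<^sup>2 = R\<^sup>2\<close> gives \<open>M D + D M = 0\<close>, so
  \<open>tr (D M D) = 0\<close>, and positive definiteness of \<open>M\<close> forces every column of \<open>D\<close> to vanish.\<close>

lemma psd_sqrt_unique:
  assumes S: "pd d S" and R: "psd d R"
    and eq: "\<And>i j. i < d \<Longrightarrow> j < d \<Longrightarrow> mmul d S S i j = mmul d R R i j"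
    and ij: "i < d" "j < d"
  shows "R i j = S i j"
proof -
  define D where "D i j = S i j - R i j" for i j
  define M where "M i j = S i j + R i j" for i j
  have Ssym: "S i j = S j i" if "i < d" "j < d" for i j
    using S that by (auto simp: pd_def msym_def)
  have Rsym: "R i j = R j i" if "i < d" "j < d" for i j
    using R that by (auto simp: psd_def msym_def)
  have MD: "mmul d M D i j + mmul d D M i j = 0" if "i < d" "j < d" for i j
  proof -
    have "mmul d M D i j + mmul d D M i j = 2 * (mmul d S S i j - mmul d R R i j)"
      by (simp add: mmul_def M_def D_def algebra_simps sum.distrib sum_subtractf)
    then show ?thesis using eq[OF that] by simp
  qed
  define t where "t = (\<Sum>i<d. \<Sum>j<d. D i j * mmul d M D j i)"
  have MD': "mmul d M D j i = - mmul d D M j i" if "i < d" "j < d" for i j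
    using MD[OF that(2,1)] by simp
  have "t = (\<Sum>i<d. \<Sum>j<d. D i j * - mmul d D M j i)"
    unfolding t_def using MD' by (intro sum.cong refl) simp
  also have "\<dots> = - (\<Sum>i<d. \<Sum>j<d. \<Sum>k<d. D i j * (D j k * M k i))"
    by (simp add: mmul_def sum_distrib_left sum_negf)
  also have "(\<Sum>i<d. \<Sum>j<d. \<Sum>k<d. D i j * (D j k * M k i)) =
      (\<Sum>j<d. \<Sum>i<d. \<Sum>k<d. D i j * (D j k * M k i))"
    by (rule sum.swap)
  also have "\<dots> = (\<Sum>j<d. \<Sum>k<d. \<Sum>i<d. D i j * (D j k * M k i))"
    by (intro sum.cong refl sum.swap)
  also have "\<dots> = t"
    unfolding t_def mmul_def by (simp add: sum_distrib_left mult_ac)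
  finally have "t = 0" by simp
  moreover have "t = (\<Sum>i<d. ip d (\<lambda>j. D j i) (mvec d M (\<lambda>j. D j i)))"
    unfolding t_def ip_def mvec_def mmul_def
    using Ssym Rsym by (intro sum.cong refl) (auto simp: D_def)
  moreover have pos: "0 \<le> ip d x (mvec d R x)" for x using R by (simp add: psd_def)
  have Msplit: "ip d x (mvec d M x) = ip d x (mvec d S x) + ip d x (mvec d R x)" for x
    by (simp add: ip_def mvec_def M_def algebra_simps sum.distrib)
  have Mpos: "0 < ip d x (mvec d M x)" if "\<exists>i<d. x i \<noteq> 0" for x
    using S that pos[of x] unfolding Msplit pd_def by (intro add_pos_nonneg) blast+
  have M0: "0 \<le> ip d x (mvec d M x)" for x
  proof (cases "\<exists>i<d. x i \<noteq> 0")
    case True then show ?thesis using Mpos[of x] by simp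
  next
    case False then show ?thesis by (simp add: ip_def)
  qed
  ultimately have "\<forall>i<d. ip d (\<lambda>j. D j i) (mvec d M (\<lambda>j. D j i)) = 0"
    using M0 by (simp add: sum_nonneg_eq_0_iff)
  then have "ip d (\<lambda>k. D k j) (mvec d M (\<lambda>k. D k j)) = 0"
    using ij by blast
  then have "D i j = 0"
    using Mpos[of "\<lambda>k. D k j"] ij by (metis less_irrefl)
  then show ?thesis by (simp add: D_def)
qed

text \<open>Resolves the definite descriptions behind \<open>mat_sqrt\<close> and
  \<open>inv_sqrt\<close>. The root is unique by \<open>psd_sqrt_unique\<close>, the inverse because
  a positive definite matrix has trivial kernel; \<open>dmat\<close> fixes the remaining
  entries.\<close>

lemma mat_sqrt_inv_sqrt:
  assumes A: "pd d A" and d: "1 \<le> d"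
  shows "pd d (mat_sqrt d A)"
    and "\<And>i j. i < d \<Longrightarrow> j < d \<Longrightarrow> mmul d (mat_sqrt d A) (mat_sqrt d A) i j = A i j"
    and "\<And>i j. i < d \<Longrightarrow> j < d \<Longrightarrow> mmul d (mat_sqrt d A) (inv_sqrt d A) i j = (if i = j then 1 else 0)"
proof -
  obtain S W where S: "dmat d S" "pd d S" "\<And>i j. i < d \<Longrightarrow> j < d \<Longrightarrow> mmul d S S i j = A i j"
    and W: "dmat d W" "\<And>i j. i < d \<Longrightarrow> j < d \<Longrightarrow> mmul d S W i j = (if i = j then 1 else 0)"
    using pd_sqrt_and_inverse[OF A d] by blast
  have "psd d S"
    unfolding psd_def
  proof (intro conjI allI)
    show "msym d S" using S by (simp add: pd_def)
    fix x show "0 \<le> ip d x (mvec d S x)"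
    proof (cases "\<exists>i<d. x i \<noteq> 0")
      case True then show ?thesis using S unfolding pd_def by (meson less_imp_le)
    next
      case False then show ?thesis by (simp add: ip_def)
    qed
  qed
  have sqrt: "mat_sqrt d A = S"
    unfolding mat_sqrt_def
  proof (rule the_equality)
    show "dmat d S \<and> psd d S \<and> (\<forall>i<d. \<forall>j<d. mmul d S S i j = A i j)"
      using S \<open>psd d S\<close> by blast
    fix R assume R: "dmat d R \<and> psd d R \<and> (\<forall>i<d. \<forall>j<d. mmul d R R i j = A i j)"
    show "R = S"
    proof (intro ext)
      fix i j
      show "R i j = S i j"
      proof (cases "i < d \<and> j < d")
        case True
        then show ?thesis using psd_sqrt_unique[OF S(2), of R i j] R S(3) by simp
      next
        case False
        then show ?thesis using R S(1) by (auto simp: dmat_def)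
      qed
    qed
  qed
  have inv: "inv_sqrt d A = W"
    unfolding inv_sqrt_def sqrt mat_inv_def
  proof (rule the_equality)
    show "dmat d W \<and> (\<forall>i<d. \<forall>j<d. mmul d S W i j = (if i = j then 1 else 0))"
      using W by blast
    fix B assume B: "dmat d B \<and> (\<forall>i<d. \<forall>j<d. mmul d S B i j = (if i = j then 1 else 0))"
    show "B = W"
    proof (intro ext)
      fix i j
      show "B i j = W i j"
      proof (cases "i < d \<and> j < d")
        case True
        have "mvec d S (\<lambda>k. B k j - W k j) l = 0" if "l < d" for l
          unfolding mvec_diff using B W(2) True that by (simp add: mmul_def mvec_def)
        then have "B i j - W i j = 0"
          using pd_mvec_eq_0[OF S(2), of "\<lambda>k. B k j - W k j" i] True by blast
        then show ?thesis by simp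
      next
        case False
        then show ?thesis using B W(1) by (auto simp: dmat_def)
      qed
    qed
  qed
  show "pd d (mat_sqrt d A)" using S sqrt by simp
  show "mmul d (mat_sqrt d A) (mat_sqrt d A) i j = A i j" if "i < d" "j < d" for i j
    using S(3) that sqrt by simp
  show "mmul d (mat_sqrt d A) (inv_sqrt d A) i j = (if i = j then 1 else 0)" if "i < d" "j < d" for i j
    using W(2) that sqrt inv by simp
qed

section \<open>Sparse approximation in the l1 ball\<close>

lemma exp_le_quadratic:
  fixes x :: real
  assumes "\<bar>x\<bar> \<le> 1"
  shows "exp x \<le> 1 + x + x\<^sup>2"
proof (cases "0 \<le> x")
  case True
  then show ?thesis using assms exp_bound by simp
next
  case False
  define t where "t = - x"
  have t: "0 < t" using False by (simp add: t_def)
  have "1 \<le> (1 - t + t\<^sup>2) * (1 + t + t\<^sup>2 / 2)"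
  proof -
    have "(1 - t + t\<^sup>2) * (1 + t + t\<^sup>2 / 2) = 1 + (t\<^sup>2 + t ^ 3 + t ^ 4) / 2"
      by (simp add: field_simps power2_eq_square power3_eq_cube power4_eq_xxxx)
    then show ?thesis using t by simp
  qed
  also have "\<dots> \<le> (1 - t + t\<^sup>2) * exp t"
  proof (rule mult_left_mono)
    show "1 + t + t\<^sup>2 / 2 \<le> exp t"
      using exp_lower_Taylor_quadratic[of t] t by simp
    show "0 \<le> 1 - t + t\<^sup>2" using assms t by (simp add: t_def)
  qed
  finally have "exp (- t) \<le> 1 - t + t\<^sup>2" by (simp add: exp_minus field_simps)
  then show ?thesis by (simp add: t_def)
qed

text \<open>Valid for every nonnegative argument, however large. For this reason the lower tail of a
  sum of squares is governed by fourth moments alone, with no truncation of the squares.\<close>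

lemma exp_neg_le_quadratic:
  fixes y :: real
  assumes "0 \<le> y"
  shows "exp (- y) \<le> 1 - y + y\<^sup>2 / 2"
proof -
  have pos: "0 \<le> 1 - y + y\<^sup>2 / 2"
    using sum_power2_ge_zero[of "1 - y" 1] by (simp add: power2_diff)
  have "1 \<le> (1 - y + y\<^sup>2 / 2) * (1 + y + y\<^sup>2 / 2)"
  proof -
    have "(1 - y + y\<^sup>2 / 2) * (1 + y + y\<^sup>2 / 2) = 1 + y ^ 4 / 4"
      by (simp add: algebra_simps power2_eq_square power4_eq_xxxx)
    then show ?thesis using assms by simp
  qed
  also have "\<dots> \<le> (1 - y + y\<^sup>2 / 2) * exp y"
    using exp_lower_Taylor_quadratic[of y] assms pos by (intro mult_left_mono) auto
  finally show ?thesis by (simp add: exp_minus field_simps)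
qed

text \<open>The vertices of the l1 ball together with the origin; in the random choice below the
  origin carries the mass \<open>1 - l1n d v\<close>.\<close>

definition signed_atoms :: "nat \<Rightarrow> (nat \<Rightarrow> real) set" where
  "signed_atoms d = insert (\<lambda>_. 0) ((\<lambda>(s, i) j. if j = i then s else 0) ` ({-1, 1} \<times> {..<d}))"

primrec atom_sums :: "nat \<Rightarrow> nat \<Rightarrow> (nat \<Rightarrow> real) set" where
  "atom_sums d 0 = {\<lambda>_. 0}"
| "atom_sums d (Suc m) = (\<lambda>(D, f) j. D j + f j) ` (atom_sums d m \<times> signed_atoms d)"

lemma finite_signed_atoms: "finite (signed_atoms d)"
  by (simp add: signed_atoms_def)

lemma card_signed_atoms:
  assumes "1 \<le> d"
  shows "card (signed_atoms d) \<le> 3 * d"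
proof -
  have "card (signed_atoms d) \<le> Suc (card ({-1, 1::real} \<times> {..<d}))"
    unfolding signed_atoms_def
    by (rule card_insert_le_m1, simp, unfold diff_Suc_1, rule card_image_le) simp
  also have "\<dots> \<le> 3 * d"
    using assms by (simp add: card_cartesian_product)
  finally show ?thesis .
qed

lemma finite_atom_sums: "finite (atom_sums d m)"
  by (induction m) (auto simp: finite_signed_atoms)

lemma card_atom_sums:
  assumes "1 \<le> d"
  shows "card (atom_sums d m) \<le> (3 * d) ^ m"
proof (induction m)
  case (Suc m)
  have "card (atom_sums d (Suc m)) \<le> card (atom_sums d m \<times> signed_atoms d)"
    unfolding atom_sums.simps
    by (intro card_image_le finite_cartesian_product finite_atom_sums finite_signed_atoms)
  also have "\<dots> \<le> (3 * d) ^ m * (3 * d)"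
    unfolding card_cartesian_product
    by (intro mult_mono Suc.IH card_signed_atoms assms) auto
  finally show ?case by (simp add: mult.commute)
qed auto

lemma abs_ip_le_l1n:
  assumes "\<And>j. j < d \<Longrightarrow> \<bar>c j\<bar> \<le> b"
  shows "\<bar>ip d c v\<bar> \<le> b * l1n d v"
proof -
  have "\<bar>ip d c v\<bar> \<le> (\<Sum>j<d. \<bar>c j\<bar> * \<bar>v j\<bar>)"
    unfolding ip_def by (rule order_trans[OF sum_abs]) (simp add: abs_mult)
  also have "\<dots> \<le> (\<Sum>j<d. b * \<bar>v j\<bar>)"
    using assms by (intro sum_mono mult_right_mono) auto
  finally show ?thesis by (simp add: l1n_def sum_distrib_left)
qed

text \<open>The average over the law that picks \<open>sgn (v j) e\<^sub>j\<close> with probability \<open>\<bar>v j\<bar>\<close> and \<open>0\<close> with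
  the remaining probability; its mean is \<open>v\<close>.\<close>

lemma maurey_mgf:
  assumes c: "\<And>j. j < d \<Longrightarrow> \<bar>c j\<bar> \<le> 1" and v: "l1n d v \<le> 1" and l: "\<bar>l\<bar> \<le> 1 / 2"
  shows "(\<Sum>j<d. \<bar>v j\<bar> * exp (l * (c j * sgn (v j) - ip d c v)))
           + (1 - l1n d v) * exp (l * (0 - ip d c v)) \<le> exp (4 * l\<^sup>2)"
proof -
  let ?m = "ip d c v"
  have m: "\<bar>?m\<bar> \<le> 1" using abs_ip_le_l1n[of d c 1 v] c v by simp
  have e: "exp (l * (y - ?m)) \<le> 1 + l * (y - ?m) + 4 * l\<^sup>2" if "\<bar>y\<bar> \<le> 1" for y
  proof -
    have y: "\<bar>y - ?m\<bar> \<le> 2" using that m by linarith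
    have "\<bar>l * (y - ?m)\<bar> \<le> (1/2) * 2"
      unfolding abs_mult using y l by (intro mult_mono) auto
    then have "exp (l * (y - ?m)) \<le> 1 + l * (y - ?m) + (l * (y - ?m))\<^sup>2"
      by (intro exp_le_quadratic) simp
    also have "(l * (y - ?m))\<^sup>2 \<le> l\<^sup>2 * 2\<^sup>2"
      unfolding power_mult_distrib using y
      by (intro mult_left_mono abs_le_square_iff[THEN iffD1]) auto
    finally show ?thesis by simp
  qed
  have "\<bar>c j * sgn (v j)\<bar> \<le> 1" if "j < d" for j
    using c[OF that] by (simp add: abs_mult abs_sgn_eq)
  then have "(\<Sum>j<d. \<bar>v j\<bar> * exp (l * (c j * sgn (v j) - ?m))) + (1 - l1n d v) * exp (l * (0 - ?m))
     \<le> (\<Sum>j<d. \<bar>v j\<bar> * (1 + l * (c j * sgn (v j) - ?m) + 4 * l\<^sup>2))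
        + (1 - l1n d v) * (1 + l * (0 - ?m) + 4 * l\<^sup>2)"
    using e e[of 0] v by (intro add_mono sum_mono mult_left_mono) auto
  \<comment> \<open>Since \<open>\<bar>v j\<bar> * sgn (v j) = v j\<close>, the law has mean
    \<open>v\<close>: the terms linear in \<open>l\<close> cancel and only
    \<open>1 + 4 * l\<^sup>2\<close> survives.\<close>
  also have "(\<Sum>j<d. \<bar>v j\<bar> * (1 + l * (c j * sgn (v j) - ?m) + 4 * l\<^sup>2))
     = (\<Sum>j<d. \<bar>v j\<bar> * (1 - l * ?m + 4 * l\<^sup>2) + l * (c j * v j))"
  proof (intro sum.cong refl)
    fix j
    have "\<bar>v j\<bar> * (c j * sgn (v j)) = c j * v j"
      by (metis abs_mult_sgn mult.left_commute)
    then show "\<bar>v j\<bar> * (1 + l * (c j * sgn (v j) - ?m) + 4 * l\<^sup>2)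
        = \<bar>v j\<bar> * (1 - l * ?m + 4 * l\<^sup>2) + l * (c j * v j)"
      by (simp add: algebra_simps)
  qed
  also have "\<dots> = l1n d v * (1 - l * ?m + 4 * l\<^sup>2) + l * ?m"
    by (simp add: sum.distrib l1n_def ip_def sum_distrib_left sum_distrib_right)
  also have "\<dots> + (1 - l1n d v) * (1 + l * (0 - ?m) + 4 * l\<^sup>2) = 1 + 4 * l\<^sup>2"
    by (simp add: algebra_simps)
  also have "\<dots> \<le> exp (4 * l\<^sup>2)" by simp
  finally show ?thesis .
qed

text \<open>Maurey's random choice, derandomised by conditional expectations. One more random atom
  multiplies the mean of the two-sided exponential potential by at most
  \<open>exp (4 * l\<^sup>2)\<close>, so the atom minimising the potential does no worse.\<close>

lemma atom_sums_potential:
  fixes C :: "(nat \<Rightarrow> real) set"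
  assumes C: "finite C" "\<And>c j. c \<in> C \<Longrightarrow> j < d \<Longrightarrow> \<bar>c j\<bar> \<le> 1"
    and v: "l1n d v \<le> 1" and l: "\<bar>l\<bar> \<le> 1 / 2"
  shows "\<exists>D\<in>atom_sums d m.
     (\<Sum>c\<in>C. exp (l * (ip d c D - real m * ip d c v)) + exp (- l * (ip d c D - real m * ip d c v)))
       \<le> 2 * real (card C) * exp (4 * l\<^sup>2 * real m)"
proof (induction m)
  case 0
  then show ?case by (simp add: ip_def)
next
  case (Suc m)
  then obtain D where D: "D \<in> atom_sums d m"
    "(\<Sum>c\<in>C. exp (l * (ip d c D - real m * ip d c v)) + exp (- l * (ip d c D - real m * ip d c v)))
       \<le> 2 * real (card C) * exp (4 * l\<^sup>2 * real m)" (is "(\<Sum>c\<in>C. ?a c + ?b c) \<le> _")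
    by blast
  define \<Phi> where "\<Phi> f = (\<Sum>c\<in>C. ?a c * exp (l * (ip d c f - ip d c v))
      + ?b c * exp (- l * (ip d c f - ip d c v)))" for f
  have "signed_atoms d \<noteq> {}" by (auto simp: signed_atoms_def)
  then have "Min (\<Phi> ` signed_atoms d) \<in> \<Phi> ` signed_atoms d"
    using finite_signed_atoms by (intro Min_in) auto
  then obtain f where "f \<in> signed_atoms d" "\<Phi> f = Min (\<Phi> ` signed_atoms d)" by auto
  then have f: "f \<in> signed_atoms d" "\<And>g. g \<in> signed_atoms d \<Longrightarrow> \<Phi> f \<le> \<Phi> g"
    using finite_signed_atoms by auto
  let ?e = "\<lambda>j k. if k = j then sgn (v j) else 0"
  have e: "?e j \<in> signed_atoms d" if "j < d" for j
  proof (cases "v j = 0")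
    case True
    then have "?e j = (\<lambda>_. 0)" by auto
    then show ?thesis by (simp add: signed_atoms_def)
  next
    case False
    then have "sgn (v j) \<in> {-1, 1}" by (auto simp: sgn_if)
    with that have "(sgn (v j), j) \<in> {-1, 1} \<times> {..<d}" by simp
    then show ?thesis
      unfolding signed_atoms_def
      by (intro insertI2 image_eqI[where x = "(sgn (v j), j)"]) auto
  qed
  have e0: "(\<lambda>_. 0) \<in> signed_atoms d" by (simp add: signed_atoms_def)
  have ipe: "ip d c (?e j) = c j * sgn (v j)" if "j < d" for c j
    using that by (rule ip_single)
  \<comment> \<open>The weights \<open>\<bar>v j\<bar>\<close> and \<open>1 - l1n d v\<close> are
    nonnegative and sum to 1, so the minimum of \<open>\<Phi>\<close> is at most its weighted
    mean.\<close>
  have "\<Phi> f = (\<Sum>j<d. \<bar>v j\<bar> * \<Phi> f) + (1 - l1n d v) * \<Phi> f"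
    by (simp add: l1n_def algebra_simps flip: sum_distrib_left)
  also have "\<dots> \<le> (\<Sum>j<d. \<bar>v j\<bar> * \<Phi> (?e j)) + (1 - l1n d v) * \<Phi> (\<lambda>_. 0)"
    using f(2)[OF e] f(2)[OF e0] v by (intro add_mono sum_mono mult_left_mono) auto
  also have "\<dots> = (\<Sum>c\<in>C.
       ?a c * ((\<Sum>j<d. \<bar>v j\<bar> * exp (l * (c j * sgn (v j) - ip d c v)))
           + (1 - l1n d v) * exp (l * (0 - ip d c v)))
     + ?b c * ((\<Sum>j<d. \<bar>v j\<bar> * exp (- l * (c j * sgn (v j) - ip d c v)))
           + (1 - l1n d v) * exp (- l * (0 - ip d c v))))"
  proof -
    have "(\<Sum>j<d. \<bar>v j\<bar> * \<Phi> (?e j)) = (\<Sum>j<d. \<Sum>c\<in>C.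
        ?a c * (\<bar>v j\<bar> * exp (l * (c j * sgn (v j) - ip d c v)))
      + ?b c * (\<bar>v j\<bar> * exp (- l * (c j * sgn (v j) - ip d c v))))"
      unfolding \<Phi>_def sum_distrib_left
    proof (intro sum.cong refl)
      fix j c assume "j \<in> {..<d}"
      then have "ip d c (?e j) = c j * sgn (v j)" using ipe by simp
      then show "\<bar>v j\<bar> * (?a c * exp (l * (ip d c (?e j) - ip d c v))
            + ?b c * exp (- l * (ip d c (?e j) - ip d c v)))
          = ?a c * (\<bar>v j\<bar> * exp (l * (c j * sgn (v j) - ip d c v)))
            + ?b c * (\<bar>v j\<bar> * exp (- l * (c j * sgn (v j) - ip d c v)))"
        by (simp only: distrib_left mult.left_commute)
    qed
    also have "\<dots> = (\<Sum>c\<in>C. \<Sum>j<d.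
        ?a c * (\<bar>v j\<bar> * exp (l * (c j * sgn (v j) - ip d c v)))
      + ?b c * (\<bar>v j\<bar> * exp (- l * (c j * sgn (v j) - ip d c v))))"
      by (rule sum.swap)
    finally have 1: "(\<Sum>j<d. \<bar>v j\<bar> * \<Phi> (?e j)) = (\<Sum>c\<in>C.
        ?a c * (\<Sum>j<d. \<bar>v j\<bar> * exp (l * (c j * sgn (v j) - ip d c v)))
      + ?b c * (\<Sum>j<d. \<bar>v j\<bar> * exp (- l * (c j * sgn (v j) - ip d c v))))"
      by (simp only: sum.distrib sum_distrib_left)
    have 2: "(1 - l1n d v) * \<Phi> (\<lambda>_. 0) = (\<Sum>c\<in>C.
        ?a c * ((1 - l1n d v) * exp (l * (0 - ip d c v)))
      + ?b c * ((1 - l1n d v) * exp (- l * (0 - ip d c v))))"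
      unfolding \<Phi>_def sum_distrib_left
      by (intro sum.cong refl) (simp add: ip_def distrib_left mult.left_commute)
    show ?thesis
      unfolding 1 2 sum.distrib[symmetric] by (intro sum.cong refl) (simp only: distrib_left add_ac)
  qed
  also have "\<dots> \<le> (\<Sum>c\<in>C. ?a c * exp (4 * l\<^sup>2) + ?b c * exp (4 * l\<^sup>2))"
  proof (intro sum_mono add_mono mult_left_mono)
    fix c assume c: "c \<in> C"
    show "(\<Sum>j<d. \<bar>v j\<bar> * exp (l * (c j * sgn (v j) - ip d c v)))
           + (1 - l1n d v) * exp (l * (0 - ip d c v)) \<le> exp (4 * l\<^sup>2)"
      using c C(2) v l by (intro maurey_mgf) auto
    have "(\<Sum>j<d. \<bar>v j\<bar> * exp (- l * (c j * sgn (v j) - ip d c v)))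
           + (1 - l1n d v) * exp (- l * (0 - ip d c v)) \<le> exp (4 * (- l)\<^sup>2)"
      using c C(2) v l by (intro maurey_mgf) auto
    then show "(\<Sum>j<d. \<bar>v j\<bar> * exp (- l * (c j * sgn (v j) - ip d c v)))
           + (1 - l1n d v) * exp (- l * (0 - ip d c v)) \<le> exp (4 * l\<^sup>2)" by simp
  qed auto
  also have "\<dots> = (\<Sum>c\<in>C. ?a c + ?b c) * exp (4 * l\<^sup>2)"
    by (simp only: sum_distrib_right distrib_right)
  also have "\<dots> \<le> (2 * real (card C) * exp (4 * l\<^sup>2 * real m)) * exp (4 * l\<^sup>2)"
    using D(2) by (intro mult_right_mono) auto
  also have "\<dots> = 2 * real (card C) * exp (4 * l\<^sup>2 * real (Suc m))"
  proof -
    have "exp (4 * l\<^sup>2 * real (Suc m)) = exp (4 * l\<^sup>2 * real m) * exp (4 * l\<^sup>2)"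
      unfolding exp_add[symmetric] by (simp add: algebra_simps)
    then show ?thesis by simp
  qed
  finally have bound: "\<Phi> f \<le> 2 * real (card C) * exp (4 * l\<^sup>2 * real (Suc m))" .
  let ?D = "\<lambda>j. D j + f j"
  have "?D \<in> atom_sums d (Suc m)"
    using D(1) f(1) by auto
  moreover have "(\<Sum>c\<in>C. exp (l * (ip d c ?D - real (Suc m) * ip d c v))
      + exp (- l * (ip d c ?D - real (Suc m) * ip d c v))) = \<Phi> f"
    unfolding \<Phi>_def ip_add_right
    by (intro sum.cong refl arg_cong2[of _ _ _ _ "(+)"]; simp only: exp_add[symmetric])
      (simp_all add: algebra_simps)
  ultimately show ?case using bound by (intro bexI[of _ ?D]) (simp only:)
qed

text \<open>A single term of the potential already bounds the error of one functional, so all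
  functionals in \<open>C\<close> are controlled together once \<open>m\<close> is of order
  \<open>ln (card C) / \<eta>\<^sup>2\<close>.\<close>

lemma maurey:
  fixes C :: "(nat \<Rightarrow> real) set"
  assumes C: "finite C" "\<And>c j. c \<in> C \<Longrightarrow> j < d \<Longrightarrow> \<bar>c j\<bar> \<le> 1"
    and v: "l1n d v \<le> 1" and \<eta>: "0 < \<eta>" "\<eta> \<le> 1"
    and m: "1 \<le> m" "16 * ln (2 * real (card C)) \<le> \<eta>\<^sup>2 * real m"
  shows "\<exists>D\<in>atom_sums d m. \<forall>c\<in>C. \<bar>ip d c (\<lambda>j. D j / real m - v j)\<bar> \<le> \<eta>"
proof -
  \<comment> \<open>With this \<open>l\<close> the logarithmic term and
    \<open>4 * l\<^sup>2 * m\<close> are each at most \<open>\<eta>\<^sup>2 * m / 16\<close>, which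
    add up to exactly \<open>l * (\<eta> * m)\<close>.\<close>
  define l where "l = \<eta> / 8"
  have l: "0 < l" "\<bar>l\<bar> \<le> 1 / 2" using \<eta> by (auto simp: l_def)
  obtain D where D: "D \<in> atom_sums d m"
    "(\<Sum>c\<in>C. exp (l * (ip d c D - real m * ip d c v)) + exp (- l * (ip d c D - real m * ip d c v)))
       \<le> 2 * real (card C) * exp (4 * l\<^sup>2 * real m)"
    using atom_sums_potential[of C d v l m] C v l(2) by blast
  have "\<bar>ip d c (\<lambda>j. D j / real m - v j)\<bar> \<le> \<eta>" if c: "c \<in> C" for c
  proof -
    define z where "z = ip d c D - real m * ip d c v"
    have card: "0 < card C" using c C(1) card_gt_0_iff by blast
    have "exp (l * \<bar>z\<bar>) \<le> exp (l * z) + exp (- l * z)"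
      using exp_ge_zero by (cases "0 \<le> z") (auto simp: add_increasing)
    also have "\<dots> \<le> (\<Sum>c\<in>C. exp (l * (ip d c D - real m * ip d c v))
        + exp (- l * (ip d c D - real m * ip d c v)))"
      unfolding z_def using c C(1)
      by (intro member_le_sum) (auto intro: add_nonneg_nonneg)
    also have "\<dots> \<le> exp (ln (2 * real (card C)) + 4 * l\<^sup>2 * real m)"
      using D(2) card by (simp add: exp_add)
    finally have "l * \<bar>z\<bar> \<le> ln (2 * real (card C)) + 4 * l\<^sup>2 * real m" by simp
    also have "\<dots> \<le> \<eta>\<^sup>2 * real m / 16 + 4 * l\<^sup>2 * real m" using m by simp
    also have "\<dots> = l * (\<eta> * real m)" by (simp add: l_def power2_eq_square)
    finally have "\<bar>z\<bar> \<le> \<eta> * real m" using l by simp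
    moreover have "ip d c (\<lambda>j. D j / real m - v j) = z / real m"
    proof -
      have "ip d c (\<lambda>j. (1 / real m) * D j - v j) = (1 / real m) * ip d c D - ip d c v"
        by (simp only: ip_diff_right ip_scale_right)
      then show ?thesis using m by (simp add: z_def field_simps)
    qed
    ultimately show ?thesis using m(1) by (simp only: abs_divide) (simp add: pos_divide_le_eq)
  qed
  with D(1) show ?thesis by blast
qed

section \<open>Exponential moments and Chernoff bounds\<close>

text \<open>Exponential Markov inequality for independent, not identically distributed coordinates:
  the expectation of the product factorises, and the bounds \<open>b i\<close> add up in the
  exponent.\<close>

lemma chernoff_PiM:
  fixes M :: "'i \<Rightarrow> 'a measure" and g :: "'i \<Rightarrow> 'a \<Rightarrow> real" and s :: real
  assumes I: "finite I" and prob: "\<And>i. prob_space (M i)"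
    and g: "\<And>i. i \<in> I \<Longrightarrow> g i \<in> borel_measurable (M i)"
    and mgf: "\<And>i. i \<in> I \<Longrightarrow> (\<integral>\<^sup>+x. ennreal (exp (g i x)) \<partial>M i) \<le> ennreal (exp (b i))"
  defines "B \<equiv> {\<omega> \<in> space (PiM I M). (\<Sum>i\<in>I. b i) + s \<le> (\<Sum>i\<in>I. g i (\<omega> i))}"
  shows "B \<in> sets (PiM I M)" and "measure (PiM I M) B \<le> exp (- s)"
proof -
  interpret product_prob_space M I
    using prob prob_space_imp_sigma_finite
    by (intro product_prob_space.intro product_sigma_finite.intro product_prob_space_axioms.intro) auto
  let ?P = "PiM I M"
  have [measurable]: "(\<lambda>\<omega>. g i (\<omega> i)) \<in> borel_measurable ?P" if "i \<in> I" for i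
    using g[OF that] measurable_component_singleton[OF that] by (rule measurable_compose_rev)
  have meas: "(\<lambda>\<omega>. \<Sum>i\<in>I. g i (\<omega> i)) \<in> borel_measurable ?P"
    by measurable
  show B: "B \<in> sets ?P" unfolding B_def using meas by measurable
  let ?u = "\<lambda>\<omega>. ennreal (exp ((\<Sum>i\<in>I. g i (\<omega> i)) - (\<Sum>i\<in>I. b i)))"
  have "(\<integral>\<^sup>+\<omega>. ?u \<omega> \<partial>?P)
      = (\<integral>\<^sup>+\<omega>. (\<Prod>i\<in>I. ennreal (exp (g i (\<omega> i)))) * ennreal (exp (- (\<Sum>i\<in>I. b i))) \<partial>?P)"
    by (intro nn_integral_cong)
      (simp add: exp_diff exp_minus divide_inverse exp_sum I prod_ennreal ennreal_mult prod_nonneg)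
  also have "\<dots> = (\<integral>\<^sup>+\<omega>. (\<Prod>i\<in>I. ennreal (exp (g i (\<omega> i)))) \<partial>?P) * ennreal (exp (- (\<Sum>i\<in>I. b i)))"
    by (intro nn_integral_multc) measurable
  also have "(\<integral>\<^sup>+\<omega>. (\<Prod>i\<in>I. ennreal (exp (g i (\<omega> i)))) \<partial>?P)
      = (\<Prod>i\<in>I. \<integral>\<^sup>+x. ennreal (exp (g i x)) \<partial>M i)"
    using g I by (intro product_nn_integral_prod) auto
  also have "\<dots> \<le> (\<Prod>i\<in>I. ennreal (exp (b i)))"
    using mgf by (intro prod_mono_ennreal) auto
  also have "\<dots> = ennreal (exp (\<Sum>i\<in>I. b i))"
    by (simp add: exp_sum I prod_ennreal)
  finally have int: "(\<integral>\<^sup>+\<omega>. ?u \<omega> \<partial>?P) \<le> 1"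
    by (simp add: mult_right_mono flip: ennreal_mult' exp_add)
  have "emeasure ?P B \<le> emeasure ?P {\<omega> \<in> space ?P. 1 \<le> ennreal (exp (- s)) * ?u \<omega>}"
  proof (rule emeasure_mono)
    show "B \<subseteq> {\<omega> \<in> space ?P. 1 \<le> ennreal (exp (- s)) * ?u \<omega>}"
      by (auto simp: B_def simp flip: ennreal_mult' exp_add)
    show "{\<omega> \<in> space ?P. 1 \<le> ennreal (exp (- s)) * ?u \<omega>} \<in> sets ?P"
      using meas by measurable
  qed
  also have "\<dots> \<le> ennreal (exp (- s)) * (\<integral>\<^sup>+\<omega>. ?u \<omega> * indicator (space ?P) \<omega> \<partial>?P)"
    using meas by (intro nn_integral_Markov_inequality) measurable
  also have "(\<integral>\<^sup>+\<omega>. ?u \<omega> * indicator (space ?P) \<omega> \<partial>?P) = (\<integral>\<^sup>+\<omega>. ?u \<omega> \<partial>?P)"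
    by (intro nn_integral_cong) simp
  also have "ennreal (exp (- s)) * \<dots> \<le> ennreal (exp (- s)) * 1"
    using int by (intro mult_left_mono) auto
  finally show "measure ?P B \<le> exp (- s)"
    by (simp add: emeasure_eq_measure)
qed

text \<open>Completing the square turns the tilted density into the normal density with mean
  \<open>a * \<sigma>\<^sup>2\<close>, which has total mass 1.\<close>

lemma normal_mgf:
  assumes "0 < \<sigma>"
  shows "(\<integral>\<^sup>+e. ennreal (exp (a * e - a\<^sup>2 * \<sigma>\<^sup>2 / 2)) \<partial>density lborel (normal_density 0 \<sigma>)) = 1"
proof -
  have "(\<integral>\<^sup>+e. ennreal (exp (a * e - a\<^sup>2 * \<sigma>\<^sup>2 / 2)) \<partial>density lborel (normal_density 0 \<sigma>))
     = (\<integral>\<^sup>+e. ennreal (normal_density 0 \<sigma> e) * ennreal (exp (a * e - a\<^sup>2 * \<sigma>\<^sup>2 / 2)) \<partial>lborel)"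
    by (intro nn_integral_density) auto
  also have "\<dots> = (\<integral>\<^sup>+e. ennreal (normal_density (a * \<sigma>\<^sup>2) \<sigma> e) * indicator (space lborel) e \<partial>lborel)"
  proof (intro nn_integral_cong)
    fix e :: real
    have "- (e - 0)\<^sup>2 / (2 * \<sigma>\<^sup>2) + (a * e - a\<^sup>2 * \<sigma>\<^sup>2 / 2) = - (e - a * \<sigma>\<^sup>2)\<^sup>2 / (2 * \<sigma>\<^sup>2)"
      using assms by (simp add: field_simps power2_eq_square)
    then show "ennreal (normal_density 0 \<sigma> e) * ennreal (exp (a * e - a\<^sup>2 * \<sigma>\<^sup>2 / 2))
        = ennreal (normal_density (a * \<sigma>\<^sup>2) \<sigma> e) * indicator (space lborel) e"
      unfolding normal_density_def
      by (simp add: mult.assoc flip: ennreal_mult' exp_add)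
  qed
  also have "\<dots> = emeasure (density lborel (normal_density (a * \<sigma>\<^sup>2) \<sigma>)) (space lborel)"
    by (intro emeasure_density[symmetric]) auto
  also have "\<dots> = 1"
    using prob_space.emeasure_space_1[OF prob_space_normal_density[OF assms, of "a * \<sigma>\<^sup>2"]] by simp
  finally show ?thesis .
qed

lemma fourth_power_le_exp:
  fixes z :: real
  assumes "0 \<le> z"
  shows "z ^ 4 / 64 \<le> exp z"
proof -
  have "(z / 2)\<^sup>2 / 2 \<le> exp (z / 2)"
    using exp_lower_Taylor_quadratic[of "z / 2"] assms by simp
  then have "((z / 2)\<^sup>2 / 2)\<^sup>2 \<le> (exp (z / 2))\<^sup>2"
    by (intro power_mono) auto
  then show ?thesis
    by (simp add: power_divide flip: exp_double power_mult)
qed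

text \<open>Truncation at \<open>ln N\<close>. Below it two of the four powers cost only a
  logarithm; above it \<open>N \<le> exp \<bar>z\<bar>\<close> produces the factor
  \<open>1 / N\<close>. Thus the fourth moment is governed by the variance, up to a remainder of
  order \<open>1 / N\<close>.\<close>

lemma fourth_power_le_truncated:
  fixes z N :: real
  assumes N: "1 \<le> N"
  shows "z ^ 4 \<le> (ln N)\<^sup>2 * z\<^sup>2 + 64 / N * (exp (2 * z) + exp (- 2 * z))"
proof (cases "\<bar>z\<bar> \<le> ln N")
  case True
  then have "z\<^sup>2 \<le> (ln N)\<^sup>2"
    by (metis abs_ge_zero power2_abs power_mono)
  then have "z\<^sup>2 * z\<^sup>2 \<le> (ln N)\<^sup>2 * z\<^sup>2" by (intro mult_right_mono) auto
  moreover have "0 \<le> 64 / N * (exp (2 * z) + exp (- 2 * z))" using N by simp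
  ultimately show ?thesis by (simp flip: power_add)
next
  case False
  have "N \<le> exp \<bar>z\<bar>"
    using False N by (metis exp_le_cancel_iff exp_ln less_eq_real_def linorder_not_le order_less_le_trans zero_less_one)
  have "z ^ 4 / 64 * N \<le> exp \<bar>z\<bar> * exp \<bar>z\<bar>"
    using fourth_power_le_exp[of "\<bar>z\<bar>"] N \<open>N \<le> exp \<bar>z\<bar>\<close>
    by (intro mult_mono) auto
  also have "\<dots> \<le> exp (2 * z) + exp (- 2 * z)"
    by (cases "0 \<le> z") (auto simp flip: exp_add)
  finally have "z ^ 4 \<le> 64 / N * (exp (2 * z) + exp (- 2 * z))"
    using N by (simp add: field_simps)
  moreover have "0 \<le> (ln N)\<^sup>2 * z\<^sup>2" by simp
  ultimately show ?thesis by linarith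
qed

text \<open>The difference \<open>exp y + exp (- y) - 2\<close> is the square of
  \<open>exp (y / 2) - exp (- y / 2)\<close>, which is at least \<open>y\<close> for nonnegative
  \<open>y\<close>.\<close>

lemma exp_sym_ge:
  fixes y :: real
  shows "2 + y\<^sup>2 \<le> exp y + exp (- y)"
proof -
  have pos: "2 + y\<^sup>2 \<le> exp y + exp (- y)" if y: "0 \<le> y" for y :: real
  proof -
    let ?a = "y / 2"
    have "2 * ?a \<le> exp ?a - exp (- ?a)"
      using exp_lower_Taylor_quadratic[of ?a] exp_neg_le_quadratic[of ?a] y by simp
    then have "y\<^sup>2 \<le> (exp ?a - exp (- ?a))\<^sup>2" using y by (intro power_mono) auto
    also have "\<dots> = exp y + exp (- y) - 2"
    proof -
      have "(exp ?a)\<^sup>2 = exp y" "(exp (- ?a))\<^sup>2 = exp (- y)" "exp ?a * exp (- ?a) = 1"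
        by (simp_all flip: exp_double exp_add)
      then show ?thesis by (simp add: power2_diff)
    qed
    finally show ?thesis by simp
  qed
  show ?thesis using pos[of y] pos[of "- y"] by (cases "0 \<le> y") auto
qed

section \<open>Quadratic forms of the covariances and the multi-domain model\<close>

text \<open>The squared norm of \<open>G w\<close>, that is the quadratic form of
  \<open>G^T G\<close>. As a sum of squared linear functionals it is accessible to Maurey's
  argument.\<close>

definition qform :: "nat \<Rightarrow> (nat \<Rightarrow> nat \<Rightarrow> real) \<Rightarrow> (nat \<Rightarrow> real) \<Rightarrow> real" where
  "qform d G w = (\<Sum>k<d. (ip d (G k) w)\<^sup>2)"

lemma qform_nonneg: "0 \<le> qform d G w"
  by (simp add: qform_def sum_nonneg)

lemma qform_scale: "qform d G (\<lambda>j. c * w j) = c\<^sup>2 * qform d G w"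
  by (simp add: qform_def ip_scale_right power_mult_distrib sum_distrib_left)

lemma qform_single: "j < d \<Longrightarrow> qform d G (\<lambda>i. if i = j then 1 else 0) = (\<Sum>k<d. (G k j)\<^sup>2)"
  by (simp add: qform_def ip_single)

lemma qform_triangle: "qform d G v \<le> 2 * qform d G w + 2 * qform d G (\<lambda>j. w j - v j)"
proof -
  have "(ip d (G k) v)\<^sup>2 \<le> 2 * (ip d (G k) w)\<^sup>2 + 2 * (ip d (G k) (\<lambda>j. w j - v j))\<^sup>2" for k
    unfolding ip_diff_right using sum_squares_bound[of "2 * ip d (G k) w" "ip d (G k) v"]
      zero_le_power2[of "2 * ip d (G k) w - ip d (G k) v"]
    by (simp add: power2_eq_square algebra_simps)
  then have "qform d G v \<le> (\<Sum>k<d. 2 * (ip d (G k) w)\<^sup>2 + 2 * (ip d (G k) (\<lambda>j. w j - v j))\<^sup>2)"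
    unfolding qform_def by (rule sum_mono)
  then show ?thesis by (simp add: qform_def sum.distrib sum_distrib_left)
qed

text \<open>The matrices \<open>G t\<close> are factors of the covariances, \<open>\<Sigma>\<^sub>t = (G t)\<^sup>T (G t)\<close>, and \<open>\<tau>\<close>
  stands for \<open>Tr \<Sigma>\<close>.\<close>

locale multi_domain =
  fixes d n T :: nat and p :: "nat \<Rightarrow> (nat \<Rightarrow> real) measure"
    and G :: "nat \<Rightarrow> nat \<Rightarrow> nat \<Rightarrow> real" and \<tau> \<sigma> \<rho> \<delta> :: real
  assumes dims: "1 \<le> d" "1 \<le> n" "1 \<le> T"
    and pos: "0 < \<sigma>" "0 < \<rho>" "0 < \<delta>" "\<delta> < 1"
    and prob: "\<And>t. prob_space (p t)"
    and sets_p[measurable_cong]: "\<And>t. sets (p t) = sets (PiM {..<d} (\<lambda>_. (borel :: real measure)))"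
    and second_moment: "\<And>t i j. i < d \<Longrightarrow> j < d \<Longrightarrow>
          integrable (p t) (\<lambda>x. x i * x j) \<and> (\<integral>x. x i * x j \<partial>p t) = (\<Sum>k<d. G t k i * G t k j)"
    and trace_le: "\<And>t. (\<Sum>k<d. \<Sum>j<d. (G t k j)\<^sup>2) \<le> \<tau>"
    and qform_pos: "\<And>t w i. i < d \<Longrightarrow> w i \<noteq> 0 \<Longrightarrow> 0 < qform d (G t) w"
    and subg: "\<And>t w. 0 < qform d (G t) w \<Longrightarrow> subgaussian_rv (p t) (\<lambda>x. ip d w x) (\<rho>\<^sup>2 * qform d (G t) w)"
begin

abbreviation "q t \<equiv> qform d (G t)"
abbreviation "gauss \<equiv> density lborel (normal_density 0 \<sigma>)"
abbreviation "P \<equiv> train_space n T p \<sigma>"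
abbreviation "N \<equiv> real n * real T"

text \<open>The single logarithmic factor in which all others are absorbed. The summand 1 makes it
  at least 1, so its powers increase with the exponent.\<close>

definition "Lg = 1 + ln (real (d * n * T) / \<delta>)"

lemma coord_measurable[measurable]: "j < d \<Longrightarrow> (\<lambda>x. x j) \<in> borel_measurable (p t)"
  using measurable_component_singleton[of j "{..<d}" "\<lambda>_. borel"]
  by (simp cong: measurable_cong_sets add: sets_p)

lemma ip_measurable[measurable]: "(\<lambda>x. ip d w x) \<in> borel_measurable (p t)"
  unfolding ip_def by measurable

lemma second_moment_ip:
  "integrable (p t) (\<lambda>x. (ip d w x)\<^sup>2)" "(\<integral>x. (ip d w x)\<^sup>2 \<partial>p t) = q t w"
proof -
  have eq: "(ip d w x)\<^sup>2 = (\<Sum>i<d. \<Sum>j<d. (w i * w j) * (x i * x j))" for x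
    by (simp add: ip_def power2_eq_square sum_product mult_ac)
  have hb: "has_bochner_integral (p t) (\<lambda>x. (ip d w x)\<^sup>2)
      (\<Sum>i<d. \<Sum>j<d. (w i * w j) * (\<Sum>k<d. G t k i * G t k j))"
    unfolding eq using second_moment
    by (intro has_bochner_integral_sum has_bochner_integral_mult_right)
      (auto simp: has_bochner_integral_iff)
  have "(\<Sum>i<d. \<Sum>j<d. (w i * w j) * (\<Sum>k<d. G t k i * G t k j))
      = (\<Sum>i<d. \<Sum>j<d. \<Sum>k<d. (G t k i * w i) * (G t k j * w j))"
    by (simp add: sum_distrib_left mult_ac)
  also have "\<dots> = (\<Sum>i<d. \<Sum>k<d. \<Sum>j<d. (G t k i * w i) * (G t k j * w j))"
    by (intro sum.cong refl sum.swap)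
  also have "\<dots> = (\<Sum>k<d. \<Sum>i<d. \<Sum>j<d. (G t k i * w i) * (G t k j * w j))"
    by (rule sum.swap)
  also have "\<dots> = q t w"
    by (simp add: qform_def ip_def power2_eq_square sum_product)
  finally show "integrable (p t) (\<lambda>x. (ip d w x)\<^sup>2)" "(\<integral>x. (ip d w x)\<^sup>2 \<partial>p t) = q t w"
    using hb unfolding has_bochner_integral_iff by auto
qed

lemma exp_moment:
  assumes "0 < q t w"
  shows "integrable (p t) (\<lambda>x. exp (l * ip d w x))"
    "(\<integral>x. exp (l * ip d w x) \<partial>p t) \<le> exp (l\<^sup>2 * (\<rho>\<^sup>2 * q t w) / 2)"
  using subg[OF assms] by (auto simp: subgaussian_rv_def)

lemma q_single: "j < d \<Longrightarrow> 0 < q t (\<lambda>i. if i = j then 1 else 0)" "j < d \<Longrightarrow> q t (\<lambda>i. if i = j then 1 else 0) \<le> \<tau>"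
proof -
  assume j: "j < d"
  show "0 < q t (\<lambda>i. if i = j then 1 else 0)" using j qform_pos by simp
  have "(\<Sum>k<d. (G t k j)\<^sup>2) \<le> (\<Sum>k<d. \<Sum>j<d. (G t k j)\<^sup>2)"
    using j by (intro sum_mono member_le_sum) auto
  then show "q t (\<lambda>i. if i = j then 1 else 0) \<le> \<tau>"
    using trace_le[of t] j by (simp add: qform_single)
qed

lemma tau_pos: "0 < \<tau>"
  using q_single[of 0 0] dims by simp

text \<open>A variance proxy cannot be far below the variance: averaging \<open>exp_sym_ge\<close>
  over a coordinate projection gives \<open>1 / \<rho>\<^sup>2 \<le> exp 1 - 1 \<le> 2\<close>. This
  lower bound lets absolute constants be absorbed into powers of \<open>\<rho>\<close>.\<close>

lemma rho_sq_ge: "1 \<le> 2 * \<rho>\<^sup>2"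
proof -
  interpret prob_space "p 0" by (rule prob)
  define w where "w = (\<lambda>i. if i = (0::nat) then 1 else (0::real))"
  have qw: "0 < q 0 w" using q_single(1)[of 0 0] dims by (simp add: w_def)
  \<comment> \<open>This choice makes the exponent
    \<open>l\<^sup>2 * (\<rho>\<^sup>2 * q 0 w) / 2\<close> of the subgaussian bound equal to
    1.\<close>
  define l where "l = sqrt (2 / (\<rho>\<^sup>2 * q 0 w))"
  have l2: "l\<^sup>2 = 2 / (\<rho>\<^sup>2 * q 0 w)" using qw by (simp add: l_def)
  note ex = exp_moment[OF qw, of l] exp_moment[OF qw, of "- l"]
  have "(\<integral>x. 2 + l\<^sup>2 * (ip d w x)\<^sup>2 \<partial>p 0) \<le> (\<integral>x. exp (l * ip d w x) + exp (- l * ip d w x) \<partial>p 0)"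
  proof (rule integral_mono)
    show "integrable (p 0) (\<lambda>x. 2 + l\<^sup>2 * (ip d w x)\<^sup>2)"
      by (intro Bochner_Integration.integrable_add integrable_mult_right second_moment_ip) simp
    show "integrable (p 0) (\<lambda>x. exp (l * ip d w x) + exp (- l * ip d w x))"
      using ex by (intro Bochner_Integration.integrable_add)
    show "2 + l\<^sup>2 * (ip d w x)\<^sup>2 \<le> exp (l * ip d w x) + exp (- l * ip d w x)" for x
      using exp_sym_ge[of "l * ip d w x"] by (simp add: power_mult_distrib)
  qed
  also have "\<dots> \<le> 2 * exp (l\<^sup>2 * (\<rho>\<^sup>2 * q 0 w) / 2)"
    using ex by simp
  also have "(\<integral>x. 2 + l\<^sup>2 * (ip d w x)\<^sup>2 \<partial>p 0) = 2 + l\<^sup>2 * q 0 w"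
    using second_moment_ip[of 0 w] by (simp add: prob_space)
  finally have "2 + 2 / \<rho>\<^sup>2 \<le> 2 * exp 1"
    using qw pos by (simp add: l2)
  then have "1 / \<rho>\<^sup>2 \<le> 2" using exp_le by simp
  then show ?thesis using pos by (simp add: field_simps)
qed

lemma N_ge_1: "1 \<le> N"
  using dims by (metis mult_le_mono nat_mult_1 of_nat_1 of_nat_le_iff of_nat_mult)

lemma dN_ge: "N \<le> real (d * n * T)" "1 \<le> real d"
  using dims mult_right_mono[of 1 "real d" "N"] by (auto simp: mult.assoc)

lemma Lg_ge_1: "1 \<le> Lg"
proof -
  have "1 \<le> real (d * n * T)" using dN_ge N_ge_1 by linarith
  then have "1 \<le> real (d * n * T) / \<delta>" using pos by (simp add: field_simps)
  then show ?thesis by (simp add: Lg_def)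
qed

lemma dN_le_dN_div_delta: "real d * N \<le> real d * N / \<delta>"
proof -
  have "0 \<le> real d * N" by simp
  then have "real d * N * \<delta> \<le> real d * N"
    using pos by (intro mult_left_le) auto
  then show ?thesis using pos by (simp add: pos_le_divide_eq)
qed

lemma Lg_eq: "Lg = 1 + ln (real d * N / \<delta>)"
  by (simp add: Lg_def mult.assoc)

text \<open>The threshold \<open>4 * (d * N)\<close> covers both counts that occur: twice the number
  of functionals fed to \<open>maurey\<close>, and the \<open>3 * d\<close> bound on the number of
  signed atoms.\<close>

lemma ln_le_Lg:
  assumes "0 < y" "y \<le> 4 * (real d * N)"
  shows "ln y \<le> 3 * Lg"
proof -
  have pos': "0 < real d * N" using dims by simp
  have "ln y \<le> ln (4 * (real d * N / \<delta>))"
    using assms dN_le_dN_div_delta by (intro ln_mono) auto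
  also have "\<dots> = ln 4 + ln (real d * N / \<delta>)"
    using pos' pos by (intro ln_mult_pos) auto
  also have "\<dots> \<le> 3 + (Lg - 1)"
    using ln_le_minus_one[of 4] by (simp add: Lg_eq)
  also have "\<dots> \<le> 3 * Lg" using Lg_ge_1 by simp
  finally show ?thesis .
qed

lemma ln_N_le_Lg: "1 + ln N \<le> Lg"
proof -
  have "N \<le> real d * N / \<delta>"
    using dN_le_dN_div_delta dN_ge by (simp add: mult.assoc)
  then show ?thesis unfolding Lg_eq using N_ge_1 by (intro add_left_mono ln_mono) auto
qed

text \<open>The budget of the union bound: at most \<open>7 * (d * N)\<close> bad events, each of
  probability at most \<open>exp (- (3 * Lg))\<close>.\<close>

lemma exp_Lg_le: "7 * (real d * N) * exp (- (3 * Lg)) \<le> \<delta>"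
proof -
  define y where "y = real d * N / \<delta>"
  have y: "1 \<le> y" using dN_le_dN_div_delta N_ge_1 dN_ge unfolding y_def by (simp add: mult.assoc)
  have "7 \<le> exp (1::real) ^ 3"
  proof -
    have "2 ^ 3 \<le> exp (1::real) ^ 3"
      using exp_ge_add_one_self[of 1] by (intro power_mono) auto
    then show ?thesis by simp
  qed
  moreover have "y \<le> y ^ 3" using y by (simp add: self_le_power)
  ultimately have "7 * y \<le> exp 1 ^ 3 * y ^ 3"
    using y by (intro mult_mono) auto
  also have "\<dots> = exp (3 * Lg)"
  proof -
    have "exp 1 * y = exp Lg" using y by (simp add: Lg_eq exp_add flip: y_def)
    then have "exp 1 ^ 3 * y ^ 3 = exp Lg ^ 3" by (simp only: power_mult_distrib[symmetric])
    then show ?thesis using exp_of_nat_mult[of 3 Lg] by simp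
  qed
  finally have "7 * y * exp (- (3 * Lg)) \<le> 1" by (simp add: exp_minus field_simps)
  then show ?thesis using pos by (simp add: y_def field_simps)
qed

end

section \<open>The high-probability event\<close>

context multi_domain
begin

text \<open>On the good event \<open>K2\<close> bounds all squared coordinates of the samples and \<open>W\<close> bounds the sum of
  the squares of each coordinate; \<open>\<rho>\<^sup>2 H (q t w)\<^sup>2\<close> bounds the fourth moment of \<open>ip d w x\<close>.\<close>

definition "K2 = 6 * \<rho>\<^sup>2 * \<tau> * Lg"
definition "W = 2 * N * \<tau> + 3 * Lg * K2"
definition "H = (ln N)\<^sup>2 + 2304"

lemma K2_pos: "0 < K2"
  using pos tau_pos Lg_ge_1 by (simp add: K2_def)

lemma W_pos: "0 < W"
  using K2_pos tau_pos Lg_ge_1 dims by (simp add: W_def add_pos_pos)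

lemma prob_space_gauss: "prob_space gauss"
  using pos by (intro prob_space_normal_density)

lemma fst_coord_measurable[measurable]:
  "j < d \<Longrightarrow> (\<lambda>z. fst z j) \<in> borel_measurable (p t \<Otimes>\<^sub>M gauss)"
  by (rule measurable_compose[OF measurable_fst coord_measurable])

lemma fst_ip_measurable[measurable]:
  "(\<lambda>z. ip d w (fst z)) \<in> borel_measurable (p t \<Otimes>\<^sub>M gauss)"
  by (rule measurable_compose[OF measurable_fst ip_measurable])

lemma nn_integral_fst_only:
  assumes "f \<in> borel_measurable (p t)"
  shows "(\<integral>\<^sup>+z. f (fst z) \<partial>(p t \<Otimes>\<^sub>M gauss)) = (\<integral>\<^sup>+x. f x \<partial>p t)"
proof -
  interpret E: prob_space gauss by (rule prob_space_gauss)
  have "(\<lambda>z. f (fst z)) \<in> borel_measurable (p t \<Otimes>\<^sub>M gauss)"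
    by (rule measurable_compose[OF measurable_fst assms])
  from E.nn_integral_fst[OF this] show ?thesis
    by (simp add: E.emeasure_space_1 del: space_density)
qed

lemma nn_integral_exp_le:
  assumes "integrable (p t) f" "\<And>x. 0 \<le> f x" "(\<integral>x. f x \<partial>p t) \<le> c"
  shows "(\<integral>\<^sup>+z. ennreal (f (fst z)) \<partial>(p t \<Otimes>\<^sub>M gauss)) \<le> ennreal c"
proof -
  have "(\<integral>\<^sup>+z. ennreal (f (fst z)) \<partial>(p t \<Otimes>\<^sub>M gauss)) = (\<integral>\<^sup>+x. ennreal (f x) \<partial>p t)"
    using assms by (intro nn_integral_fst_only) auto
  also have "\<dots> = ennreal (\<integral>x. f x \<partial>p t)"
    using assms by (intro nn_integral_eq_integral) auto
  finally show ?thesis using assms by (simp add: ennreal_leI)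
qed

lemma chernoff_train:
  fixes g :: "nat \<Rightarrow> nat \<Rightarrow> (nat \<Rightarrow> real) \<times> real \<Rightarrow> real"
  assumes g: "\<And>t i. t < T \<Longrightarrow> i < n \<Longrightarrow> g t i \<in> borel_measurable (p t \<Otimes>\<^sub>M gauss)"
    and mgf: "\<And>t i. t < T \<Longrightarrow> i < n \<Longrightarrow>
        (\<integral>\<^sup>+z. ennreal (exp (g t i z)) \<partial>(p t \<Otimes>\<^sub>M gauss)) \<le> ennreal (exp (b t i))"
  shows "{\<omega> \<in> space P. (\<Sum>t<T. \<Sum>i<n. b t i) + s \<le> (\<Sum>t<T. \<Sum>i<n. g t i (\<omega> (t, i)))} \<in> sets P"
    and "measure P {\<omega> \<in> space P. (\<Sum>t<T. \<Sum>i<n. b t i) + s \<le> (\<Sum>t<T. \<Sum>i<n. g t i (\<omega> (t, i)))} \<le> exp (- s)"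
proof -
  let ?M = "\<lambda>(t, i). p t \<Otimes>\<^sub>M gauss"
  let ?I = "{..<T} \<times> {..<n}"
  have M: "prob_space (?M a)" for a :: "nat \<times> nat"
    using prob prob_space_gauss by (cases a) (auto intro: prob_space_pair)
  have *: "(\<Sum>t<T. \<Sum>i<n. f t i) = (\<Sum>a\<in>?I. f (fst a) (snd a))" for f :: "nat \<Rightarrow> nat \<Rightarrow> real"
    by (simp add: sum.cartesian_product case_prod_beta)
  have "(\<lambda>a. g (fst a) (snd a)) a \<in> borel_measurable (?M a)"
    "(\<integral>\<^sup>+z. ennreal (exp ((\<lambda>a. g (fst a) (snd a)) a z)) \<partial>?M a) \<le> ennreal (exp (b (fst a) (snd a)))"
    if "a \<in> ?I" for a
    using g[of "fst a" "snd a"] mgf[of "fst a" "snd a"] that by (auto simp: case_prod_beta)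
  note chernoff_PiM[where I = ?I and M = ?M and s = s, OF _ M this]
  then show "{\<omega> \<in> space P. (\<Sum>t<T. \<Sum>i<n. b t i) + s \<le> (\<Sum>t<T. \<Sum>i<n. g t i (\<omega> (t, i)))} \<in> sets P"
    "measure P {\<omega> \<in> space P. (\<Sum>t<T. \<Sum>i<n. b t i) + s \<le> (\<Sum>t<T. \<Sum>i<n. g t i (\<omega> (t, i)))} \<le> exp (- s)"
    unfolding train_space_def * by simp_all
qed

lemma prob_space_P: "prob_space P"
  unfolding train_space_def using prob prob_space_gauss
  by (intro prob_space_PiM) (auto intro: prob_space_pair)

text \<open>A self-normalised sum. The quadratic correction is the Gaussian log moment generating
  function given the covariates, so each factor of the exponential has mean exactly 1. The signs
  \<open>l\<close> and \<open>- l\<close> give the two tails.\<close>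

definition noise_bad where
  "noise_bad l j = {\<omega> \<in> space P. 3 * Lg \<le>
     (\<Sum>t<T. \<Sum>i<n. l * (fst (\<omega> (t, i)) j * snd (\<omega> (t, i))) - l\<^sup>2 * \<sigma>\<^sup>2 / 2 * (fst (\<omega> (t, i)) j)\<^sup>2)}"

lemma noise_bad:
  assumes j: "j < d"
  shows "noise_bad l j \<in> sets P" "measure P (noise_bad l j) \<le> exp (- (3 * Lg))"
proof -
  define g :: "nat \<Rightarrow> nat \<Rightarrow> (nat \<Rightarrow> real) \<times> real \<Rightarrow> real"
    where "g t i z = l * (fst z j * snd z) - l\<^sup>2 * \<sigma>\<^sup>2 / 2 * (fst z j)\<^sup>2" for t i z
  have g: "g t i \<in> borel_measurable (p t \<Otimes>\<^sub>M gauss)" for t i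
    unfolding g_def using j by measurable
  have mgf: "(\<integral>\<^sup>+z. ennreal (exp (g t i z)) \<partial>(p t \<Otimes>\<^sub>M gauss)) \<le> ennreal (exp ((\<lambda>_ _. 0) t i))" for t i
  proof -
    interpret E: prob_space gauss by (rule prob_space_gauss)
    interpret X: prob_space "p t" by (rule prob)
    have "(\<integral>\<^sup>+z. ennreal (exp (g t i z)) \<partial>(p t \<Otimes>\<^sub>M gauss))
        = (\<integral>\<^sup>+x. \<integral>\<^sup>+e. ennreal (exp (g t i (x, e))) \<partial>gauss \<partial>p t)"
      by (rule E.nn_integral_fst[symmetric]) (use g in simp)
    also have "\<dots> = (\<integral>\<^sup>+x. 1 \<partial>p t)"
    proof (intro nn_integral_cong)
      fix x
      have "g t i (x, e) = (l * x j) * e - (l * x j)\<^sup>2 * \<sigma>\<^sup>2 / 2" for e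
        by (simp add: g_def power_mult_distrib)
      then show "(\<integral>\<^sup>+e. ennreal (exp (g t i (x, e))) \<partial>gauss) = 1"
        using normal_mgf[OF pos(1), of "l * x j"] by simp
    qed
    also have "\<dots> = 1" by (simp add: X.emeasure_space_1)
    finally show ?thesis by simp
  qed
  note chernoff_train[where g = g and b = "\<lambda>_ _. 0" and s = "3 * Lg", OF g mgf]
  then show "noise_bad l j \<in> sets P" "measure P (noise_bad l j) \<le> exp (- (3 * Lg))"
    unfolding noise_bad_def g_def sum.neutral_const add_0 by (simp_all only:)
qed

definition coord_bad where
  "coord_bad r t i j = {\<omega> \<in> space P. r\<^sup>2 * (\<rho>\<^sup>2 * \<tau>) / 2 + 3 * Lg \<le> r * fst (\<omega> (t, i)) j}"

lemma coord_bad: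
  assumes j: "j < d" and ti: "t < T" "i < n"
  shows "coord_bad r t i j \<in> sets P" "measure P (coord_bad r t i j) \<le> exp (- (3 * Lg))"
proof -
  \<comment> \<open>The functions vanish except at the index \<open>(t, i)\<close>, so the bound for
    sums specialises to a single sample coordinate.\<close>
  define g :: "nat \<Rightarrow> nat \<Rightarrow> (nat \<Rightarrow> real) \<times> real \<Rightarrow> real"
    where "g t' i' z = (if (t', i') = (t, i) then r * fst z j else 0)" for t' i' z
  define b where "b t' i' = (if (t', i') = (t, i) then r\<^sup>2 * (\<rho>\<^sup>2 * \<tau>) / 2 else 0)" for t' i'
  have g: "g t' i' \<in> borel_measurable (p t' \<Otimes>\<^sub>M gauss)" for t' i'
    unfolding g_def using j by (cases "(t', i') = (t, i)") auto
  have mgf: "(\<integral>\<^sup>+z. ennreal (exp (g t' i' z)) \<partial>(p t' \<Otimes>\<^sub>M gauss)) \<le> ennreal (exp (b t' i'))" for t' i'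
  proof (cases "(t', i') = (t, i)")
    case True
    let ?e = "\<lambda>i. if i = j then 1 else (0::real)"
    have ip: "ip d ?e x = x j" for x
      using ip_single[OF j, of x 1] by (simp add: ip_commute)
    have "(\<integral>x. exp (r * x j) \<partial>p t) \<le> exp (r\<^sup>2 * (\<rho>\<^sup>2 * q t ?e) / 2)"
      using exp_moment(2)[OF q_single(1)[OF j], of t r] by (simp only: ip)
    also have "\<dots> \<le> exp (r\<^sup>2 * (\<rho>\<^sup>2 * \<tau>) / 2)"
      using q_single(2)[OF j, of t] by (auto intro!: mult_left_mono)
    finally have "(\<integral>\<^sup>+z. ennreal (exp (r * fst z j)) \<partial>(p t \<Otimes>\<^sub>M gauss)) \<le> ennreal (exp (r\<^sup>2 * (\<rho>\<^sup>2 * \<tau>) / 2))"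
      using exp_moment(1)[OF q_single(1)[OF j], of t r]
      by (intro nn_integral_exp_le[where f = "\<lambda>x. exp (r * x j)"]) (auto simp: ip)
    with True show ?thesis by (simp add: g_def b_def)
  next
    case False
    interpret Z: prob_space "p t' \<Otimes>\<^sub>M gauss"
      using prob prob_space_gauss by (rule prob_space_pair)
    show ?thesis using False by (auto simp add: g_def b_def Z.emeasure_space_1 simp del: space_pair_measure)
  qed
  have inner: "(\<Sum>i'<n. if t' = t \<and> i' = i then c i' else 0) = (if t' = t then c i else (0::real))" for t' c
    using ti by auto
  have *: "(\<Sum>t'<T. \<Sum>i'<n. b t' i') = r\<^sup>2 * (\<rho>\<^sup>2 * \<tau>) / 2"
    "(\<Sum>t'<T. \<Sum>i'<n. g t' i' (\<omega> (t', i'))) = r * fst (\<omega> (t, i)) j" for \<omega>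
    using ti by (simp_all add: b_def g_def inner)
  note chernoff_train[where g = g and b = b and s = "3 * Lg", OF g mgf]
  then show "coord_bad r t i j \<in> sets P" "measure P (coord_bad r t i j) \<le> exp (- (3 * Lg))"
    unfolding coord_bad_def * by (simp_all only:)
qed

text \<open>Squares of subgaussian variables are only subexponential. Truncating the normalised
  square at 1 permits \<open>exp y \<le> 1 + 2 * y\<close> on the unit interval; where all
  coordinates are at most \<open>sqrt K2\<close> in absolute value, the truncation is
  inactive.\<close>

definition energy_bad where
  "energy_bad j = {\<omega> \<in> space P. 2 * N * \<tau> / K2 + 3 * Lg \<le>
     (\<Sum>t<T. \<Sum>i<n. min ((fst (\<omega> (t, i)) j)\<^sup>2 / K2) 1)}"

lemma energy_bad:
  assumes j: "j < d"
  shows "energy_bad j \<in> sets P" "measure P (energy_bad j) \<le> exp (- (3 * Lg))"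
proof -
  define g :: "nat \<Rightarrow> nat \<Rightarrow> (nat \<Rightarrow> real) \<times> real \<Rightarrow> real"
    where "g t i z = min ((fst z j)\<^sup>2 / K2) 1" for t i z
  have g: "g t i \<in> borel_measurable (p t \<Otimes>\<^sub>M gauss)" for t i
    unfolding g_def using j by measurable
  have mgf: "(\<integral>\<^sup>+z. ennreal (exp (g t i z)) \<partial>(p t \<Otimes>\<^sub>M gauss)) \<le> ennreal (exp ((\<lambda>_ _. 2 * \<tau> / K2) t i))" for t i
  proof -
    interpret X: prob_space "p t" by (rule prob)
    let ?e = "\<lambda>i. if i = j then 1 else (0::real)"
    have ip: "ip d ?e x = x j" for x
      using ip_single[OF j, of x 1] by (simp add: ip_commute)
    have sq: "integrable (p t) (\<lambda>x. (x j)\<^sup>2)" "(\<integral>x. (x j)\<^sup>2 \<partial>p t) = q t ?e"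
      using second_moment_ip[of t ?e] by (simp_all only: ip)
    have "(\<integral>x. 1 + 2 / K2 * (x j)\<^sup>2 \<partial>p t) = 1 + 2 / K2 * q t ?e"
      using sq by (simp add: X.prob_space)
    also have "\<dots> \<le> 1 + 2 * \<tau> / K2"
      using q_single(2)[OF j, of t] K2_pos by (simp add: divide_right_mono)
    also have "\<dots> \<le> exp (2 * \<tau> / K2)" by simp
    finally have le: "(\<integral>x. 1 + 2 / K2 * (x j)\<^sup>2 \<partial>p t) \<le> exp (2 * \<tau> / K2)" .
    have "(\<integral>\<^sup>+z. ennreal (exp (g t i z)) \<partial>(p t \<Otimes>\<^sub>M gauss))
        \<le> (\<integral>\<^sup>+z. ennreal (1 + 2 / K2 * (fst z j)\<^sup>2) \<partial>(p t \<Otimes>\<^sub>M gauss))"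
    proof (intro nn_integral_mono ennreal_leI)
      fix z :: "(nat \<Rightarrow> real) \<times> real"
      define y where "y = g t i z"
      have y: "0 \<le> y" "y \<le> 1" "y \<le> (fst z j)\<^sup>2 / K2" using K2_pos by (auto simp: y_def g_def)
      have "exp y \<le> 1 + y + y\<^sup>2" using y by (intro exp_le_quadratic) auto
      also have "y\<^sup>2 \<le> y" using y by (simp add: power2_eq_square mult_left_le)
      finally show "exp (g t i z) \<le> 1 + 2 / K2 * (fst z j)\<^sup>2" using y(3) by (simp add: y_def)
    qed
    also have "\<dots> \<le> ennreal (exp (2 * \<tau> / K2))"
      using sq le K2_pos by (intro nn_integral_exp_le[where f = "\<lambda>x. 1 + 2 / K2 * (x j)\<^sup>2"]) auto
    finally show ?thesis by simp
  qed
  note chernoff_train[where g = g and b = "\<lambda>_ _. 2 * \<tau> / K2" and s = "3 * Lg", OF g mgf]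
  moreover have "(\<Sum>t<T. \<Sum>i<n. 2 * \<tau> / K2) = 2 * N * \<tau> / K2" by simp
  ultimately show "energy_bad j \<in> sets P" "measure P (energy_bad j) \<le> exp (- (3 * Lg))"
    unfolding energy_bad_def g_def by (simp_all only:)
qed

text \<open>A second-order expansion leaves the fourth moment of the projection, which truncation
  bounds by \<open>\<rho>\<^sup>2 * H * (q t w)\<^sup>2\<close>. The condition on \<open>s\<close>
  makes the quadratic term at most half of the linear one.\<close>

lemma lower_tail_mgf:
  assumes q: "0 < q t w" and N: "\<rho> ^ 4 \<le> N" and s: "0 \<le> s" "s * (\<rho>\<^sup>2 * H * q t w) \<le> 1"
  shows "(\<integral>\<^sup>+z. ennreal (exp (- s * (ip d w (fst z))\<^sup>2)) \<partial>(p t \<Otimes>\<^sub>M gauss)) \<le> ennreal (exp (- (s / 2) * q t w))"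
proof -
  interpret X: prob_space "p t" by (rule prob)
  \<comment> \<open>The subgaussian scale of the projection: after division by \<open>c\<close>, the
    exponentials with parameter 2 and -2 have mean at most \<open>exp 2 \<le> 9\<close>.\<close>
  define c where "c = \<rho> * sqrt (q t w)"
  have c: "0 < c" using pos q by (simp add: c_def)
  have c2: "c\<^sup>2 = \<rho>\<^sup>2 * q t w" using q by (simp add: c_def power_mult_distrib)
  let ?z = "\<lambda>x. ip d w x / c"
  let ?up = "\<lambda>x. 1 - s * (ip d w x)\<^sup>2
    + s\<^sup>2 * c ^ 4 / 2 * ((ln N)\<^sup>2 / c\<^sup>2 * (ip d w x)\<^sup>2 + 64 / N * (exp (2 / c * ip d w x) + exp (- 2 / c * ip d w x)))"
  have up: "exp (- s * (ip d w x)\<^sup>2) \<le> ?up x" for x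
  proof -
    have "exp (- (s * (ip d w x)\<^sup>2)) \<le> 1 - s * (ip d w x)\<^sup>2 + (s * (ip d w x)\<^sup>2)\<^sup>2 / 2"
      using s by (intro exp_neg_le_quadratic) auto
    also have "(s * (ip d w x)\<^sup>2)\<^sup>2 / 2 = s\<^sup>2 * c ^ 4 / 2 * (?z x) ^ 4"
      using c by (simp add: power_mult_distrib power_divide flip: power_mult)
    also have "\<dots> \<le> s\<^sup>2 * c ^ 4 / 2 * ((ln N)\<^sup>2 * (?z x)\<^sup>2 + 64 / N * (exp (2 * ?z x) + exp (- 2 * ?z x)))"
      using fourth_power_le_truncated[OF N_ge_1, of "?z x"] by (intro mult_left_mono) simp_all
    finally show ?thesis by (simp add: power_divide)
  qed
  note ex = exp_moment[OF q, of "2 / c"] exp_moment[OF q, of "- 2 / c"]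
  have ex2: "(\<integral>x. exp (2 / c * ip d w x) \<partial>p t) \<le> 9" "(\<integral>x. exp (- 2 / c * ip d w x) \<partial>p t) \<le> 9"
  proof -
    have "exp (2::real) \<le> 9"
      using power_mono[OF exp_le, of 2] by (simp flip: exp_double)
    moreover have "(2 / c)\<^sup>2 * (\<rho>\<^sup>2 * q t w) / 2 = 2" "(- 2 / c)\<^sup>2 * (\<rho>\<^sup>2 * q t w) / 2 = 2"
      unfolding c2[symmetric] using c by (simp_all add: power_divide)
    ultimately show "(\<integral>x. exp (2 / c * ip d w x) \<partial>p t) \<le> 9" "(\<integral>x. exp (- 2 / c * ip d w x) \<partial>p t) \<le> 9"
      using ex(2,4) by (simp_all only:)
  qed
  note sm = second_moment_ip[of t w]
  have int: "integrable (p t) ?up"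
    using ex sm
    by (intro Bochner_Integration.integrable_add Bochner_Integration.integrable_diff integrable_mult_right) auto
  have "(\<integral>x. ?up x \<partial>p t) = 1 - s * q t w + s\<^sup>2 * c ^ 4 / 2 * ((ln N)\<^sup>2 / c\<^sup>2 * q t w
     + 64 / N * ((\<integral>x. exp (2 / c * ip d w x) \<partial>p t) + (\<integral>x. exp (- 2 / c * ip d w x) \<partial>p t)))"
    using ex sm by (simp add: X.prob_space)
  also have "\<dots> \<le> 1 - s * q t w + s\<^sup>2 * c ^ 4 / 2 * ((ln N)\<^sup>2 / c\<^sup>2 * q t w + 64 / N * (9 + 9))"
    using ex2 N_ge_1 c by (intro add_left_mono mult_left_mono add_mono) auto
  also have "\<dots> \<le> 1 - s * q t w + s * q t w * (s * (\<rho>\<^sup>2 * H * q t w)) / 2"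
  proof -
    have c4: "c ^ 4 = \<rho> ^ 4 * (q t w)\<^sup>2"
      using c2 by (metis (no_types, lifting) mult_2 numeral_Bit0 power_add power_mult_distrib power2_eq_square)
    have "c ^ 4 * ((ln N)\<^sup>2 / c\<^sup>2 * q t w) = (q t w)\<^sup>2 * (\<rho>\<^sup>2 * (ln N)\<^sup>2)"
    proof -
      have "c ^ 4 * ((ln N)\<^sup>2 / c\<^sup>2 * q t w) = c\<^sup>2 * (ln N)\<^sup>2 * q t w"
        using c by (simp add: power2_eq_square power4_eq_xxxx)
      also have "\<dots> = (q t w)\<^sup>2 * (\<rho>\<^sup>2 * (ln N)\<^sup>2)"
        by (simp only: c2 power2_eq_square[of "q t w"] mult_ac)
      finally show ?thesis .
    qed
    \<comment> \<open>The remainder carries \<open>64 * (9 + 9) = 1152\<close> times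
      \<open>\<rho> ^ 4 / N\<close>, which is at most \<open>1 \<le> 2 * \<rho>\<^sup>2\<close>.
      This is where \<open>\<rho> ^ 4 \<le> N\<close> enters and where the 2304 in \<open>H\<close>
      comes from.\<close>
    moreover have "c ^ 4 * (64 / N * (9 + 9)) \<le> (q t w)\<^sup>2 * (\<rho>\<^sup>2 * 2304)"
    proof -
      have "\<rho> ^ 4 / N \<le> 1" using N N_ge_1 by (simp add: divide_le_eq_1)
      also have "1 \<le> 2 * \<rho>\<^sup>2" by (rule rho_sq_ge)
      finally have "(q t w)\<^sup>2 * 1152 * (\<rho> ^ 4 / N) \<le> (q t w)\<^sup>2 * 1152 * (2 * \<rho>\<^sup>2)"
        by (intro mult_left_mono) auto
      then show ?thesis by (simp add: c4 mult_ac)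
    qed
    ultimately have "c ^ 4 * ((ln N)\<^sup>2 / c\<^sup>2 * q t w + 64 / N * (9 + 9)) \<le> (q t w)\<^sup>2 * (\<rho>\<^sup>2 * H)"
      unfolding H_def distrib_left[of "c ^ 4"] by (simp add: algebra_simps)
    then have "s\<^sup>2 / 2 * (c ^ 4 * ((ln N)\<^sup>2 / c\<^sup>2 * q t w + 64 / N * (9 + 9))) \<le> s\<^sup>2 / 2 * ((q t w)\<^sup>2 * (\<rho>\<^sup>2 * H))"
      by (intro mult_left_mono) auto
    moreover have "s\<^sup>2 * c ^ 4 / 2 * X = s\<^sup>2 / 2 * (c ^ 4 * X)" for X by simp
    moreover have "s\<^sup>2 / 2 * ((q t w)\<^sup>2 * (\<rho>\<^sup>2 * H)) = s * q t w * (s * (\<rho>\<^sup>2 * H * q t w)) / 2"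
      by (simp add: power2_eq_square)
    ultimately show ?thesis by (simp only: add_le_cancel_left)
  qed
  also have "\<dots> \<le> 1 - s * q t w + s * q t w * 1 / 2"
    using s q by (intro add_left_mono divide_right_mono mult_left_mono) auto
  also have "\<dots> \<le> exp (- (s / 2) * q t w)"
    using exp_ge_add_one_self[of "- (s / 2) * q t w"] by simp
  finally have le: "(\<integral>x. ?up x \<partial>p t) \<le> exp (- (s / 2) * q t w)" .
  have "(\<integral>\<^sup>+z. ennreal (exp (- s * (ip d w (fst z))\<^sup>2)) \<partial>(p t \<Otimes>\<^sub>M gauss)) \<le> (\<integral>\<^sup>+z. ennreal (?up (fst z)) \<partial>(p t \<Otimes>\<^sub>M gauss))"
    using up by (intro nn_integral_mono ennreal_leI)
  also have "\<dots> \<le> ennreal (exp (- (s / 2) * q t w))"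
    using int order_trans[OF exp_ge_zero up] le by (rule nn_integral_exp_le)
  finally show ?thesis .
qed

text \<open>The range is wider than the dyadic level from \<open>u / 2\<close> to \<open>u\<close>:
  moving from a vector to its approximant \<open>w\<close> may change the form by a constant factor.
  Being defined through \<open>w\<close>, only finitely many bands enter the union bound.\<close>

definition band where "band u w = {t. t < T \<and> u / 8 \<le> q t w \<and> q t w \<le> 4 * u}"

definition tail_bad where
  "tail_bad u s w = {\<omega> \<in> space P. 2 * (\<Sum>t\<in>band u w. \<Sum>i<n. (ip d w (fst (\<omega> (t, i))))\<^sup>2) + 8 * \<rho>\<^sup>2 * H * u * s
      \<le> real n * (\<Sum>t\<in>band u w. q t w)}"

lemma tail_bad:
  assumes u: "0 < u" and N: "\<rho> ^ 4 \<le> N"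
  shows "tail_bad u s w \<in> sets P" "measure P (tail_bad u s w) \<le> exp (- s)"
proof -
  have H: "0 < H" by (simp add: H_def add_nonneg_pos)
  define r where "r = 1 / (4 * u * \<rho>\<^sup>2 * H)"
  have r: "0 < r" using u H pos by (simp add: r_def)
  define g :: "nat \<Rightarrow> nat \<Rightarrow> (nat \<Rightarrow> real) \<times> real \<Rightarrow> real"
    where "g t i z = (if t \<in> band u w then - r * (ip d w (fst z))\<^sup>2 else 0)" for t i z
  define b where "b t i = (if t \<in> band u w then - (r / 2) * q t w else 0)" for t and i :: nat
  have g: "g t i \<in> borel_measurable (p t \<Otimes>\<^sub>M gauss)" for t i
    unfolding g_def by (cases "t \<in> band u w") auto
  have mgf: "(\<integral>\<^sup>+z. ennreal (exp (g t i z)) \<partial>(p t \<Otimes>\<^sub>M gauss)) \<le> ennreal (exp (b t i))" for t i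
  proof (cases "t \<in> band u w")
    case True
    then have qt: "u / 8 \<le> q t w" "q t w \<le> 4 * u" by (auto simp: band_def)
    have "r * (\<rho>\<^sup>2 * H * q t w) \<le> r * (\<rho>\<^sup>2 * H * (4 * u))"
      using r H qt by (intro mult_left_mono) auto
    also have "\<dots> = 1" using u H pos by (simp add: r_def)
    finally show ?thesis
      using lower_tail_mgf[of t w r] True N r qt u by (simp add: g_def b_def)
  next
    case False
    interpret Z: prob_space "p t \<Otimes>\<^sub>M gauss"
      using prob prob_space_gauss by (rule prob_space_pair)
    show ?thesis using False by (auto simp add: g_def b_def Z.emeasure_space_1 simp del: space_pair_measure)
  qed
  have fin: "finite (band u w)" "band u w \<subseteq> {..<T}" by (auto simp: band_def)
  have *: "(\<Sum>t<T. if t \<in> band u w then f t else (0::real)) = (\<Sum>t\<in>band u w. f t)" for f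
    using fin by (simp add: sum.If_cases Int_absorb1)
  have sumb: "(\<Sum>t<T. \<Sum>i<n. b t i) = - (r / 2) * (real n * (\<Sum>t\<in>band u w. q t w))"
  proof -
    have "(\<Sum>t<T. \<Sum>i<n. b t i) = (\<Sum>t<T. if t \<in> band u w then - (r / 2) * real n * q t w else 0)"
      by (intro sum.cong) (auto simp: b_def)
    then show ?thesis by (simp add: * sum_distrib_left sum_negf mult_ac)
  qed
  have sumg: "(\<Sum>t<T. \<Sum>i<n. g t i (\<omega> (t, i))) = - r * (\<Sum>t\<in>band u w. \<Sum>i<n. (ip d w (fst (\<omega> (t, i))))\<^sup>2)" for \<omega>
  proof -
    have "(\<Sum>t<T. \<Sum>i<n. g t i (\<omega> (t, i)))
        = (\<Sum>t<T. if t \<in> band u w then - r * (\<Sum>i<n. (ip d w (fst (\<omega> (t, i))))\<^sup>2) else 0)"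
      by (intro sum.cong) (auto simp: g_def sum_distrib_left sum_negf)
    then show ?thesis by (simp add: * sum_distrib_left sum_negf)
  qed
  have iff: "- (r / 2) * Q + s \<le> - r * Y \<longleftrightarrow> 2 * Y + 8 * \<rho>\<^sup>2 * H * u * s \<le> Q" for Y Q
  proof -
    have "- (r / 2) * Q + s \<le> - r * Y \<longleftrightarrow> r / 2 * (2 * Y + 2 / r * s) \<le> r / 2 * Q"
      using r by (simp add: algebra_simps)
    also have "\<dots> \<longleftrightarrow> 2 * Y + 2 / r * s \<le> Q"
      using r by (simp only: mult_le_cancel_left_pos half_gt_zero)
    also have "2 / r = 8 * \<rho>\<^sup>2 * H * u" by (simp add: r_def)
    finally show ?thesis .
  qed
  note chernoff_train[where g = g and b = b and s = s, OF g mgf]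
  then show "tail_bad u s w \<in> sets P" "measure P (tail_bad u s w) \<le> exp (- s)"
    unfolding sumb sumg iff tail_bad_def by (simp_all only:)
qed

end

section \<open>Uniform lower bound for the empirical quadratic form\<close>

context multi_domain
begin

text \<open>The constant in \<open>msz\<close> satisfies \<open>16 \<cdot> 3 \<le> 20000 / 384\<close>, as needed in \<open>maurey\<close> for the
  accuracy \<open>\<eta>\<^sup>2 = 1 / (384 \<rho>\<^sup>2 Lg 2\<^sup>k)\<close>.\<close>

definition "lvl k = \<tau> / 2 ^ k"
definition "msz k = nat \<lceil>20000 * \<rho>\<^sup>2 * Lg\<^sup>2 * 2 ^ k\<rceil>"
text \<open>The first summand pays for the union over at most \<open>(3 * d) ^ msz k\<close>
  approximants; the second leaves \<open>exp (- (3 * Lg))\<close> for the whole level.\<close>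

definition "tail k = real (msz k) * ln (3 * real d) + 3 * Lg"

definition emp where
  "emp \<omega> v = (\<Sum>t<T. \<Sum>i<n. (ip d v (fst (\<omega> (t, i))))\<^sup>2)"

lemma H_pos: "0 < H"
  by (simp add: H_def add_nonneg_pos)

lemma rho_Lg_ge: "1 \<le> 2 * \<rho>\<^sup>2 * Lg"
  using mult_mono[OF rho_sq_ge Lg_ge_1] rho_sq_ge by simp

lemma lvl_pos: "0 < lvl k"
  using tau_pos by (simp add: lvl_def)

lemma msz_ge_1: "1 \<le> msz k"
proof -
  have "0 < 20000 * \<rho>\<^sup>2 * Lg\<^sup>2 * 2 ^ k" using pos Lg_ge_1 by simp
  then show ?thesis by (simp add: msz_def Suc_le_eq)
qed

text \<open>Hoelder's inequality for each row of \<open>G t\<close>, whose entries are bounded by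
  the row norm. It gives the top dyadic level and settles the regime of large
  \<open>\<rho>\<close>.\<close>

lemma q_le_l1: "q t v \<le> (l1n d v)\<^sup>2 * \<tau>"
proof -
  have "(ip d (G t k) v)\<^sup>2 \<le> (l1n d v)\<^sup>2 * (\<Sum>j<d. (G t k j)\<^sup>2)" for k
  proof -
    have "\<bar>G t k j\<bar> \<le> l2n d (G t k)" if "j < d" for j
      using that member_le_L2_set[of "{..<d}" j "\<lambda>j. \<bar>G t k j\<bar>"]
      by (simp add: l2n_eq_L2_set L2_set_def)
    then have "\<bar>ip d (G t k) v\<bar> \<le> l2n d (G t k) * l1n d v" by (rule abs_ip_le_l1n)
    then have "\<bar>ip d (G t k) v\<bar>\<^sup>2 \<le> (l2n d (G t k) * l1n d v)\<^sup>2" by (intro power_mono) auto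
    then show ?thesis
      by (simp add: power_mult_distrib l2n_sq ip_def power2_eq_square[of "G t k _"] mult.commute)
  qed
  then have "q t v \<le> (\<Sum>k<d. (l1n d v)\<^sup>2 * (\<Sum>j<d. (G t k j)\<^sup>2))"
    unfolding qform_def by (rule sum_mono)
  also have "\<dots> = (l1n d v)\<^sup>2 * (\<Sum>k<d. \<Sum>j<d. (G t k j)\<^sup>2)"
    by (simp add: sum_distrib_left)
  also have "\<dots> \<le> (l1n d v)\<^sup>2 * \<tau>"
    using trace_le by (intro mult_left_mono) auto
  finally show ?thesis .
qed

text \<open>Maurey's lemma is applied at once to all sample covariates and all rows of all
  \<open>G t\<close>, each scaled to sup norm at most 1. Undoing the scaling gives the sample errors
  directly, and the form errors after summing over rows.\<close>

lemma sparse_approximation: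
  assumes coords: "\<And>t i j. t < T \<Longrightarrow> i < n \<Longrightarrow> j < d \<Longrightarrow> \<bar>fst (\<omega> (t, i)) j\<bar> \<le> sqrt K2"
    and v: "l1n d v \<le> 1"
  obtains D where "D \<in> atom_sums d (msz k)"
    "\<And>t. t < T \<Longrightarrow> q t (\<lambda>j. D j / real (msz k) - v j) \<le> lvl k / 64"
    "\<And>t i. t < T \<Longrightarrow> i < n \<Longrightarrow>
       (ip d (\<lambda>j. D j / real (msz k) - v j) (fst (\<omega> (t, i))))\<^sup>2 \<le> lvl k / 64"
proof -
  \<comment> \<open>Chosen so that \<open>\<eta>\<^sup>2 * K2 = lvl k / 64\<close>.\<close>
  define \<eta> where "\<eta> = sqrt (1 / (384 * \<rho>\<^sup>2 * Lg * 2 ^ k))"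
  have two: "(1::real) \<le> 2 ^ k" by simp
  have big: "1 \<le> 384 * \<rho>\<^sup>2 * Lg * 2 ^ k"
  proof -
    have "1 * 1 \<le> 2 * \<rho>\<^sup>2 * Lg * 2 ^ k" using rho_Lg_ge two by (rule mult_mono) (use Lg_ge_1 in auto)
    then show ?thesis by simp
  qed
  have \<eta>2: "\<eta>\<^sup>2 = 1 / (384 * \<rho>\<^sup>2 * Lg * 2 ^ k)"
    using big Lg_ge_1 by (simp add: \<eta>_def)
  have \<eta>: "0 < \<eta>" "\<eta> \<le> 1"
  proof -
    have "0 < X \<Longrightarrow> 0 < sqrt (1 / X)" "1 \<le> X \<Longrightarrow> sqrt (1 / X) \<le> 1" for X :: real by auto
    from this(1)[OF less_le_trans[OF zero_less_one big]] this(2)[OF big]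
    show "0 < \<eta>" "\<eta> \<le> 1" unfolding \<eta>_def by blast+
  qed
  define X where "X a j = fst (\<omega> a) j / sqrt K2" for a j
  define \<beta> where "\<beta> a = l2n d (G (fst a) (snd a))" for a
  \<comment> \<open>A zero row has \<open>\<beta> a = 0\<close> and then \<open>Y a\<close> is 0
    because division by 0 gives 0; the identity \<open>G = \<beta> * Y\<close> still holds
    entrywise.\<close>
  define Y where "Y a j = G (fst a) (snd a) j / \<beta> a" for a j
  have G\<beta>: "\<bar>G (fst a) (snd a) j\<bar> \<le> \<beta> a" if "j < d" for a j
    using that member_le_L2_set[of "{..<d}" j "\<lambda>j. \<bar>G (fst a) (snd a) j\<bar>"]
    by (simp add: l2n_eq_L2_set L2_set_def \<beta>_def)
  define C where "C = X ` ({..<T} \<times> {..<n}) \<union> Y ` ({..<T} \<times> {..<d})"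
  have fin: "finite C" by (simp add: C_def)
  have Cle: "\<bar>c j\<bar> \<le> 1" if "c \<in> C" "j < d" for c j
  proof -
    have "\<bar>X a j\<bar> \<le> 1" if "a \<in> {..<T} \<times> {..<n}" for a
      using coords[of "fst a" "snd a" j] that \<open>j < d\<close> K2_pos by (auto simp: X_def divide_le_eq_1)
    moreover have "\<bar>Y a j\<bar> \<le> 1" for a
      using G\<beta>[OF \<open>j < d\<close>, of a] l2n_nonneg[of d] by (auto simp: Y_def \<beta>_def divide_le_eq_1)
    ultimately show ?thesis using \<open>c \<in> C\<close> by (auto simp: C_def)
  qed
  have "card C \<le> card (X ` ({..<T} \<times> {..<n})) + card (Y ` ({..<T} \<times> {..<d}))"
    unfolding C_def by (rule card_Un_le)
  also have "\<dots> \<le> card ({..<T} \<times> {..<n}) + card ({..<T} \<times> {..<d})"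
    by (intro add_mono card_image_le) auto
  also have "\<dots> = T * n + T * d" by simp
  also have "\<dots> \<le> d * (T * n) + n * (T * d)"
    using dims by (intro add_mono) auto
  also have "\<dots> = 2 * (d * (n * T))" by (simp add: algebra_simps)
  finally have "card C \<le> 2 * (d * (n * T))" .
  then have "real (card C) \<le> real (2 * (d * (n * T)))" by (simp only: of_nat_le_iff)
  then have card: "2 * real (card C) \<le> 4 * (real d * N)" by (simp add: mult_ac)
  have "X (0, 0) \<in> C" using dims by (force simp: C_def)
  then have "0 < card C" using fin card_gt_0_iff by blast
  then have "ln (2 * real (card C)) \<le> 3 * Lg" using card by (intro ln_le_Lg) auto
  then have "16 * ln (2 * real (card C)) \<le> 20000 / 384 * Lg" using Lg_ge_1 by linarith
  also have "\<dots> = \<eta>\<^sup>2 * (20000 * \<rho>\<^sup>2 * Lg\<^sup>2 * 2 ^ k)"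
    using pos Lg_ge_1 unfolding \<eta>2 by (simp add: power2_eq_square)
  also have "\<dots> \<le> \<eta>\<^sup>2 * real (msz k)"
    unfolding msz_def by (intro mult_left_mono real_nat_ceiling_ge) auto
  finally obtain D where D: "D \<in> atom_sums d (msz k)"
    "\<And>c. c \<in> C \<Longrightarrow> \<bar>ip d c (\<lambda>j. D j / real (msz k) - v j)\<bar> \<le> \<eta>"
    using maurey[of C d v \<eta> "msz k"] fin Cle v \<eta> msz_ge_1 by blast
  let ?e = "\<lambda>j. D j / real (msz k) - v j"
  have tauK: "\<eta>\<^sup>2 * K2 = lvl k / 64"
    using pos Lg_ge_1 unfolding \<eta>2 by (simp add: K2_def lvl_def)
  have "\<tau> \<le> K2"
    using mult_right_mono[of 1 "6 * \<rho>\<^sup>2 * Lg" \<tau>] rho_Lg_ge tau_pos by (simp add: K2_def mult_ac)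
  show ?thesis
  proof (rule that)
    show "D \<in> atom_sums d (msz k)" by (rule D)
    fix t assume t: "t < T"
    have "(ip d (G t r) ?e)\<^sup>2 \<le> \<eta>\<^sup>2 * (\<Sum>j<d. (G t r j)\<^sup>2)" if r: "r < d" for r
    proof -
      have "Y (t, r) \<in> C" using t r by (auto simp: C_def)
      then have Y: "\<bar>ip d (Y (t, r)) ?e\<bar> \<le> \<eta>" by (rule D)
      have "G t r j = \<beta> (t, r) * Y (t, r) j" if "j < d" for j
        using G\<beta>[OF that, of "(t, r)"] by (auto simp: Y_def)
      then have "ip d (G t r) ?e = \<beta> (t, r) * ip d (Y (t, r)) ?e"
        unfolding ip_scale_left[symmetric] by (intro ip_cong) auto
      then have "(ip d (G t r) ?e)\<^sup>2 = (\<beta> (t, r))\<^sup>2 * \<bar>ip d (Y (t, r)) ?e\<bar>\<^sup>2"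
        by (simp add: power_mult_distrib)
      also have "\<dots> \<le> (\<beta> (t, r))\<^sup>2 * \<eta>\<^sup>2"
        using Y by (intro mult_left_mono power_mono) auto
      also have "(\<beta> (t, r))\<^sup>2 = (\<Sum>j<d. (G t r j)\<^sup>2)"
        by (simp add: \<beta>_def l2n_sq) (simp add: ip_def power2_eq_square)
      finally show ?thesis by (simp add: mult.commute)
    qed
    then have "q t ?e \<le> (\<Sum>r<d. \<eta>\<^sup>2 * (\<Sum>j<d. (G t r j)\<^sup>2))"
      unfolding qform_def by (intro sum_mono) auto
    also have "\<dots> = \<eta>\<^sup>2 * (\<Sum>r<d. \<Sum>j<d. (G t r j)\<^sup>2)"
      by (simp add: sum_distrib_left)
    also have "\<dots> \<le> \<eta>\<^sup>2 * K2"
      using trace_le[of t] \<open>\<tau> \<le> K2\<close> by (intro mult_left_mono) auto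
    finally show "q t ?e \<le> lvl k / 64" by (simp only: tauK)
  next
    fix t i assume ti: "t < T" "i < n"
    then have "X (t, i) \<in> C" by (auto simp: C_def)
    then have X: "\<bar>ip d (X (t, i)) ?e\<bar> \<le> \<eta>" by (rule D)
    have "ip d (fst (\<omega> (t, i))) ?e = sqrt K2 * ip d (X (t, i)) ?e"
      unfolding ip_scale_left[symmetric] using K2_pos by (intro ip_cong) (auto simp: X_def)
    then have "(ip d ?e (fst (\<omega> (t, i))))\<^sup>2 = K2 * \<bar>ip d (X (t, i)) ?e\<bar>\<^sup>2"
      using K2_pos by (simp add: power_mult_distrib ip_commute[of d ?e])
    also have "\<dots> \<le> K2 * \<eta>\<^sup>2"
      using X K2_pos by (intro mult_left_mono power_mono) auto
    finally show "(ip d ?e (fst (\<omega> (t, i))))\<^sup>2 \<le> lvl k / 64"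
      by (simp add: tauK mult.commute)
  qed
qed

text \<open>The tail estimate is available only for the approximant. It transfers to
  \<open>v\<close> because the band of the approximant contains the level of \<open>v\<close>, and
  because the sample projections differ by little.\<close>

lemma level_bound:
  assumes coords: "\<And>t i j. t < T \<Longrightarrow> i < n \<Longrightarrow> j < d \<Longrightarrow> \<bar>fst (\<omega> (t, i)) j\<bar> \<le> sqrt K2"
    and \<omega>: "\<omega> \<in> space P"
    and tails: "\<And>D. D \<in> atom_sums d (msz k) \<Longrightarrow>
          \<omega> \<notin> tail_bad (lvl k) (tail k) (\<lambda>j. D j / real (msz k))"
    and v: "l1n d v \<le> 1"
  shows "real n * real (card {t. t < T \<and> lvl k / 2 < q t v \<and> q t v \<le> lvl k}) * lvl k
     \<le> 64 * emp \<omega> v + 128 * \<rho>\<^sup>2 * H * (lvl k * tail k)"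
proof -
  let ?u = "lvl k"
  obtain D where D: "D \<in> atom_sums d (msz k)"
    and qD: "\<And>t. t < T \<Longrightarrow> q t (\<lambda>j. D j / real (msz k) - v j) \<le> ?u / 64"
    and xD: "\<And>t i. t < T \<Longrightarrow> i < n \<Longrightarrow>
       (ip d (\<lambda>j. D j / real (msz k) - v j) (fst (\<omega> (t, i))))\<^sup>2 \<le> ?u / 64"
    using sparse_approximation[where \<omega> = \<omega> and v = v and k = k, OF coords v] by blast
  define V where "V = (\<lambda>j. D j / real (msz k))"
  define B where "B = band ?u V"
  have u: "0 < ?u" by (rule lvl_pos)
  have B: "finite B" "B \<subseteq> {..<T}" by (auto simp: B_def band_def)
  have sub: "{t. t < T \<and> ?u / 2 < q t v \<and> q t v \<le> ?u} \<subseteq> B"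
  proof safe
    fix t assume t: "t < T" "?u / 2 < q t v" "q t v \<le> ?u"
    have 1: "q t (\<lambda>j. V j - v j) \<le> ?u / 64" using qD[OF t(1)] by (simp add: V_def)
    have "q t (\<lambda>j. v j - V j) = q t (\<lambda>j. (- 1) * (V j - v j))" by simp
    also have "\<dots> = q t (\<lambda>j. V j - v j)" by (simp only: qform_scale) simp
    finally have "q t V \<le> 4 * ?u"
      using qform_triangle[of d "G t" V v] 1 t u by linarith
    moreover have "?u / 8 \<le> q t V"
      using qform_triangle[of d "G t" v V] 1 t u by linarith
    ultimately show "t \<in> B" using t by (simp add: B_def band_def)
  qed
  have "real n * (real (card B) * (?u / 8)) \<le> real n * (\<Sum>t\<in>B. q t V)"
    using B by (intro mult_left_mono sum_bounded_below[of B "?u / 8"]) (auto simp: B_def band_def)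
  also have "\<dots> \<le> 2 * (\<Sum>t\<in>B. \<Sum>i<n. (ip d V (fst (\<omega> (t, i))))\<^sup>2) + 8 * \<rho>\<^sup>2 * H * ?u * tail k"
    using tails[OF D] \<omega> by (auto simp: tail_bad_def B_def V_def)
  also have "(\<Sum>t\<in>B. \<Sum>i<n. (ip d V (fst (\<omega> (t, i))))\<^sup>2)
      \<le> (\<Sum>t\<in>B. \<Sum>i<n. 2 * (ip d v (fst (\<omega> (t, i))))\<^sup>2 + 2 * (?u / 64))"
  proof (intro sum_mono)
    fix t i assume "t \<in> B" "i \<in> {..<n}"
    then have "(ip d V (fst (\<omega> (t, i))) - ip d v (fst (\<omega> (t, i))))\<^sup>2 \<le> ?u / 64"
      using xD[of t i] B by (auto simp: V_def ip_diff_left)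
    moreover have "a\<^sup>2 \<le> 2 * b\<^sup>2 + 2 * (a - b)\<^sup>2" for a b :: real
      using zero_le_power2[of "a - 2 * b"] by (simp add: power2_eq_square algebra_simps)
    ultimately show "(ip d V (fst (\<omega> (t, i))))\<^sup>2 \<le> 2 * (ip d v (fst (\<omega> (t, i))))\<^sup>2 + 2 * (?u / 64)"
      by (smt (verit))
  qed
  \<comment> \<open>This sum still gets multiplied by 2, so the approximation error costs
    \<open>n * card B * u / 16\<close>, half of the left-hand side
    \<open>n * card B * u / 8\<close>; it is subtracted below.\<close>
  also have "\<dots> = 2 * (\<Sum>t\<in>B. \<Sum>i<n. (ip d v (fst (\<omega> (t, i))))\<^sup>2) + real n * (real (card B) * (?u / 32))"
    by (simp add: sum.distrib sum_distrib_left)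
  also have "(\<Sum>t\<in>B. \<Sum>i<n. (ip d v (fst (\<omega> (t, i))))\<^sup>2) \<le> emp \<omega> v"
    unfolding emp_def using B by (intro sum_mono2) (auto intro: sum_nonneg)
  finally have "real n * (real (card B) * ?u) \<le> 64 * emp \<omega> v + 128 * \<rho>\<^sup>2 * H * (?u * tail k)"
    by simp
  moreover have "real n * (real (card {t. t < T \<and> ?u / 2 < q t v \<and> q t v \<le> ?u}) * ?u)
      \<le> real n * (real (card B) * ?u)"
    using sub B u by (intro mult_left_mono mult_right_mono) (auto intro: card_mono)
  ultimately show ?thesis by (simp add: mult.assoc)
qed

text \<open>Induction on \<open>K\<close>: a value at most \<open>lvl K\<close> lies either in level
  \<open>K\<close> or below \<open>lvl (Suc K)\<close>. Values below the last level are not resolved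
  and contribute the residual \<open>lvl K\<close>.\<close>

lemma dyadic_bound:
  assumes "x \<le> \<tau>"
  shows "x \<le> lvl K + (\<Sum>k<K. if lvl k / 2 < x \<and> x \<le> lvl k then lvl k else 0)"
proof -
  have "x \<le> lvl K \<or> (\<exists>k<K. lvl k / 2 < x \<and> x \<le> lvl k)"
  proof (induction K)
    case 0 then show ?case using assms by (simp add: lvl_def)
  next
    case (Suc K)
    then show ?case
      by (cases "lvl K / 2 < x") (auto simp: lvl_def less_Suc_eq)
  qed
  then show ?thesis
  proof
    assume "x \<le> lvl K"
    moreover have "0 \<le> (\<Sum>k<K. if lvl k / 2 < x \<and> x \<le> lvl k then lvl k else 0)"
      using lvl_pos by (intro sum_nonneg) (auto simp: less_imp_le)
    ultimately show ?thesis by linarith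
  next
    assume "\<exists>k<K. lvl k / 2 < x \<and> x \<le> lvl k"
    then obtain k where k: "k < K" "lvl k / 2 < x" "x \<le> lvl k" by blast
    have "(if lvl k / 2 < x \<and> x \<le> lvl k then lvl k else 0)
        \<le> (\<Sum>k<K. if lvl k / 2 < x \<and> x \<le> lvl k then lvl k else 0)"
      using k lvl_pos by (intro member_le_sum) (auto simp: less_imp_le)
    then show ?thesis using k lvl_pos[of K] by simp
  qed
qed

text \<open>The number of atoms grows like \<open>2 ^ k\<close> while \<open>lvl k\<close> shrinks
  like \<open>1 / 2 ^ k\<close>. The product is free of \<open>k\<close>, so all levels cost the
  same.\<close>

lemma lvl_tail_le: "lvl k * tail k \<le> 60012 * \<tau> * \<rho>\<^sup>2 * Lg ^ 3"
proof -
  have two: "(1::real) \<le> 2 ^ k" by simp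
  have rL: "2 \<le> 4 * \<rho>\<^sup>2 * Lg\<^sup>2"
  proof -
    have "1 * 1 \<le> (2 * \<rho>\<^sup>2 * Lg) * Lg"
      using rho_Lg_ge Lg_ge_1 by (rule mult_mono) (use Lg_ge_1 in auto)
    then show ?thesis by (simp add: power2_eq_square mult_ac)
  qed
  then have rLk: "2 \<le> 4 * \<rho>\<^sup>2 * Lg\<^sup>2 * 2 ^ k"
    using mult_mono[OF rL two] by simp
  have "ln (3 * real d) \<le> 3 * Lg"
  proof (rule ln_le_Lg)
    show "3 * real d \<le> 4 * (real d * N)"
      using mult_left_mono[OF N_ge_1, of "real d"] by simp
  qed (use dims in simp)
  then have "tail k \<le> real (msz k) * (3 * Lg) + 3 * Lg"
    unfolding tail_def by (intro add_right_mono mult_left_mono) auto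
  also have "\<dots> = 3 * Lg * (real (msz k) + 1)" by (simp add: algebra_simps)
  also have "\<dots> \<le> 3 * Lg * (20000 * \<rho>\<^sup>2 * Lg\<^sup>2 * 2 ^ k + 2)"
  proof -
    have "0 \<le> 20000 * \<rho>\<^sup>2 * Lg\<^sup>2 * 2 ^ k" by simp
    then have "real (msz k) \<le> 20000 * \<rho>\<^sup>2 * Lg\<^sup>2 * 2 ^ k + 1"
      unfolding msz_def by linarith
    then show ?thesis using Lg_ge_1 by (intro mult_left_mono) auto
  qed
  \<comment> \<open>The 2 left by the ceiling and by the extra \<open>3 * Lg\<close> is absorbed
    through \<open>rLk\<close>.\<close>
  also have "\<dots> \<le> 3 * Lg * (20004 * \<rho>\<^sup>2 * Lg\<^sup>2 * 2 ^ k)"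
    using rLk Lg_ge_1 by (intro mult_left_mono) auto
  finally have "lvl k * tail k \<le> lvl k * (3 * Lg * (20004 * \<rho>\<^sup>2 * Lg\<^sup>2 * 2 ^ k))"
    using lvl_pos by (intro mult_left_mono) (auto simp: less_imp_le)
  also have "\<dots> = 60012 * \<tau> * \<rho>\<^sup>2 * Lg ^ 3"
    by (simp add: lvl_def power2_eq_square power3_eq_cube)
  finally show ?thesis .
qed

text \<open>The three bounds serve in turn to make the residual \<open>N * lvl K\<close> at most
  \<open>\<tau>\<close>, to count the level events in the union bound, and to keep the sum over
  levels logarithmic.\<close>

lemma level_count: "\<exists>K. N \<le> 2 ^ K \<and> 2 ^ K \<le> 2 * N \<and> real K \<le> 2 * Lg"
proof -
  define K where "K = nat \<lceil>log 2 N\<rceil>"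
  have log: "0 \<le> log 2 N" using N_ge_1 by simp
  have K1: "log 2 N \<le> real K" by (simp add: K_def real_nat_ceiling_ge)
  have K2: "real K \<le> log 2 N + 1"
    using log by (simp add: K_def)
  have pw: "2 ^ K = 2 powr real K" by (simp add: powr_realpow)
  have N: "N = 2 powr (log 2 N)" using N_ge_1 by simp
  have "N \<le> 2 ^ K" unfolding pw using K1 by (subst N) (intro powr_mono, auto)
  moreover have "2 ^ K \<le> 2 * N"
  proof -
    have "2 powr real K \<le> 2 powr (log 2 N + 1)" using K2 by (intro powr_mono) auto
    also have "\<dots> = 2 * N" using N_ge_1 by (simp add: powr_add)
    finally show ?thesis by (simp add: pw)
  qed
  moreover have "real K \<le> 2 * Lg"
  proof -
    have "log 2 N \<le> 2 * ln N"
    proof -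
      have "1 / 2 \<le> ln (2::real)" using ln2_ge_two_thirds by simp
      then have "ln N * (1 / 2) \<le> ln N * ln 2" using N_ge_1 by (intro mult_left_mono) auto
      then have "ln N \<le> 2 * ln N * ln 2" by simp
      then show ?thesis by (simp add: log_def pos_divide_le_eq)
    qed
    then show ?thesis using K2 ln_N_le_Lg by linarith
  qed
  ultimately show ?thesis by blast
qed

lemma uniform_lower_bound:
  assumes coords: "\<And>t i j. t < T \<Longrightarrow> i < n \<Longrightarrow> j < d \<Longrightarrow> \<bar>fst (\<omega> (t, i)) j\<bar> \<le> sqrt K2"
    and \<omega>: "\<omega> \<in> space P"
    and K: "N \<le> 2 ^ K" "real K \<le> 2 * Lg"
    and tails: "\<And>k D. k < K \<Longrightarrow> D \<in> atom_sums d (msz k) \<Longrightarrow>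
          \<omega> \<notin> tail_bad (lvl k) (tail k) (\<lambda>j. D j / real (msz k))"
    and v: "l1n d v \<le> 1"
  shows "real n * (\<Sum>t<T. q t v) \<le> 128 * Lg * emp \<omega> v + 40000000000 * (\<rho> ^ 4 * \<tau> * Lg ^ 6)"
proof -
  define b where "b = 64 * emp \<omega> v + 128 * \<rho>\<^sup>2 * H * (60012 * \<tau> * \<rho>\<^sup>2 * Lg ^ 3)"
  have emp: "0 \<le> emp \<omega> v" by (simp add: emp_def sum_nonneg)
  have b: "0 \<le> b" using emp H_pos tau_pos Lg_ge_1 by (simp add: b_def)
  let ?A = "\<lambda>k. {t. t < T \<and> lvl k / 2 < q t v \<and> q t v \<le> lvl k}"
  have A: "real n * (real (card (?A k)) * lvl k) \<le> b" if "k < K" for k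
  proof -
    have "real n * real (card (?A k)) * lvl k \<le> 64 * emp \<omega> v + 128 * \<rho>\<^sup>2 * H * (lvl k * tail k)"
      using coords \<omega> tails[OF that] v by (rule level_bound)
    also have "\<dots> \<le> b"
      unfolding b_def using lvl_tail_le H_pos by (intro add_left_mono mult_left_mono) auto
    finally show ?thesis by (simp add: mult.assoc)
  qed
  have l1: "(l1n d v)\<^sup>2 \<le> 1"
    using v by (intro power_le_one) (auto simp: l1n_def sum_nonneg)
  have "q t v \<le> \<tau>" for t
    using q_le_l1[of t v] mult_right_mono[OF l1, of \<tau>] tau_pos by linarith
  then have "(\<Sum>t<T. q t v) \<le> (\<Sum>t<T. lvl K + (\<Sum>k<K. if lvl k / 2 < q t v \<and> q t v \<le> lvl k then lvl k else 0))"
    by (intro sum_mono dyadic_bound)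
  also have "\<dots> = real T * lvl K + (\<Sum>k<K. \<Sum>t<T. if lvl k / 2 < q t v \<and> q t v \<le> lvl k then lvl k else 0)"
    unfolding sum.distrib by (subst sum.swap) simp
  also have "\<dots> = real T * lvl K + (\<Sum>k<K. real (card (?A k)) * lvl k)"
  proof -
    have "{..<T} \<inter> {t. lvl k / 2 < q t v \<and> q t v \<le> lvl k} = ?A k" for k by auto
    then show ?thesis by (simp add: sum.If_cases)
  qed
  finally have "real n * (\<Sum>t<T. q t v) \<le> real n * (real T * lvl K + (\<Sum>k<K. real (card (?A k)) * lvl k))"
    by (intro mult_left_mono) auto
  also have "\<dots> = N * lvl K + (\<Sum>k<K. real n * (real (card (?A k)) * lvl k))"
    by (simp add: distrib_left sum_distrib_left mult_ac)
  also have "\<dots> \<le> \<tau> + (\<Sum>k<K. b)"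
  proof (intro add_mono sum_mono A)
    show "N * lvl K \<le> \<tau>"
      using mult_right_mono[OF K(1), of \<tau>] tau_pos by (simp add: lvl_def divide_le_eq mult_ac)
  qed auto
  also have "\<dots> \<le> \<tau> + 2 * Lg * b"
    using mult_right_mono[OF K(2) b] by simp
  \<comment> \<open>Here \<open>H\<close> is replaced by \<open>2305 * Lg\<^sup>2\<close>: one
    \<open>Lg\<^sup>2\<close> dominates the squared logarithm and 2304 of them dominate the
    constant. With \<open>Lg ^ 3\<close> from \<open>lvl_tail_le\<close> and \<open>Lg\<close> from
    the number of levels this gives \<open>Lg ^ 6\<close>.\<close>
  also have "2 * Lg * b \<le> 128 * Lg * emp \<omega> v + 2 * Lg * (128 * \<rho>\<^sup>2 * (2305 * Lg\<^sup>2) * (60012 * \<tau> * \<rho>\<^sup>2 * Lg ^ 3))"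
  proof -
    have "0 \<le> ln N" using N_ge_1 by simp
    then have "(ln N)\<^sup>2 \<le> Lg\<^sup>2" using ln_N_le_Lg by (intro power_mono) auto
    moreover have "1 \<le> Lg\<^sup>2" using Lg_ge_1 by simp
    ultimately have "H \<le> 2305 * Lg\<^sup>2" unfolding H_def by linarith
    then have "2 * Lg * b \<le> 2 * Lg * (64 * emp \<omega> v + 128 * \<rho>\<^sup>2 * (2305 * Lg\<^sup>2) * (60012 * \<tau> * \<rho>\<^sup>2 * Lg ^ 3))"
      unfolding b_def using tau_pos Lg_ge_1
      by (intro mult_left_mono add_left_mono mult_right_mono) auto
    then show ?thesis by (simp add: algebra_simps)
  qed
  also have "2 * Lg * (128 * \<rho>\<^sup>2 * (2305 * Lg\<^sup>2) * (60012 * \<tau> * \<rho>\<^sup>2 * Lg ^ 3))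
      = (2 * 128 * 2305 * 60012) * (\<rho> ^ 4 * \<tau> * Lg ^ 6)"
    by (simp add: eval_nat_numeral)
  finally have le: "real n * (\<Sum>t<T. q t v) \<le> \<tau> +
      (128 * Lg * emp \<omega> v + (2 * 128 * 2305 * 60012) * (\<rho> ^ 4 * \<tau> * Lg ^ 6))" by simp
  \<comment> \<open>The unresolved residual is absorbed because \<open>rho_sq_ge\<close> gives
    \<open>1 \<le> 4 * \<rho> ^ 4\<close>.\<close>
  have "\<tau> \<le> 4 * (\<rho> ^ 4 * \<tau> * Lg ^ 6)"
  proof -
    have "1 \<le> (2 * \<rho>\<^sup>2)\<^sup>2" using rho_sq_ge by (simp only: one_le_power)
    then have "1 \<le> 4 * \<rho> ^ 4" by (simp add: power_mult_distrib flip: power_mult)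
    moreover have "1 \<le> Lg ^ 6" using Lg_ge_1 by simp
    ultimately have "1 * 1 \<le> 4 * \<rho> ^ 4 * Lg ^ 6" by (intro mult_mono) auto
    then have "1 * \<tau> \<le> 4 * \<rho> ^ 4 * Lg ^ 6 * \<tau>" using tau_pos by (intro mult_right_mono) auto
    then show ?thesis by (simp add: mult_ac)
  qed
  moreover have "0 \<le> \<rho> ^ 4 * \<tau> * Lg ^ 6" using tau_pos Lg_ge_1 by simp
  ultimately show ?thesis using le by linarith
qed

end

section \<open>The estimator\<close>

context multi_domain
begin

text \<open>Twice the high-probability bound \<open>\<sigma> * sqrt (6 * Lg * W) / N\<close> on each
  coordinate of the averaged noise.\<close>

definition "lam = 2 * \<sigma> * sqrt (6 * Lg * W) / N"

lemma lam_pos: "0 < lam"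
  using pos W_pos Lg_ge_1 dims by (simp add: lam_def)

lemma good_event:
  obtains A K where "A \<in> sets P" "1 - \<delta> \<le> measure P A" "A \<subseteq> space P"
    "N \<le> 2 ^ K" "real K \<le> 2 * Lg"
    "\<And>\<omega> j. \<omega> \<in> A \<Longrightarrow> j < d \<Longrightarrow> \<omega> \<notin> noise_bad (sqrt (6 * Lg / W) / \<sigma>) j"
    "\<And>\<omega> j. \<omega> \<in> A \<Longrightarrow> j < d \<Longrightarrow> \<omega> \<notin> noise_bad (- (sqrt (6 * Lg / W) / \<sigma>)) j"
    "\<And>\<omega> j. \<omega> \<in> A \<Longrightarrow> j < d \<Longrightarrow> \<omega> \<notin> energy_bad j"
    "\<And>\<omega> t i j. \<omega> \<in> A \<Longrightarrow> t < T \<Longrightarrow> i < n \<Longrightarrow> j < d \<Longrightarrow> \<omega> \<notin> coord_bad (sqrt K2 / (\<rho>\<^sup>2 * \<tau>)) t i j"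
    "\<And>\<omega> t i j. \<omega> \<in> A \<Longrightarrow> t < T \<Longrightarrow> i < n \<Longrightarrow> j < d \<Longrightarrow> \<omega> \<notin> coord_bad (- (sqrt K2 / (\<rho>\<^sup>2 * \<tau>))) t i j"
    "\<And>\<omega> k D. \<omega> \<in> A \<Longrightarrow> \<rho> ^ 4 \<le> N \<Longrightarrow> k < K \<Longrightarrow> D \<in> atom_sums d (msz k) \<Longrightarrow>
        \<omega> \<notin> tail_bad (lvl k) (tail k) (\<lambda>j. D j / real (msz k))"
proof -
  interpret prob_space P by (rule prob_space_P)
  obtain K where K: "N \<le> 2 ^ K" "2 ^ K \<le> 2 * N" "real K \<le> 2 * Lg"
    using level_count by blast
  define K' where "K' = (if \<rho> ^ 4 \<le> N then K else 0)"
  define e where "e = exp (- (3 * Lg))"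
  define l where "l = sqrt (6 * Lg / W) / \<sigma>"
  define r where "r = sqrt K2 / (\<rho>\<^sup>2 * \<tau>)"
  define B1 where "B1 = (\<Union>j<d. noise_bad l j)"
  define B2 where "B2 = (\<Union>j<d. noise_bad (- l) j)"
  define B3 where "B3 = (\<Union>j<d. energy_bad j)"
  define I where "I = ({..<T} \<times> {..<n}) \<times> {..<d}"
  define B4 where "B4 = (\<Union>a\<in>I. coord_bad r (fst (fst a)) (snd (fst a)) (snd a))"
  define B5 where "B5 = (\<Union>a\<in>I. coord_bad (- r) (fst (fst a)) (snd (fst a)) (snd a))"
  define TB where "TB k = (\<Union>D\<in>atom_sums d (msz k). tail_bad (lvl k) (tail k) (\<lambda>j. D j / real (msz k)))" for k
  define B6 where "B6 = (\<Union>k<K'. TB k)"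
  have union: "(\<Union>a\<in>J. E a) \<in> sets P \<and> measure P (\<Union>a\<in>J. E a) \<le> real (card J) * x"
    if "finite J" "\<And>a. a \<in> J \<Longrightarrow> E a \<in> sets P" "\<And>a. a \<in> J \<Longrightarrow> measure P (E a) \<le> x"
    for J :: "'b set" and E x
  proof -
    have "measure P (\<Union>a\<in>J. E a) \<le> (\<Sum>a\<in>J. measure P (E a))"
      using that by (intro finite_measure_subadditive_finite) auto
    also have "\<dots> \<le> real (card J) * x"
      using that(3) by (rule sum_bounded_above)
    finally show ?thesis using that by auto
  qed
  have B1: "B1 \<in> sets P \<and> measure P B1 \<le> real (card {..<d}) * e"
    unfolding B1_def using noise_bad by (intro union) (auto simp: e_def)
  have B2: "B2 \<in> sets P \<and> measure P B2 \<le> real (card {..<d}) * e"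
    unfolding B2_def using noise_bad by (intro union) (auto simp: e_def)
  have B3: "B3 \<in> sets P \<and> measure P B3 \<le> real (card {..<d}) * e"
    unfolding B3_def using energy_bad by (intro union) (auto simp: e_def)
  have B4: "B4 \<in> sets P \<and> measure P B4 \<le> real (card I) * e"
    unfolding B4_def using coord_bad by (intro union) (auto simp: e_def I_def)
  have B5: "B5 \<in> sets P \<and> measure P B5 \<le> real (card I) * e"
    unfolding B5_def using coord_bad by (intro union) (auto simp: e_def I_def)
  have TB: "TB k \<in> sets P" "measure P (TB k) \<le> e" if "k < K'" for k
  proof -
    have N4: "\<rho> ^ 4 \<le> N" using that by (simp add: K'_def split: if_splits)
    let ?x = "exp (- tail k)"
    have TB1: "TB k \<in> sets P \<and> measure P (TB k) \<le> real (card (atom_sums d (msz k))) * ?x"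
      unfolding TB_def using tail_bad[OF lvl_pos N4] finite_atom_sums by (intro union) auto
    have "real (card (atom_sums d (msz k))) \<le> real ((3 * d) ^ msz k)"
      using card_atom_sums dims(1) by (simp only: of_nat_le_iff)
    also have "\<dots> = exp (real (msz k) * ln (3 * real d))"
      using dims by (simp add: exp_of_nat_mult)
    finally have "real (card (atom_sums d (msz k))) * ?x \<le> exp (real (msz k) * ln (3 * real d)) * ?x"
      by (intro mult_right_mono) auto
    also have "\<dots> = e" by (simp add: tail_def e_def flip: exp_add)
    finally show "TB k \<in> sets P" "measure P (TB k) \<le> e" using TB1 by auto
  qed
  have B6: "B6 \<in> sets P \<and> measure P B6 \<le> real (card {..<K'}) * e"
    unfolding B6_def using TB by (intro union) auto
  define A where "A = space P - (B1 \<union> B2 \<union> B3 \<union> B4 \<union> B5 \<union> B6)"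
  have Bsets: "B1 \<union> B2 \<union> B3 \<union> B4 \<union> B5 \<union> B6 \<in> sets P"
    using B1 B2 B3 B4 B5 B6 by auto
  have "measure P (B1 \<union> B2 \<union> B3 \<union> B4 \<union> B5 \<union> B6)
      \<le> measure P B1 + measure P B2 + measure P B3 + measure P B4 + measure P B5 + measure P B6"
    using B1 B2 B3 B4 B5 B6
    by (intro order_trans[OF measure_Un_le] add_right_mono measure_Un_le) auto
  also have "\<dots> \<le> real d * e + real d * e + real d * e + real (card I) * e + real (card I) * e + real K' * e"
    using B1 B2 B3 B4 B5 B6 by (intro add_mono) auto
  \<comment> \<open>Three families of size \<open>d\<close>, two of size \<open>d * N\<close>, and
    at most \<open>K < 2 ^ K \<le> 2 * N\<close> levels.\<close>
  also have "\<dots> \<le> 7 * (real d * N) * e"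
  proof -
    have dN: "real d \<le> real d * N" "N \<le> real d * N"
      using mult_left_mono[OF N_ge_1, of "real d"] mult_right_mono[OF dN_ge(2), of N] by auto
    have "real K < 2 ^ K" using of_nat_less_two_power by simp
    then have "real K \<le> 2 * N" using K by linarith
    then have "real K' \<le> 2 * N" by (simp add: K'_def)
    moreover have "real (card I) = real d * N" by (simp add: I_def)
    ultimately have "real d + real d + real d + real (card I) + real (card I) + real K' \<le> 7 * (real d * N)"
      using dN by linarith
    then have "(real d + real d + real d + real (card I) + real (card I) + real K') * e \<le> 7 * (real d * N) * e"
      by (intro mult_right_mono) (auto simp: e_def)
    then show ?thesis by (simp add: algebra_simps)
  qed
  also have "\<dots> \<le> \<delta>" unfolding e_def by (rule exp_Lg_le)
  finally have "1 - \<delta> \<le> measure P A"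
    unfolding A_def using Bsets by (simp add: prob_compl)
  moreover have "A \<in> sets P" "A \<subseteq> space P" using Bsets by (auto simp: A_def)
  ultimately show ?thesis
  proof (intro that[of A K] K(1,3))
    fix \<omega> assume \<omega>: "\<omega> \<in> A"
    show "\<omega> \<notin> noise_bad (sqrt (6 * Lg / W) / \<sigma>) j" "\<omega> \<notin> noise_bad (- (sqrt (6 * Lg / W) / \<sigma>)) j"
      "\<omega> \<notin> energy_bad j" if "j < d" for j
      using \<omega> that unfolding A_def B1_def B2_def B3_def l_def by blast+
    show "\<omega> \<notin> coord_bad (sqrt K2 / (\<rho>\<^sup>2 * \<tau>)) t i j" "\<omega> \<notin> coord_bad (- (sqrt K2 / (\<rho>\<^sup>2 * \<tau>))) t i j"
      if "t < T" "i < n" "j < d" for t i j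
    proof -
      have "((t, i), j) \<in> I" using that by (simp add: I_def)
      then show "\<omega> \<notin> coord_bad (sqrt K2 / (\<rho>\<^sup>2 * \<tau>)) t i j" "\<omega> \<notin> coord_bad (- (sqrt K2 / (\<rho>\<^sup>2 * \<tau>))) t i j"
        using \<omega> unfolding A_def B4_def B5_def r_def by fastforce+
    qed
    show "\<omega> \<notin> tail_bad (lvl k) (tail k) (\<lambda>j. D j / real (msz k))"
      if "\<rho> ^ 4 \<le> N" "k < K" "D \<in> atom_sums d (msz k)" for k D
    proof -
      have "k \<in> {..<K'}" using that by (simp add: K'_def)
      then show ?thesis using \<omega> that(3) unfolding A_def B6_def TB_def by blast
    qed
  qed
qed

text \<open>With \<open>r = sqrt K2 / (\<rho>\<^sup>2 * \<tau>)\<close> both summands of the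
  threshold equal \<open>3 * Lg\<close>, and their total is \<open>r * sqrt K2\<close>.\<close>

lemma coord_le:
  assumes "\<omega> \<in> space P" "\<omega> \<notin> coord_bad (sqrt K2 / (\<rho>\<^sup>2 * \<tau>)) t i j"
    "\<omega> \<notin> coord_bad (- (sqrt K2 / (\<rho>\<^sup>2 * \<tau>))) t i j"
  shows "\<bar>fst (\<omega> (t, i)) j\<bar> \<le> sqrt K2"
proof -
  define r where "r = sqrt K2 / (\<rho>\<^sup>2 * \<tau>)"
  have r: "0 < r" using K2_pos pos tau_pos by (simp add: r_def)
  have "r\<^sup>2 * (\<rho>\<^sup>2 * \<tau>) = K2 / (\<rho>\<^sup>2 * \<tau>)"
    using K2_pos pos tau_pos by (simp add: r_def power2_eq_square)
  also have "\<dots> = 6 * Lg" using pos tau_pos by (simp add: K2_def)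
  finally have r2: "r\<^sup>2 * (\<rho>\<^sup>2 * \<tau>) / 2 + 3 * Lg = 6 * Lg" by simp
  have rK: "r * sqrt K2 = 6 * Lg"
    using K2_pos pos tau_pos by (simp add: r_def K2_def)
  have "r * fst (\<omega> (t, i)) j \<le> r * sqrt K2" "r * (- fst (\<omega> (t, i)) j) \<le> r * sqrt K2"
    using assms r2 unfolding coord_bad_def r_def[symmetric] rK by auto
  then have "fst (\<omega> (t, i)) j \<le> sqrt K2" "- fst (\<omega> (t, i)) j \<le> sqrt K2"
    using r by (simp_all only: mult_le_cancel_left_pos)
  then show ?thesis by linarith
qed

lemma energy_le:
  assumes \<omega>: "\<omega> \<in> space P" "\<omega> \<notin> energy_bad j"
    and coords: "\<And>t i. t < T \<Longrightarrow> i < n \<Longrightarrow> \<bar>fst (\<omega> (t, i)) j\<bar> \<le> sqrt K2"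
  shows "(\<Sum>t<T. \<Sum>i<n. (fst (\<omega> (t, i)) j)\<^sup>2) \<le> W"
proof -
  have "(\<Sum>t<T. \<Sum>i<n. (fst (\<omega> (t, i)) j)\<^sup>2) / K2 = (\<Sum>t<T. \<Sum>i<n. min ((fst (\<omega> (t, i)) j)\<^sup>2 / K2) 1)"
    unfolding sum_divide_distrib
  proof (intro sum.cong refl)
    fix t i assume "t \<in> {..<T}" "i \<in> {..<n}"
    then have "\<bar>fst (\<omega> (t, i)) j\<bar>\<^sup>2 \<le> (sqrt K2)\<^sup>2" using coords by (intro power_mono) auto
    then have "(fst (\<omega> (t, i)) j)\<^sup>2 / K2 \<le> 1" using K2_pos by simp
    then show "(fst (\<omega> (t, i)) j)\<^sup>2 / K2 = min ((fst (\<omega> (t, i)) j)\<^sup>2 / K2) 1" by simp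
  qed
  also have "\<dots> \<le> 2 * N * \<tau> / K2 + 3 * Lg"
    using \<omega> by (auto simp: energy_bad_def)
  finally show ?thesis using K2_pos by (simp add: W_def field_simps)
qed

text \<open>The parameter balances the two costs: given the energy bound, the quadratic correction
  is at most \<open>3 * Lg\<close>, the same as the deviation level. Hence
  \<open>l * \<bar>Z\<bar> \<le> 6 * Lg\<close>, which is \<open>l * (N * lam / 2)\<close>.\<close>

lemma noise_le:
  assumes \<omega>: "\<omega> \<in> space P" "\<omega> \<notin> noise_bad (sqrt (6 * Lg / W) / \<sigma>) j"
    "\<omega> \<notin> noise_bad (- (sqrt (6 * Lg / W) / \<sigma>)) j"
    and energy: "(\<Sum>t<T. \<Sum>i<n. (fst (\<omega> (t, i)) j)\<^sup>2) \<le> W"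
  shows "\<bar>\<Sum>t<T. \<Sum>i<n. fst (\<omega> (t, i)) j * snd (\<omega> (t, i))\<bar> \<le> N * lam / 2"
proof -
  define l where "l = sqrt (6 * Lg / W) / \<sigma>"
  define Z where "Z = (\<Sum>t<T. \<Sum>i<n. fst (\<omega> (t, i)) j * snd (\<omega> (t, i)))"
  define Q where "Q = (\<Sum>t<T. \<Sum>i<n. (fst (\<omega> (t, i)) j)\<^sup>2)"
  have l: "0 < l" using Lg_ge_1 W_pos pos by (simp add: l_def)
  have l2: "l\<^sup>2 * \<sigma>\<^sup>2 = 6 * Lg / W"
    using pos Lg_ge_1 W_pos by (simp add: l_def power_divide)
  have "l\<^sup>2 * \<sigma>\<^sup>2 / 2 * Q \<le> l\<^sup>2 * \<sigma>\<^sup>2 / 2 * W"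
    using energy by (intro mult_left_mono) (auto simp: Q_def)
  also have "\<dots> = 3 * Lg" unfolding l2 using W_pos by simp
  finally have Q: "l\<^sup>2 * \<sigma>\<^sup>2 / 2 * Q \<le> 3 * Lg" .
  have sum: "(\<Sum>t<T. \<Sum>i<n. c * (fst (\<omega> (t, i)) j * snd (\<omega> (t, i))) - c\<^sup>2 * \<sigma>\<^sup>2 / 2 * (fst (\<omega> (t, i)) j)\<^sup>2)
      = c * Z - c\<^sup>2 * \<sigma>\<^sup>2 / 2 * Q" for c
    unfolding Z_def Q_def sum_subtractf sum_distrib_left ..
  have nb: "c * Z - c\<^sup>2 * \<sigma>\<^sup>2 / 2 * Q < 3 * Lg" if "\<omega> \<notin> noise_bad c j" for c
  proof -
    have "\<not> 3 * Lg \<le> (\<Sum>t<T. \<Sum>i<n. c * (fst (\<omega> (t, i)) j * snd (\<omega> (t, i)))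
        - c\<^sup>2 * \<sigma>\<^sup>2 / 2 * (fst (\<omega> (t, i)) j)\<^sup>2)"
      using that \<omega>(1) unfolding noise_bad_def by blast
    then show ?thesis by (simp only: sum not_le)
  qed
  have "l * Z - l\<^sup>2 * \<sigma>\<^sup>2 / 2 * Q < 3 * Lg" "(- l) * Z - (- l)\<^sup>2 * \<sigma>\<^sup>2 / 2 * Q < 3 * Lg"
    using \<omega>(2,3) unfolding l_def[symmetric] by (blast intro: nb)+
  then have "l * \<bar>Z\<bar> \<le> 6 * Lg" using Q by (cases "0 \<le> Z") auto
  also have "6 * Lg = l * (N * lam / 2)"
  proof -
    have "l * (N * lam / 2) = sqrt (6 * Lg / W) * sqrt (6 * Lg * W)"
      using pos dims by (simp add: l_def lam_def)
    also have "\<dots> = sqrt ((6 * Lg)\<^sup>2)"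
      using W_pos by (simp add: power2_eq_square flip: real_sqrt_mult)
    also have "\<dots> = 6 * Lg" unfolding real_sqrt_abs using Lg_ge_1 by simp
    finally show ?thesis by simp
  qed
  finally show ?thesis using l by (simp add: Z_def)
qed

text \<open>The slow-rate lasso argument, without sparsity. Half of the penalty level absorbs the
  noise, and the triangle inequality trades \<open>l1n d \<theta>\<close> for
  \<open>l1n d \<Delta>\<close>; both conclusions then follow from one inequality with two
  nonnegative terms on the left.\<close>

lemma basic_inequality:
  assumes noise: "\<And>j. j < d \<Longrightarrow> \<bar>\<Sum>t<T. \<Sum>i<n. fst (\<omega> (t, i)) j * snd (\<omega> (t, i))\<bar> \<le> N * lam / 2"
    and min: "lasso_obj d n T \<theta>s lam 0 \<omega> \<theta> \<le> lasso_obj d n T \<theta>s lam 0 \<omega> \<theta>s"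
  defines "\<Delta> \<equiv> \<lambda>j. \<theta> j - \<theta>s j"
  shows "l1n d \<Delta> \<le> 4 * l1n d \<theta>s" "emp \<omega> \<Delta> \<le> 4 * N * lam * l1n d \<theta>s"
proof -
  define E where "E = (\<Sum>t<T. \<Sum>i<n. (snd (\<omega> (t, i)))\<^sup>2)"
  define Z where "Z j = (\<Sum>t<T. \<Sum>i<n. fst (\<omega> (t, i)) j * snd (\<omega> (t, i)))" for j
  have N: "0 < N" using N_ge_1 by linarith
  have cross: "(\<Sum>t<T. \<Sum>i<n. snd (\<omega> (t, i)) * ip d \<Delta> (fst (\<omega> (t, i)))) = ip d Z \<Delta>"
  proof -
    have "(\<Sum>t<T. \<Sum>i<n. snd (\<omega> (t, i)) * ip d \<Delta> (fst (\<omega> (t, i))))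
        = (\<Sum>t<T. \<Sum>i<n. \<Sum>j<d. \<Delta> j * (fst (\<omega> (t, i)) j * snd (\<omega> (t, i))))"
      by (simp add: ip_def sum_distrib_left mult_ac)
    also have "\<dots> = (\<Sum>t<T. \<Sum>j<d. \<Sum>i<n. \<Delta> j * (fst (\<omega> (t, i)) j * snd (\<omega> (t, i))))"
      by (intro sum.cong refl sum.swap)
    also have "\<dots> = (\<Sum>j<d. \<Sum>t<T. \<Sum>i<n. \<Delta> j * (fst (\<omega> (t, i)) j * snd (\<omega> (t, i))))"
      by (rule sum.swap)
    finally show ?thesis
      by (simp add: ip_def Z_def sum_distrib_left mult.commute)
  qed
  have obj: "lasso_obj d n T \<theta>s lam 0 \<omega> \<theta> = 1 / (2 * N) * (emp \<omega> \<Delta> - 2 * ip d Z \<Delta> + E) + lam * l1n d \<theta>"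
  proof -
    have "(ip d (fst (\<omega> a)) \<theta> - (ip d (fst (\<omega> a)) \<theta>s + snd (\<omega> a)))\<^sup>2
       = (ip d \<Delta> (fst (\<omega> a)))\<^sup>2 - 2 * (snd (\<omega> a) * ip d \<Delta> (fst (\<omega> a))) + (snd (\<omega> a))\<^sup>2" for a
      unfolding \<Delta>_def ip_diff_left ip_commute[of d "fst (\<omega> a)"]
      by (simp add: power2_eq_square algebra_simps)
    then have "(\<Sum>t<T. \<Sum>i<n. (ip d (fst (\<omega> (t, i))) \<theta> - (ip d (fst (\<omega> (t, i))) \<theta>s + snd (\<omega> (t, i))))\<^sup>2)
        = emp \<omega> \<Delta> - 2 * ip d Z \<Delta> + E"
      unfolding emp_def E_def cross[symmetric] sum_distrib_left
      by (simp add: sum.distrib sum_subtractf)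
    then show ?thesis by (simp add: lasso_obj_def mult.assoc)
  qed
  have obj_s: "lasso_obj d n T \<theta>s lam 0 \<omega> \<theta>s = 1 / (2 * N) * E + lam * l1n d \<theta>s"
    by (simp add: lasso_obj_def E_def mult.assoc)
  have "ip d Z \<Delta> \<le> N * lam / 2 * l1n d \<Delta>"
    using abs_ip_le_l1n[of d Z "N * lam / 2" \<Delta>, OF noise[folded Z_def]] by linarith
  then have "1 / (2 * N) * (emp \<omega> \<Delta> - N * lam * l1n d \<Delta> + E) \<le> 1 / (2 * N) * (emp \<omega> \<Delta> - 2 * ip d Z \<Delta> + E)"
    using N by (intro mult_left_mono) auto
  also have "\<dots> \<le> 1 / (2 * N) * E + lam * l1n d \<theta>s - lam * l1n d \<theta>"
    using min unfolding obj obj_s by linarith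
  also have "1 / (2 * N) * (emp \<omega> \<Delta> - N * lam * l1n d \<Delta> + E)
      = 1 / (2 * N) * emp \<omega> \<Delta> - lam / 2 * l1n d \<Delta> + 1 / (2 * N) * E"
  proof -
    have "1 / (2 * x) * (a - x * b * c + E) = 1 / (2 * x) * a - b / 2 * c + 1 / (2 * x) * E"
      if "0 < x" for x a b c :: real
      using that by (simp add: field_simps)
    then show ?thesis using N by blast
  qed
  finally have 1: "1 / (2 * N) * emp \<omega> \<Delta> \<le> lam / 2 * l1n d \<Delta> + lam * l1n d \<theta>s - lam * l1n d \<theta>"
    by linarith
  have "l1n d \<Delta> \<le> l1n d \<theta> + l1n d \<theta>s"
    unfolding l1n_def \<Delta>_def sum.distrib[symmetric] by (intro sum_mono) auto
  then have "lam * l1n d \<Delta> \<le> lam * (l1n d \<theta> + l1n d \<theta>s)"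
    using lam_pos by (intro mult_left_mono) auto
  with 1 have 2: "1 / (2 * N) * emp \<omega> \<Delta> + lam / 2 * l1n d \<Delta> \<le> 2 * lam * l1n d \<theta>s"
    by (simp add: algebra_simps)
  have "0 \<le> emp \<omega> \<Delta>" "0 \<le> l1n d \<Delta>"
    by (auto simp: emp_def l1n_def intro!: sum_nonneg)
  then have e0: "0 \<le> 1 / (2 * N) * emp \<omega> \<Delta>" and l0: "0 \<le> lam / 2 * l1n d \<Delta>"
    using N lam_pos by auto
  have "lam * l1n d \<Delta> \<le> lam * (4 * l1n d \<theta>s)" using 2 e0 by simp
  then show "l1n d \<Delta> \<le> 4 * l1n d \<theta>s" using lam_pos by simp
  have "1 / (2 * N) * emp \<omega> \<Delta> \<le> 2 * lam * l1n d \<theta>s" using 2 l0 by linarith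
  then show "emp \<omega> \<Delta> \<le> 4 * N * lam * l1n d \<theta>s" using N by (simp add: field_simps)
qed

text \<open>In the regime \<open>\<rho> ^ 4 \<le> N\<close> also
  \<open>\<rho>\<^sup>2 \<le> N\<close>, so the deviation part of \<open>W\<close> is at most a
  logarithmic factor above its mean part and \<open>\<rho>\<close> disappears from the first error
  term.\<close>

lemma lam_le:
  assumes "\<rho> ^ 4 \<le> N"
  shows "N * lam \<le> 22 * \<sigma> * Lg\<^sup>2 * sqrt \<tau> * sqrt N"
proof -
  have "\<rho>\<^sup>2 \<le> N"
  proof (cases "\<rho>\<^sup>2 \<le> 1")
    case True then show ?thesis using N_ge_1 by linarith
  next
    case False
    then have "\<rho>\<^sup>2 * 1 \<le> \<rho>\<^sup>2 * \<rho>\<^sup>2" by (intro mult_left_mono) auto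
    then show ?thesis using assms by (simp flip: power_add)
  qed
  then have "18 * \<tau> * Lg\<^sup>2 * \<rho>\<^sup>2 \<le> 18 * \<tau> * Lg\<^sup>2 * N"
    using tau_pos by (intro mult_left_mono) auto
  moreover have "2 * N * \<tau> * 1 \<le> 2 * N * \<tau> * Lg\<^sup>2"
    using tau_pos Lg_ge_1 by (intro mult_left_mono) auto
  ultimately have "W \<le> 20 * N * \<tau> * Lg\<^sup>2"
    by (simp add: W_def K2_def power2_eq_square algebra_simps)
  then have "6 * Lg * W \<le> 6 * Lg * (20 * N * \<tau> * Lg\<^sup>2)"
    using Lg_ge_1 by (intro mult_left_mono) auto
  also have "\<dots> = 120 * Lg ^ 3 * (N * \<tau>)" by (simp add: power2_eq_square power3_eq_cube)
  \<comment> \<open>Rounding 120 up to \<open>11\<^sup>2\<close> and \<open>Lg ^ 3\<close> up to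
    \<open>Lg ^ 4\<close> makes the factor a perfect square.\<close>
  also have "\<dots> \<le> 121 * Lg ^ 4 * (N * \<tau>)"
    using Lg_ge_1 tau_pos by (intro mult_right_mono mult_mono power_increasing) auto
  also have "\<dots> = (11 * Lg\<^sup>2)\<^sup>2 * (N * \<tau>)" by (simp add: power_mult_distrib flip: power_mult)
  finally have "sqrt (6 * Lg * W) \<le> sqrt ((11 * Lg\<^sup>2)\<^sup>2 * (N * \<tau>))"
    by (rule real_sqrt_le_mono)
  also have "\<dots> = 11 * Lg\<^sup>2 * (sqrt N * sqrt \<tau>)"
    unfolding real_sqrt_mult[of _ "N * \<tau>"] real_sqrt_mult[of N] real_sqrt_abs by simp
  finally have "2 * \<sigma> * sqrt (6 * Lg * W) \<le> 2 * \<sigma> * (11 * Lg\<^sup>2 * (sqrt N * sqrt \<tau>))"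
    using pos by (intro mult_left_mono) auto
  moreover have "N * lam = 2 * \<sigma> * sqrt (6 * Lg * W)" using dims by (simp add: lam_def)
  ultimately show ?thesis by (simp add: mult_ac)
qed

text \<open>If \<open>\<rho> ^ 4 > N\<close> or the true parameter has l1 norm 0, the bound by l1
  norms suffices. Otherwise the error, rescaled into the unit l1 ball, is controlled by the uniform
  lower bound, with the basic inequality supplying its empirical form.\<close>

theorem lasso_rate:
  "\<exists>A\<in>sets P. 1 - \<delta> \<le> measure P A \<and> (\<forall>\<omega>\<in>A. \<forall>\<theta>.
     lasso_obj d n T \<theta>s lam 0 \<omega> \<theta> \<le> lasso_obj d n T \<theta>s lam 0 \<omega> \<theta>s \<longrightarrow>
     1 / (2 * real T) * (\<Sum>t<T. q t (\<lambda>j. \<theta> j - \<theta>s j))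
       \<le> 1000000000000 * Lg ^ 6 * (\<sigma> * l1n d \<theta>s * sqrt \<tau> / sqrt N + \<rho> ^ 4 * (l1n d \<theta>s)\<^sup>2 * \<tau> / N))"
proof -
  obtain A K where A: "A \<in> sets P" "1 - \<delta> \<le> measure P A" "A \<subseteq> space P"
    and K: "N \<le> 2 ^ K" "real K \<le> 2 * Lg"
    and noise: "\<And>\<omega> j. \<omega> \<in> A \<Longrightarrow> j < d \<Longrightarrow> \<omega> \<notin> noise_bad (sqrt (6 * Lg / W) / \<sigma>) j"
    "\<And>\<omega> j. \<omega> \<in> A \<Longrightarrow> j < d \<Longrightarrow> \<omega> \<notin> noise_bad (- (sqrt (6 * Lg / W) / \<sigma>)) j"
    and energy: "\<And>\<omega> j. \<omega> \<in> A \<Longrightarrow> j < d \<Longrightarrow> \<omega> \<notin> energy_bad j"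
    and coord: "\<And>\<omega> t i j. \<omega> \<in> A \<Longrightarrow> t < T \<Longrightarrow> i < n \<Longrightarrow> j < d \<Longrightarrow> \<omega> \<notin> coord_bad (sqrt K2 / (\<rho>\<^sup>2 * \<tau>)) t i j"
    "\<And>\<omega> t i j. \<omega> \<in> A \<Longrightarrow> t < T \<Longrightarrow> i < n \<Longrightarrow> j < d \<Longrightarrow> \<omega> \<notin> coord_bad (- (sqrt K2 / (\<rho>\<^sup>2 * \<tau>))) t i j"
    and tails: "\<And>\<omega> k D. \<omega> \<in> A \<Longrightarrow> \<rho> ^ 4 \<le> N \<Longrightarrow> k < K \<Longrightarrow> D \<in> atom_sums d (msz k) \<Longrightarrow>
        \<omega> \<notin> tail_bad (lvl k) (tail k) (\<lambda>j. D j / real (msz k))"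
    by (rule good_event) blast
  let ?R = "l1n d \<theta>s"
  have R: "0 \<le> ?R" by (simp add: l1n_def sum_nonneg)
  have N: "0 < N" using N_ge_1 by linarith
  have Lg6: "1 \<le> Lg ^ 6" using Lg_ge_1 by simp
  let ?a = "\<sigma> * ?R * sqrt \<tau> / sqrt N" and ?b = "\<rho> ^ 4 * ?R\<^sup>2 * \<tau> / N"
  have ab: "0 \<le> ?a" "0 \<le> ?b" using pos R tau_pos N by auto
  have "1 / (2 * real T) * (\<Sum>t<T. q t (\<lambda>j. \<theta> j - \<theta>s j)) \<le> 1000000000000 * Lg ^ 6 * (?a + ?b)"
    if \<omega>A: "\<omega> \<in> A" and min: "lasso_obj d n T \<theta>s lam 0 \<omega> \<theta> \<le> lasso_obj d n T \<theta>s lam 0 \<omega> \<theta>s" for \<omega> \<theta>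
  proof -
    define \<Delta> where "\<Delta> = (\<lambda>j. \<theta> j - \<theta>s j)"
    have \<omega>: "\<omega> \<in> space P" using \<omega>A A by blast
    have coords: "\<bar>fst (\<omega> (t, i)) j\<bar> \<le> sqrt K2" if "t < T" "i < n" "j < d" for t i j
      using \<omega> coord[OF \<omega>A that] by (rule coord_le)
    have en: "(\<Sum>t<T. \<Sum>i<n. (fst (\<omega> (t, i)) j)\<^sup>2) \<le> W" if "j < d" for j
      using \<omega> energy[OF \<omega>A that] coords[OF _ _ that] by (rule energy_le)
    have nz: "\<bar>\<Sum>t<T. \<Sum>i<n. fst (\<omega> (t, i)) j * snd (\<omega> (t, i))\<bar> \<le> N * lam / 2" if "j < d" for j
      using \<omega> noise[OF \<omega>A that] en[OF that] by (rule noise_le)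
    have \<Delta>1: "l1n d \<Delta> \<le> 4 * ?R" and emp: "emp \<omega> \<Delta> \<le> 4 * N * lam * ?R"
      using basic_inequality[OF nz min] by (simp_all add: \<Delta>_def)
    have "1 / (2 * real T) * (\<Sum>t<T. q t \<Delta>) \<le> 1000000000000 * Lg ^ 6 * (?a + ?b)"
    proof (cases "\<rho> ^ 4 \<le> N \<and> 0 < ?R")
      case False
      have "q t \<Delta> \<le> 16 * ?R\<^sup>2 * \<tau>" for t
      proof -
        have "(l1n d \<Delta>)\<^sup>2 \<le> (4 * ?R)\<^sup>2"
          using \<Delta>1 by (intro power_mono) (auto simp: l1n_def sum_nonneg)
        then have "(l1n d \<Delta>)\<^sup>2 * \<tau> \<le> (4 * ?R)\<^sup>2 * \<tau>" using tau_pos by (intro mult_right_mono) auto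
        with q_le_l1[of t \<Delta>] show ?thesis by (simp add: power_mult_distrib)
      qed
      then have "(\<Sum>t<T. q t \<Delta>) \<le> real T * (16 * ?R\<^sup>2 * \<tau>)"
        using sum_bounded_above[of "{..<T}" "\<lambda>t. q t \<Delta>"] by simp
      then have "1 / (2 * real T) * (\<Sum>t<T. q t \<Delta>) \<le> 1 / (2 * real T) * (real T * (16 * ?R\<^sup>2 * \<tau>))"
        by (intro mult_left_mono) auto
      also have "\<dots> = 8 * (?R\<^sup>2 * \<tau>)" using dims by simp
      also have "?R\<^sup>2 * \<tau> \<le> ?b"
      proof (cases "?R = 0")
        case True then show ?thesis by simp
      next
        case R0: False
        then have "N \<le> \<rho> ^ 4" using False R by auto
        then have "N * (?R\<^sup>2 * \<tau>) \<le> \<rho> ^ 4 * (?R\<^sup>2 * \<tau>)"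
          using tau_pos by (intro mult_right_mono) auto
        then show ?thesis using N by (simp add: pos_le_divide_eq mult_ac)
      qed
      also have "8 * ?b \<le> 1000000000000 * Lg ^ 6 * (?a + ?b)"
        using ab Lg6 by (intro mult_mono) auto
      finally show ?thesis by simp
    next
      case True
      \<comment> \<open>The basic inequality gives \<open>l1n d \<Delta> \<le> 4 * ?R\<close>, so
        this scaling lands in the unit l1 ball. Both forms are homogeneous of degree 2, which
        multiplies the deterministic term by \<open>16 * ?R\<^sup>2\<close>.\<close>
      define v where "v = (\<lambda>j. 1 / (4 * ?R) * \<Delta> j)"
      have Rp: "0 < ?R" and N4: "\<rho> ^ 4 \<le> N" using True by auto
      have \<Delta>v: "\<Delta> = (\<lambda>j. (4 * ?R) * v j)" using Rp by (simp add: v_def)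
      have "l1n d v = \<bar>1 / (4 * ?R)\<bar> * l1n d \<Delta>"
        unfolding v_def by (simp only: l1n_def abs_mult sum_distrib_left)
      then have v1: "l1n d v \<le> 1" using \<Delta>1 Rp by (simp add: divide_le_eq_1)
      have "real n * (\<Sum>t<T. q t v) \<le> 128 * Lg * emp \<omega> v + 40000000000 * (\<rho> ^ 4 * \<tau> * Lg ^ 6)"
        using coords \<omega> K tails[OF \<omega>A N4] v1 by (rule uniform_lower_bound)
      then have scaled: "(4 * ?R)\<^sup>2 * (real n * (\<Sum>t<T. q t v))
          \<le> (4 * ?R)\<^sup>2 * (128 * Lg * emp \<omega> v + 40000000000 * (\<rho> ^ 4 * \<tau> * Lg ^ 6))"
        by (intro mult_left_mono) auto
      have q\<Delta>: "(4 * ?R)\<^sup>2 * (real n * (\<Sum>t<T. q t v)) = real n * (\<Sum>t<T. q t \<Delta>)"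
        unfolding \<Delta>v qform_scale sum_distrib_left by (simp add: mult_ac)
      have emp\<Delta>: "(4 * ?R)\<^sup>2 * emp \<omega> v = emp \<omega> \<Delta>"
        unfolding emp_def \<Delta>v ip_scale_left by (simp add: power_mult_distrib sum_distrib_left mult_ac)
      have "(4 * ?R)\<^sup>2 * (128 * Lg * emp \<omega> v + 40000000000 * (\<rho> ^ 4 * \<tau> * Lg ^ 6))
          = 128 * Lg * ((4 * ?R)\<^sup>2 * emp \<omega> v) + 640000000000 * (\<rho> ^ 4 * ?R\<^sup>2 * \<tau> * Lg ^ 6)"
        by (simp add: power_mult_distrib algebra_simps)
      with scaled have "real n * (\<Sum>t<T. q t \<Delta>)
          \<le> 128 * Lg * emp \<omega> \<Delta> + 640000000000 * (\<rho> ^ 4 * ?R\<^sup>2 * \<tau> * Lg ^ 6)"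
        by (simp only: q\<Delta> emp\<Delta>)
      also have "128 * Lg * emp \<omega> \<Delta> \<le> 128 * Lg * (4 * ?R * (N * lam))"
        using emp Lg_ge_1 by (intro mult_left_mono) (auto simp: mult_ac)
      also have "\<dots> \<le> 128 * Lg * (4 * ?R * (22 * \<sigma> * Lg\<^sup>2 * sqrt \<tau> * sqrt N))"
        using lam_le[OF N4] Lg_ge_1 R by (intro mult_left_mono) auto
      also have "\<dots> = 11264 * Lg ^ 3 * (N * ?a)"
      proof -
        have "N * ?a = \<sigma> * ?R * sqrt \<tau> * (N / sqrt N)" by simp
        also have "N / sqrt N = sqrt N" using N by (simp add: real_div_sqrt)
        finally show ?thesis by (simp add: power2_eq_square power3_eq_cube mult_ac)
      qed
      also have "\<dots> \<le> 640000000000 * Lg ^ 6 * (N * ?a)"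
      proof (rule mult_right_mono)
        show "11264 * Lg ^ 3 \<le> 640000000000 * Lg ^ 6"
          using Lg_ge_1 by (intro mult_mono power_increasing) auto
        show "0 \<le> N * ?a" using N ab(1) by (intro mult_nonneg_nonneg) auto
      qed
      also have "\<rho> ^ 4 * ?R\<^sup>2 * \<tau> * Lg ^ 6 = Lg ^ 6 * (N * ?b)"
      proof -
        have "a * (x / a) = x" if "0 < a" for a x :: real using that by simp
        from this[OF N] have "N * ?b = \<rho> ^ 4 * ?R\<^sup>2 * \<tau>" .
        then show ?thesis by (simp only: mult.commute[of "Lg ^ 6"])
      qed
      also have "640000000000 * Lg ^ 6 * (N * ?a) + 640000000000 * (Lg ^ 6 * (N * ?b))
          = N * (640000000000 * Lg ^ 6 * (?a + ?b))"
      proof -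
        have "c * L * (x * a) + c * (L * (x * b)) = x * (c * L * (a + b))" for a b c L x :: real
          by (simp add: algebra_simps)
        then show ?thesis .
      qed
      finally have "real n * (\<Sum>t<T. q t \<Delta>) \<le> N * (640000000000 * Lg ^ 6 * (?a + ?b))" by simp
      then have "1 / (2 * N) * (real n * (\<Sum>t<T. q t \<Delta>)) \<le> 1 / (2 * N) * (N * (640000000000 * Lg ^ 6 * (?a + ?b)))"
        using N by (intro mult_left_mono) auto
      also have "1 / (2 * N) * (real n * (\<Sum>t<T. q t \<Delta>)) = 1 / (2 * real T) * (\<Sum>t<T. q t \<Delta>)"
        using dims by simp
      also have "1 / (2 * N) * (N * (640000000000 * Lg ^ 6 * (?a + ?b))) = 320000000000 * Lg ^ 6 * (?a + ?b)"
        using N by simp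
      also have "\<dots> \<le> 1000000000000 * Lg ^ 6 * (?a + ?b)"
        using ab Lg6 by (intro mult_right_mono) auto
      finally show ?thesis .
    qed
    then show ?thesis by (simp only: \<Delta>_def)
  qed
  with A show ?thesis by blast
qed

end

section \<open>From whitened covariates to the model, and the final rate\<close>

lemma ip_mvec_right_inverse:
  assumes "\<And>i j. i < d \<Longrightarrow> j < d \<Longrightarrow> mmul d S W i j = (if i = j then 1 else 0)" and S: "msym d S"
  shows "ip d (mvec d S w) (mvec d W x) = ip d w x"
proof -
  have "ip d (mvec d S w) (mvec d W x) = ip d w (mvec d S (mvec d W x))"
    using S by (simp add: ip_mvec_sym)
  also have "\<dots> = ip d w x"
  proof (rule ip_cong)
    fix i assume i: "i < d"
    have "mvec d S (mvec d W x) i = mvec d (mmul d S W) x i" by (simp add: mvec_mmul)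
    also have "\<dots> = (\<Sum>j<d. (if i = j then 1 else 0) * x j)"
      unfolding mvec_def using assms(1) i by (intro sum.cong) auto
    also have "\<dots> = x i"
      using i by (simp add: if_distrib[of "\<lambda>c. c * _"] cong: if_cong)
    finally show "mvec d S (mvec d W x) i = x i" .
  qed auto
  finally show ?thesis .
qed

text \<open>Symmetry of the root moves it across the inner product:
  \<open><S w, W x> = <w, x>\<close> for the inverse root \<open>W\<close>. Normalising
  \<open>S w\<close> to a unit vector then rescales the proxy by \<open>|S w|^2\<close>, which is
  the quadratic form of the covariance.\<close>

lemma whitened_subgaussian_marginal:
  assumes A: "pd d A" and d: "1 \<le> d"
    and sub: "subgaussian_vec d M (\<lambda>x. mvec d (inv_sqrt d A) x) s"
    and q: "0 < qform d (mat_sqrt d A) w"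
  shows "subgaussian_rv M (\<lambda>x. ip d w x) (s * qform d (mat_sqrt d A) w)"
proof -
  let ?S = "mat_sqrt d A" and ?q = "qform d (mat_sqrt d A) w"
  note sq = mat_sqrt_inv_sqrt[OF A d]
  have sym: "msym d ?S" using sq(1) by (simp add: pd_def)
  define c where "c = sqrt ?q"
  have c: "0 < c" "c\<^sup>2 = ?q" using q by (auto simp: c_def)
  define u where "u = (\<lambda>j. 1 / c * mvec d ?S w j)"
  have "ip d (mvec d ?S w) (mvec d ?S w) = ?q"
    by (simp add: ip_def qform_def mvec_eq_ip power2_eq_square)
  then have "ip d u u = 1"
    unfolding u_def ip_scale_left ip_scale_right using c q by (simp add: power2_eq_square)
  then have "l2n d u = 1" by (simp add: l2n_def)
  then have rv: "subgaussian_rv M (\<lambda>x. ip d u (mvec d (inv_sqrt d A) x)) s"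
    using sub by (simp add: subgaussian_vec_def)
  have ipu: "ip d u (mvec d (inv_sqrt d A) x) = 1 / c * ip d w x" for x
  proof -
    have "ip d (mvec d ?S w) (mvec d (inv_sqrt d A) x) = ip d w x"
      by (rule ip_mvec_right_inverse) (use sq(3) sym in auto)
    then show ?thesis unfolding u_def ip_scale_left by simp
  qed
  show ?thesis
    unfolding subgaussian_rv_def
  proof
    fix l
    have e: "exp ((l * c) * ip d u (mvec d (inv_sqrt d A) x)) = exp (l * ip d w x)" for x
      using c by (simp add: ipu)
    have v: "(l * c)\<^sup>2 * s / 2 = l\<^sup>2 * (s * ?q) / 2" by (simp add: power_mult_distrib c(2) mult_ac)
    show "integrable M (\<lambda>x. exp (l * ip d w x)) \<and> (\<integral>x. exp (l * ip d w x) \<partial>M) \<le> exp (l\<^sup>2 * (s * ?q) / 2)"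
      using rv[unfolded subgaussian_rv_def, rule_format, of "l * c"] by (simp only: e v)
  qed
qed

lemma mtrace_le_of_loewner_le:
  assumes "loewner_le d A B"
  shows "mtrace d A \<le> mtrace d B"
  unfolding mtrace_def
proof (intro sum_mono)
  fix i assume "i \<in> {..<d}"
  then have i: "i < d" by simp
  let ?e = "\<lambda>j. if j = i then 1 else (0::real)"
  have "0 \<le> ip d ?e (mvec d (\<lambda>i j. B i j - A i j) ?e)"
    using assms by (simp add: loewner_le_def psd_def)
  also have "\<dots> = B i i - A i i"
    unfolding ip_commute[of d ?e] ip_single[OF i] mvec_single[OF i] by simp
  finally show "A i i \<le> B i i" by simp
qed

text \<open>The symmetric root serves as the factor \<open>G t\<close>: its Gram matrix is the
  covariance, and its squared Frobenius norm is the trace, which is monotone in the Loewner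
  order.\<close>

lemma multi_domain_of_whitened:
  assumes dims: "1 \<le> d" "1 \<le> n" "1 \<le> T" and pos: "0 < \<sigma>" "0 < \<rho>" "0 < \<delta>" "\<delta> < 1"
    and dom: "\<And>t. prob_space (p t)" "\<And>t. sets (p t) = sets (PiM {..<d} (\<lambda>_. (borel :: real measure)))"
    "\<And>t i j. i < d \<Longrightarrow> j < d \<Longrightarrow> integrable (p t) (\<lambda>x. x i * x j) \<and> (\<integral>x. x i * x j \<partial>p t) = Sig t i j"
    and cov: "\<And>t. pd d (Sig t)" "\<And>t. loewner_le d (Sig t) S"
    and sub: "\<And>t. subgaussian_vec d (p t) (\<lambda>x. mvec d (inv_sqrt d (Sig t)) x) (\<rho>\<^sup>2)"
  shows "multi_domain d n T p (\<lambda>t. mat_sqrt d (Sig t)) (mtrace d S) \<sigma> \<rho> \<delta>"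
proof (rule multi_domain.intro)
  fix t
  let ?G = "mat_sqrt d (Sig t)"
  note sq = mat_sqrt_inv_sqrt[OF cov(1)[of t] dims(1)]
  have Gsym: "?G i j = ?G j i" if "i < d" "j < d" for i j
    using sq(1) that by (auto simp: pd_def msym_def)
  have gram: "(\<Sum>k<d. ?G k i * ?G k j) = Sig t i j" if "i < d" "j < d" for i j
  proof -
    have "(\<Sum>k<d. ?G k i * ?G k j) = mmul d ?G ?G i j"
      unfolding mmul_def using Gsym that by (intro sum.cong) auto
    then show ?thesis using sq(2)[OF that] by simp
  qed
  show "integrable (p t) (\<lambda>x. x i * x j) \<and> (\<integral>x. x i * x j \<partial>p t) = (\<Sum>k<d. ?G k i * ?G k j)"
    if "i < d" "j < d" for i j
    using dom(3)[OF that, of t] gram[OF that] by simp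
  have "(\<Sum>k<d. \<Sum>j<d. (?G k j)\<^sup>2) = (\<Sum>j<d. \<Sum>k<d. (?G k j)\<^sup>2)" by (rule sum.swap)
  also have "\<dots> = mtrace d (Sig t)"
    unfolding mtrace_def using gram by (intro sum.cong) (auto simp: power2_eq_square)
  also have "\<dots> \<le> mtrace d S" using cov(2) by (rule mtrace_le_of_loewner_le)
  finally show "(\<Sum>k<d. \<Sum>j<d. (?G k j)\<^sup>2) \<le> mtrace d S" .
  show "0 < qform d ?G w" if i: "i < d" "w i \<noteq> 0" for w i
  proof (rule ccontr)
    assume "\<not> 0 < qform d ?G w"
    then have "qform d ?G w = 0" using qform_nonneg[of d ?G w] by linarith
    then have "mvec d ?G w k = 0" if "k < d" for k
      using that by (simp add: qform_def sum_nonneg_eq_0_iff mvec_eq_ip)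
    then have "w i = 0" using pd_mvec_eq_0[OF sq(1)] i by blast
    with i show False by simp
  qed
  show "subgaussian_rv (p t) (\<lambda>x. ip d w x) (\<rho>\<^sup>2 * qform d ?G w)" if "0 < qform d ?G w" for w
    using cov(1) dims(1) sub that by (rule whitened_subgaussian_marginal)
qed (rule dims pos dom(1) dom(2))+

theorem theorem5p1:
  shows "\<exists>C::real. \<exists>k::nat. 0 < C \<and>
    (\<forall>(d::nat) (n::nat) (T::nat) (p :: nat \<Rightarrow> (nat \<Rightarrow> real) measure)
       (Sig :: nat \<Rightarrow> nat \<Rightarrow> nat \<Rightarrow> real) (S :: nat \<Rightarrow> nat \<Rightarrow> real)
       (\<theta>s :: nat \<Rightarrow> real) (\<sigma>::real) (\<rho>::real) (\<delta>::real).
       1 \<le> d \<and> 1 \<le> n \<and> 1 \<le> T \<and> 0 < \<sigma> \<and> 0 < \<rho> \<and> 0 < \<delta> \<and> \<delta> < 1 \<and>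
       (\<forall>t<T. prob_space (p t) \<and>
          sets (p t) = sets (PiM {..<d} (\<lambda>_. (borel :: real measure))) \<and>
          (\<forall>j<d. integrable (p t) (\<lambda>x. x j) \<and> (\<integral>x. x j \<partial>p t) = 0) \<and>
          (\<forall>i<d. \<forall>j<d. integrable (p t) (\<lambda>x. x i * x j) \<and>
                        (\<integral>x. x i * x j \<partial>p t) = Sig t i j) \<and>
          pd d (Sig t) \<and>
          loewner_le d (Sig t) S \<and>
          subgaussian_vec d (p t) (\<lambda>x. mvec d (inv_sqrt d (Sig t)) x) (\<rho>\<^sup>2)) \<and>
       psd d S
     \<longrightarrow>
       (\<exists>lam1 lam2. 0 \<le> lam1 \<and> 0 \<le> lam2 \<and>
          (\<forall>\<theta>h :: (nat \<times> nat \<Rightarrow> (nat \<Rightarrow> real) \<times> real) \<Rightarrow> nat \<Rightarrow> real.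
             (\<forall>\<omega>\<in>space (train_space n T p \<sigma>). \<forall>\<theta>.
                 lasso_obj d n T \<theta>s lam1 lam2 \<omega> (\<theta>h \<omega>) \<le> lasso_obj d n T \<theta>s lam1 lam2 \<omega> \<theta>)
             \<longrightarrow>
             (\<exists>A\<in>sets (train_space n T p \<sigma>).
                1 - \<delta> \<le> measure (train_space n T p \<sigma>) A \<and>
                (\<forall>\<omega>\<in>A.
                   1 / (2 * real T) *
                     (\<Sum>t<T. \<integral>x. (ip d x (\<lambda>j. \<theta>h \<omega> j - \<theta>s j))\<^sup>2 \<partial>p t)
                   \<le> C * (1 + ln (real (d * n * T) / \<delta>)) ^ k *
                       (\<sigma> * l1n d \<theta>s * sqrt (mtrace d S) / sqrt (real (n * T))
                        + \<rho> ^ 4 * (l1n d \<theta>s)\<^sup>2 * mtrace d S / real (n * T)))))))"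
\<comment> \<open>The witnesses are the constant and the exponent of \<open>Lg\<close> in
  \<open>lasso_rate\<close>.\<close>
proof (rule exI[of _ 1000000000000], rule exI[of _ 6], intro conjI allI impI, goal_cases)
  case 1
  show ?case by simp
next
  case (2 d n T p Sig S \<theta>s \<sigma> \<rho> \<delta>)
  note r1 = 2[THEN conjunct2]
  note r2 = r1[THEN conjunct2]
  note r3 = r2[THEN conjunct2]
  note r4 = r3[THEN conjunct2]
  note r5 = r4[THEN conjunct2]
  note r6 = r5[THEN conjunct2]
  note dims = 2[THEN conjunct1] r1[THEN conjunct1] r2[THEN conjunct1]
  note pos = r3[THEN conjunct1] r4[THEN conjunct1] r5[THEN conjunct1] r6[THEN conjunct1]
  note domains = r6[THEN conjunct2, THEN conjunct1, THEN spec, THEN mp]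
  note cov = domains[THEN conjunct2, THEN conjunct2, THEN conjunct2]
  \<comment> \<open>Nothing is assumed about \<open>p t\<close> for \<open>t \<ge> T\<close>; these junk domains are replaced by domain 0.\<close>
  define r where "r t = (if t < T then t else 0)" for t
  have rT: "r t < T" for t using dims by (simp add: r_def)
  interpret multi_domain d n T "\<lambda>t. p (r t)" "\<lambda>t. mat_sqrt d (Sig (r t))" "mtrace d S" \<sigma> \<rho> \<delta>
  proof (rule multi_domain_of_whitened[where Sig = "\<lambda>t. Sig (r t)"])
    fix t
    note c = cov[OF rT[of t]]
    show "prob_space (p (r t))" "sets (p (r t)) = sets (PiM {..<d} (\<lambda>_. (borel :: real measure)))"
      by (rule domains[OF rT[of t], THEN conjunct1],
          rule domains[OF rT[of t], THEN conjunct2, THEN conjunct1])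
    show "integrable (p (r t)) (\<lambda>x. x i * x j) \<and> (\<integral>x. x i * x j \<partial>p (r t)) = Sig (r t) i j"
      if "i < d" "j < d" for i j
      using c[THEN conjunct1] that by blast
    show "pd d (Sig (r t))" using c[THEN conjunct2] by (rule conjunct1)
    show "loewner_le d (Sig (r t)) S" using c[THEN conjunct2, THEN conjunct2] by (rule conjunct1)
    show "subgaussian_vec d (p (r t)) (\<lambda>x. mvec d (inv_sqrt d (Sig (r t))) x) (\<rho>\<^sup>2)"
      using c[THEN conjunct2, THEN conjunct2] by (rule conjunct2)
  qed (rule dims pos)+
  have train: "train_space n T (\<lambda>t. p (r t)) \<sigma> = train_space n T p \<sigma>"
    unfolding train_space_def by (intro PiM_cong) (auto simp: r_def)
  have risk: "(\<integral>x. (ip d x w)\<^sup>2 \<partial>p t) = q t w" if "t < T" for t w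
    using second_moment_ip(2)[where w = w and t = t] that by (simp add: r_def ip_commute)
  obtain A where A: "A \<in> sets (train_space n T p \<sigma>)" "1 - \<delta> \<le> measure (train_space n T p \<sigma>) A"
    and rate: "\<And>\<omega> \<theta>. \<omega> \<in> A \<Longrightarrow> lasso_obj d n T \<theta>s lam 0 \<omega> \<theta> \<le> lasso_obj d n T \<theta>s lam 0 \<omega> \<theta>s \<Longrightarrow>
     1 / (2 * real T) * (\<Sum>t<T. q t (\<lambda>j. \<theta> j - \<theta>s j))
       \<le> 1000000000000 * Lg ^ 6 * (\<sigma> * l1n d \<theta>s * sqrt (mtrace d S) / sqrt N
           + \<rho> ^ 4 * (l1n d \<theta>s)\<^sup>2 * mtrace d S / N)"
    using lasso_rate[of \<theta>s] unfolding train by blast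
  show ?case
  \<comment> \<open>The event \<open>A\<close> is fixed before the estimator, so it serves every
    choice of minimisers; optimality is invoked only against \<open>\<theta>s\<close>.\<close>
  proof (rule exI[of _ lam], rule exI[of _ 0], intro conjI allI impI bexI[of _ A] ballI A)
    show "0 \<le> lam" using lam_pos by simp
    fix \<theta>h \<omega>
    assume opt: "\<forall>\<omega>\<in>space (train_space n T p \<sigma>). \<forall>\<theta>.
        lasso_obj d n T \<theta>s lam 0 \<omega> (\<theta>h \<omega>) \<le> lasso_obj d n T \<theta>s lam 0 \<omega> \<theta>" and \<omega>: "\<omega> \<in> A"
    have "\<omega> \<in> space (train_space n T p \<sigma>)" using \<omega> A(1) sets.sets_into_space by blast
    then have "lasso_obj d n T \<theta>s lam 0 \<omega> (\<theta>h \<omega>) \<le> lasso_obj d n T \<theta>s lam 0 \<omega> \<theta>s"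
      using opt by blast
    from rate[OF \<omega> this]
    show "1 / (2 * real T) * (\<Sum>t<T. \<integral>x. (ip d x (\<lambda>j. \<theta>h \<omega> j - \<theta>s j))\<^sup>2 \<partial>p t)
       \<le> 1000000000000 * (1 + ln (real (d * n * T) / \<delta>)) ^ 6 *
           (\<sigma> * l1n d \<theta>s * sqrt (mtrace d S) / sqrt (real (n * T))
             + \<rho> ^ 4 * (l1n d \<theta>s)\<^sup>2 * mtrace d S / real (n * T))"
      by (simp add: risk Lg_def)
  qed simp
qed

end
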